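(* Let $d\ge1$, $0<\alpha\le2$, and let $V\in\mathcal{S}(\mathbb{R}^d)$ be real-valued. For any integer $N\ge2$, $$Q_V^{(\alpha)}(t)=-t\int_{\mathbb{R}^d}V(\theta)\,d\theta+\sum_{\ell=2}^{N}(-t)^\ell C_\ell(V)+\mathcal{O}(t^{N+1})\quad\text{as }t\downarrow0,$$ where $$C_\ell(V)=\sum_{\substack{n+k=\ell\\ n\ge 0,\;k\ge2}}\frac{1}{n!}\,C_{n,k}(V),$$ and, for integers $n\ge0$ and $k\ge2$, $$C_{n,k}(V)=\sum_{\substack{(\ell_1,\dots,\ell_{k-1})\in\mathbb{N}^{k-1}\\ \ell_1+\dots+\ell_{k-1}=n}}A(n,\ell^{(k-1)})\int_{\mathbb{R}^{(k-1)d}}\widehat V\Bigl(-\sum_{i=1}^{k-1}\theta_i\Bigr)\prod_{i=1}^{k-1}\widehat V(\theta_i)\Bigl|\sum_{m=1}^{i}\theta_m\Bigr|^{\alpha\ell_i}\bar d\theta^{(k-1)}.$$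
   Context: $\mathcal{S}(\mathbb{R}^d)$ is the space of rapidly decreasing smooth functions; $\widehat V(\xi)=\int_{\mathbb{R}^d}e^{-ix\cdot\xi}V(x)\,dx$; $\bar d\xi=(2\pi)^{-d}d\xi$ and $\bar d\theta^{(k-1)}=\bar d\theta_{k-1}\cdots\bar d\theta_1$ with $\theta_i\in\mathbb{R}^d$. Here $\mathbb{N}=\{0,1,2,\dots\}$, $I_k=\{\lambda^{(k)}=(\lambda_k,\dots,\lambda_1)\in[0,1]^k:0<\lambda_k<\lambda_{k-1}<\dots<\lambda_1<1\}$, $d\lambda^{(k)}=d\lambda_k\cdots d\lambda_1$, and for $\ell^{(k-1)}=(\ell_1,\dots,\ell_{k-1})\in\mathbb{N}^{k-1}$, $$A(n,\ell^{(k-1)})=\binom{n}{\ell_1,\dots,\ell_{k-1}}\int_{I_k}\prod_{i=1}^{k-1}(\lambda_i-\lambda_{i+1})^{\ell_i}\,d\lambda^{(k)}$$ (multinomial coefficient). $X=\{X_t\}_{t\ge0}$ is the rotationally invariant $\alpha$-stable process on $\mathbb{R}^d$, with transition densities $p_t^{(\alpha)}(x,y)=p_t^{(\alpha)}(x-y)$ determined by $e^{-t|\xi|^\alpha}=\int_{\mathbb{R}^d}e^{-i y\cdot\xi}p_t^{(\alpha)}(y)\,dy$ for $t>0$, $\xi\in\mathbb{R}^d$. $\mathbb{E}^t_{x,y}$ denotes expectation with respect to the stable bridge, i.e. the process started at $x$ and conditioned to be at $y$ at time $t$; for $1=\lambda_0>\lambda_1>\dots>\lambda_k>\lambda_{k+1}=0$,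 $z_0=x$, $z_{k+1}=y$, the law of $(X_{t\lambda_1},\dots,X_{t\lambda_k})$ under it has density $\frac{1}{p_t^{(\alpha)}(x,y)}\prod_{j=0}^{k}p^{(\alpha)}_{t(\lambda_j-\lambda_{j+1})}(z_j,z_{j+1})$. The heat kernel of $e^{-tH_V}$, $H_V=(-\Delta)^{\alpha/2}+V$, is given by the Feynman–Kac formula $p_t^{H_V}(x,y)=p_t^{(\alpha)}(x,y)\,\mathbb{E}^t_{x,y}\bigl[e^{-\int_0^tV(X_s)ds}\bigr]$. The heat content is $$Q_V^{(\alpha)}(t)=\int_{\mathbb{R}^d}\int_{\mathbb{R}^d}\bigl\{p_t^{H_V}(x,y)-p_t^{(\alpha)}(x,y)\bigr\}dx\,dy=\int_{\mathbb{R}^d}\int_{\mathbb{R}^d}p_t^{(\alpha)}(x,y)\,\mathbb{E}^t_{x,y}\bigl[e^{-\int_0^tV(X_s)ds}-1\bigr]dx\,dy.$$ *)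

theory Defs
  imports "HOL-Probability.Probability" "HOL-Library.Landau_Symbols"
begin

text \<open>
  The space \<open>\<real>\<^sup>d\<close> is a type \<^typ>\<open>'a::euclidean_space\<close> with \<open>d = DIM('a)\<close>. Finite sequences
  indexed by \<open>1, \<dots>, m\<close> are functions on \<^typ>\<open>nat\<close> that are extensional on \<open>{1..m}\<close>, and
  Lebesgue measure on sequences of length \<open>m\<close> is the product measure \<open>PiM {1..m} (\<lambda>_. lborel)\<close>.
\<close>

section \<open>Rapidly decreasing smooth functions and the Fourier transform\<close>

primrec iterated_partial ::
  "'a::euclidean_space list \<Rightarrow> ('a \<Rightarrow> real) \<Rightarrow> 'a \<Rightarrow> real" where
  "iterated_partial [] f = f"
| "iterated_partial (b # bs) f = (\<lambda>x. frechet_derivative (iterated_partial bs f) (at x) b)"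

text \<open>
  Differentiability of all iterated partial derivatives is smoothness. It is required
  explicitly, because \<^const>\<open>frechet_derivative\<close> is unspecified where there is no derivative.
\<close>

definition rapidly_decreasing_smooth :: "('a::euclidean_space \<Rightarrow> real) \<Rightarrow> bool" where
  "rapidly_decreasing_smooth f \<longleftrightarrow>
     (\<forall>bs \<in> lists Basis.
        (\<forall>x. iterated_partial bs f differentiable (at x)) \<and>
        (\<forall>m::nat. bounded (range (\<lambda>x. norm x ^ m * iterated_partial bs f x))))"

definition fourier :: "('a::euclidean_space \<Rightarrow> real) \<Rightarrow> 'a \<Rightarrow> complex" where
  "fourier f \<xi> = (\<integral>x. exp (- (\<i> * complex_of_real (x \<bullet> \<xi>))) * complex_of_real (f x) \<partial>lborel)"

section \<open>The stable process, its bridges and the heat content\<close>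

text \<open>
  \<open>p t (x - y)\<close> is the transition density. The Fourier transform determines \<open>p t\<close> only almost
  everywhere; continuity singles out the version whose point values are used below.
\<close>

definition stable_density :: "real \<Rightarrow> (real \<Rightarrow> 'a::euclidean_space \<Rightarrow> real) \<Rightarrow> bool" where
  "stable_density \<alpha> p \<longleftrightarrow>
     (\<forall>t>0. continuous_on UNIV (p t) \<and> (\<forall>y. 0 \<le> p t y) \<and> integrable lborel (p t) \<and>
        (\<forall>\<xi>. fourier (p t) \<xi> = complex_of_real (exp (- t * norm \<xi> powr \<alpha>))))"

text \<open>
  \<open>X\<close> is a realisation on the probability space \<open>M\<close> of the process started at \<open>x\<close> and conditioned
  to be at \<open>y\<close> at time \<open>t\<close>. The only path regularity assumed is joint measurability, which makes
  \<open>\<integral>\<^sub>0\<^sup>t V(X\<^sub>s) ds\<close> a random variable; it holds whenever the paths are right-continuous with left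
  limits. The fractions \<open>1 = \<lambda>\<^sub>0 > \<lambda>\<^sub>1 > \<dots> > \<lambda>\<^sub>k > \<lambda>\<^sub>k\<^sub>+\<^sub>1 = 0\<close> decrease, so index \<open>0\<close> is the terminal time,
  with \<open>z\<^sub>0 = y\<close>, and index \<open>k + 1\<close> is the initial time, with \<open>z\<^sub>k\<^sub>+\<^sub>1 = x\<close>. (Putting \<open>z\<^sub>0 = x\<close> and
  \<open>z\<^sub>k\<^sub>+\<^sub>1 = y\<close> instead gives the bridge from \<open>y\<close> to \<open>x\<close>, which has the same law up to time reversal;
  the heat content, an integral over all \<open>x\<close> and \<open>y\<close>, is the same for both conventions.)
\<close>

definition stable_bridge ::
  "(real \<Rightarrow> 'a::euclidean_space \<Rightarrow> real) \<Rightarrow> real \<Rightarrow> 'a \<Rightarrow> 'a \<Rightarrow>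
   'w measure \<Rightarrow> (real \<Rightarrow> 'w \<Rightarrow> 'a) \<Rightarrow> bool" where
  "stable_bridge p t x y M X \<longleftrightarrow>
     prob_space M \<and>
     (\<lambda>(s, \<omega>). X s \<omega>) \<in> borel_measurable (restrict_space borel {0..t} \<Otimes>\<^sub>M M) \<and>
     (AE \<omega> in M. X 0 \<omega> = x) \<and> (AE \<omega> in M. X t \<omega> = y) \<and>
     (\<forall>k (l :: nat \<Rightarrow> real). 1 \<le> k \<longrightarrow> l 0 = 1 \<longrightarrow> l (k + 1) = 0 \<longrightarrow> (\<forall>j\<le>k. l (j + 1) < l j) \<longrightarrow>
        distributed M (\<Pi>\<^sub>M i\<in>{1..k}. lborel) (\<lambda>\<omega>. \<lambda>i\<in>{1..k}. X (t * l i) \<omega>)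
          (\<lambda>z. let z' = z(0 := y, k + 1 := x) in
             ennreal ((\<Prod>j=0..k. p (t * (l j - l (j + 1))) (z' j - z' (j + 1))) / p t (x - y))))"

text \<open>The Feynman--Kac formula.\<close>

definition heat_kernel ::
  "(real \<Rightarrow> 'a::euclidean_space \<Rightarrow> real) \<Rightarrow> (real \<Rightarrow> 'a \<Rightarrow> 'a \<Rightarrow> 'w measure) \<Rightarrow>
   (real \<Rightarrow> 'a \<Rightarrow> 'a \<Rightarrow> real \<Rightarrow> 'w \<Rightarrow> 'a) \<Rightarrow> ('a \<Rightarrow> real) \<Rightarrow> real \<Rightarrow> 'a \<Rightarrow> 'a \<Rightarrow> real" where
  "heat_kernel p M X V t x y =
     p t (x - y) * (\<integral>\<omega>. exp (- (LINT s:{0..t}|lborel. V (X t x y s \<omega>))) \<partial>M t x y)"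

definition heat_content ::
  "(real \<Rightarrow> 'a::euclidean_space \<Rightarrow> real) \<Rightarrow> (real \<Rightarrow> 'a \<Rightarrow> 'a \<Rightarrow> 'w measure) \<Rightarrow>
   (real \<Rightarrow> 'a \<Rightarrow> 'a \<Rightarrow> real \<Rightarrow> 'w \<Rightarrow> 'a) \<Rightarrow> ('a \<Rightarrow> real) \<Rightarrow> real \<Rightarrow> real" where
  "heat_content p M X V t =
     (\<integral>y. (\<integral>x. heat_kernel p M X V t x y - p t (x - y) \<partial>lborel) \<partial>lborel)"

section \<open>The coefficients\<close>

definition ordered_simplex :: "nat \<Rightarrow> (nat \<Rightarrow> real) set" where
  "ordered_simplex k =
     {l \<in> {1..k} \<rightarrow>\<^sub>E {0..1}. 0 < l k \<and> (\<forall>i\<in>{1..<k}. l (i + 1) < l i) \<and> l 1 < 1}"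

definition multi_indices :: "nat \<Rightarrow> nat \<Rightarrow> (nat \<Rightarrow> nat) set" where
  "multi_indices m n = {e \<in> {1..m} \<rightarrow>\<^sub>E UNIV. (\<Sum>i=1..m. e i) = n}"

definition A_coeff :: "nat \<Rightarrow> nat \<Rightarrow> (nat \<Rightarrow> nat) \<Rightarrow> real" where
  "A_coeff k n e =
     fact n / (\<Prod>i=1..k-1. fact (e i)) *
     (LINT l:ordered_simplex k|(\<Pi>\<^sub>M i\<in>{1..k}. lborel). (\<Prod>i=1..k-1. (l i - l (i + 1)) ^ e i))"

text \<open>
  The factor \<open>|\<theta>\<^sub>1 + \<dots> + \<theta>\<^sub>i|\<close> to the power \<open>\<alpha> \<ell>\<^sub>i\<close> is written as the \<open>\<ell>\<^sub>i\<close>-th power of its power \<open>\<alpha>\<close>,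
  because \<open>0 powr 0 = 0\<close>.
\<close>

definition C_pair :: "real \<Rightarrow> ('a::euclidean_space \<Rightarrow> real) \<Rightarrow> nat \<Rightarrow> nat \<Rightarrow> complex" where
  "C_pair \<alpha> V n k =
     (\<Sum>e \<in> multi_indices (k - 1) n.
        complex_of_real (A_coeff k n e) *
        (complex_of_real (1 / (2 * pi) ^ (DIM('a) * (k - 1))) *
         (\<integral>\<theta>. fourier V (- (\<Sum>i=1..k-1. \<theta> i)) *
               (\<Prod>i=1..k-1. fourier V (\<theta> i) *
                  complex_of_real ((norm (\<Sum>m=1..i. \<theta> m) powr \<alpha>) ^ e i))
            \<partial>(\<Pi>\<^sub>M i\<in>{1..k-1}. (lborel :: 'a measure)))))"

definition C_coeff :: "real \<Rightarrow> ('a::euclidean_space \<Rightarrow> real) \<Rightarrow> nat \<Rightarrow> complex" where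
  "C_coeff \<alpha> V m =
     (\<Sum>(n, k) \<in> {(n, k). n + k = m \<and> 2 \<le> k}. 1 / fact n * C_pair \<alpha> V n k)"

end

theory Submission
  imports Defs
begin

text \<open>
  Expand \<open>exp (- S)\<close> for \<open>S = \<integral>\<^sub>0\<^sup>t V(X\<^sub>s) ds\<close> and write \<open>S\<^sup>k / k!\<close> as \<open>t\<^sup>k\<close> times an integral over the simplex \<open>I\<^sub>k\<close>.
  The densities of the bridge turn the \<open>k\<close>-th term, integrated over both endpoints, into the integral
  over \<open>I\<^sub>k\<close> of \<open>\<integral> \<Prod>\<^sub>i V(z\<^sub>i) \<Prod>\<^sub>j p(t (\<lambda>\<^sub>j - \<lambda>\<^sub>j\<^sub>+\<^sub>1), z\<^sub>j - z\<^sub>j\<^sub>+\<^sub>1) dz\<close>. Fourier inversion of each \<open>p\<close> and the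
  unimodular substitution \<open>\<xi>\<^sub>i = - (\<theta>\<^sub>1 + \<dots> + \<theta>\<^sub>i)\<close> give an integral over \<open>\<theta>\<close> whose only dependence on \<open>t\<close>
  is through \<open>exp (- t \<Sum>\<^sub>i (\<lambda>\<^sub>i - \<lambda>\<^sub>i\<^sub>+\<^sub>1) |\<theta>\<^sub>1 + \<dots> + \<theta>\<^sub>i|\<^sup>\<alpha>)\<close>. Its Taylor polynomial in \<open>t\<close>, expanded by the
  multinomial theorem, yields \<open>C\<^sub>n\<^sub>,\<^sub>k\<close>; the remainder is controlled by the rapid decay of the Fourier transform of \<open>V\<close>.
\<close>

subsection \<open>Lebesgue measure on a Euclidean space\<close>

text \<open>The bridges are given separately for each pair of endpoints, so nothing makes a bridge
  expectation measurable in \<open>x\<close> and \<open>y\<close>, and the space of endpoints has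
  infinite measure. Both obstacles are met by passing from bridge measures to densities: every
  moment of the action is an integral of transition densities, hence jointly measurable, and the
  heat kernel is a pointwise limit of combinations of such moments. The remainder of the exponential
  series keeps one factor of the action, taken for the absolute value of the potential, because its
  weighted expectation is integrable over both endpoints; the other \<open>N\<close> factors are
  bounded by \<open>t * B\<close> each.

  The two truncations are linked: the series in \<open>k\<close> stops at \<open>N\<close>, the
  phase of the \<open>k\<close>-th chain at order \<open>N - k\<close>, so every error has order
  \<open>t ^ (N + 1)\<close>. The term \<open>k = 1\<close> contains no inner transition density,
  hence no phase, and equals \<open>- t\<close> times the integral of \<open>V\<close>
  exactly.\<close>

lemma integral_lborel_affine:
  fixes f :: "'a::euclidean_space \<Rightarrow> 'b::{banach, second_countable_topology}"
  assumes c: "c \<noteq> 0"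
  shows "(\<integral>x. f x \<partial>lborel) = \<bar>c\<bar> ^ DIM('a) *\<^sub>R (\<integral>x. f (t + c *\<^sub>R x) \<partial>lborel)" (is ?eq)
    and "integrable lborel (\<lambda>x. f (t + c *\<^sub>R x)) \<longleftrightarrow> integrable lborel f" (is ?iff)
proof -
  have imp: "integrable lborel (\<lambda>x. g (t + c *\<^sub>R x))"
    if "integrable lborel g" "c \<noteq> 0" for g :: "'a \<Rightarrow> 'b" and c t
  proof -
    have [measurable]: "g \<in> borel_measurable borel" using that by auto
    from that(1) have "integrable (density (distr lborel borel (\<lambda>x. t + c *\<^sub>R x)) (\<lambda>_. \<bar>c\<bar> ^ DIM('a))) g"
      using lborel_affine[OF that(2), of t] by simp
    then have "integrable lborel (\<lambda>x. \<bar>c\<bar> ^ DIM('a) *\<^sub>R g (t + c *\<^sub>R x))"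
      by (simp add: integrable_density integrable_distr_eq)
    from integrable_scaleR_right[OF this, of "inverse (\<bar>c\<bar> ^ DIM('a))"] that(2) show ?thesis
      by simp
  qed
  \<comment> \<open>Applying \<open>imp\<close> to the inverse affine map as well turns it into an
    equivalence.\<close>
  have fwd: "t + c *\<^sub>R (- inverse c *\<^sub>R t + inverse c *\<^sub>R x) = x" for x :: "'a"
    using c by (simp add: scaleR_add_right scaleR_diff_right)
  show iff: ?iff
  proof
    assume "integrable lborel (\<lambda>x. f (t + c *\<^sub>R x))"
    from imp[OF this, of "inverse c" "- inverse c *\<^sub>R t"] c show "integrable lborel f"
      by (simp add: fwd del: scaleR_minus_left)
  qed (use imp c in blast)
  show ?eq
  proof (cases "integrable lborel f")
    case True
    then have [measurable]: "f \<in> borel_measurable borel" by auto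
    show ?thesis
      by (subst lborel_affine[OF c, of t]) (simp add: integral_density integral_distr)
  next
    \<comment> \<open>Neither integrand is integrable, and both integrals take the default value
      0.\<close>
    case False
    then show ?thesis using iff by (simp add: not_integrable_integral_eq)
  qed
qed

lemma integral_lborel_shift:
  fixes f :: "'a::euclidean_space \<Rightarrow> 'b::{banach, second_countable_topology}"
  shows "(\<integral>x. f (t + x) \<partial>lborel) = (\<integral>x. f x \<partial>lborel)"
    and "(\<integral>x. f (t - x) \<partial>lborel) = (\<integral>x. f x \<partial>lborel)"
    and "integrable lborel (\<lambda>x. f (t + x)) \<longleftrightarrow> integrable lborel f"
    and "integrable lborel (\<lambda>x. f (t - x)) \<longleftrightarrow> integrable lborel f"
  using integral_lborel_affine[of 1 f t] integral_lborel_affine[of "-1" f t] by simp_all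

lemma nn_integral_lborel_shift:
  fixes f :: "'a::euclidean_space \<Rightarrow> ennreal"
  assumes [measurable]: "f \<in> borel_measurable borel"
  shows "(\<integral>\<^sup>+x. f (t + x) \<partial>lborel) = (\<integral>\<^sup>+x. f x \<partial>lborel)"
    and "(\<integral>\<^sup>+x. f (t - x) \<partial>lborel) = (\<integral>\<^sup>+x. f x \<partial>lborel)"
proof -
  show "(\<integral>\<^sup>+x. f (t + x) \<partial>lborel) = (\<integral>\<^sup>+x. f x \<partial>lborel)"
    by (subst (2) lborel_affine[of 1 t]) (simp_all add: nn_integral_density nn_integral_distr)
  show "(\<integral>\<^sup>+x. f (t - x) \<partial>lborel) = (\<integral>\<^sup>+x. f x \<partial>lborel)"
    by (subst (2) lborel_affine[of "-1" t]) (simp_all add: nn_integral_density nn_integral_distr)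
qed

text \<open>Fubini over the coordinates: \<open>lborel\<close> is the image of a product of
  one-dimensional Lebesgue measures under the map that builds a vector from its coordinates.\<close>

lemma lborel_prod_Basis:
  fixes f :: "'a::euclidean_space \<Rightarrow> real \<Rightarrow> 'b::{real_normed_field, banach, second_countable_topology}"
  assumes f: "\<And>b. b \<in> Basis \<Longrightarrow> integrable lborel (f b)"
  shows "integrable lborel (\<lambda>x. \<Prod>b\<in>Basis. f b (x \<bullet> b))"
    and "(\<integral>x. (\<Prod>b\<in>Basis. f b (x \<bullet> b)) \<partial>lborel) = (\<Prod>b\<in>Basis. \<integral>x. f b x \<partial>lborel)"
proof -
  interpret product_sigma_finite "\<lambda>_::'a. lborel :: real measure" ..
  have [measurable]: "b \<in> Basis \<Longrightarrow> f b \<in> borel_measurable borel" for b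
    using f[of b] by auto
  have *: "(\<Prod>b\<in>Basis. f b ((\<Sum>c\<in>Basis. g c *\<^sub>R c) \<bullet> b)) = (\<Prod>b\<in>Basis. f b (g b))" for g
    by (intro prod.cong refl) (simp add: inner_sum_left inner_Basis if_distrib cong: if_cong)
  show "integrable lborel (\<lambda>x. \<Prod>b\<in>Basis. f b (x \<bullet> b))"
    by (subst lborel_eq, subst integrable_distr_eq)
       (auto simp: * intro!: product_integrable_prod f)
  show "(\<integral>x. (\<Prod>b\<in>Basis. f b (x \<bullet> b)) \<partial>lborel) = (\<Prod>b\<in>Basis. \<integral>x. f b x \<partial>lborel)"
    by (subst lborel_eq, subst integral_distr) (auto simp: * product_integral_prod f)
qed

text \<open>Each coordinate is at most the norm, so a product of one-dimensional Cauchy weights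
  dominates. This function is the majorant for all rapidly decaying integrands below.\<close>

lemma integrable_inverse_polynomial:
  "integrable lborel (\<lambda>x::'a::euclidean_space. 1 / (1 + norm x ^ 2) ^ DIM('a))"
proof (rule Bochner_Integration.integrable_bound)
  have *: "integrable lborel (\<lambda>x::real. 1 / (1 + x ^ 2))"
    using integrable_inverse_1_plus_square
    by (simp add: set_integrable_def inverse_eq_divide)
  show "integrable lborel (\<lambda>x::'a. \<Prod>b\<in>Basis. 1 / (1 + (x \<bullet> b) ^ 2))"
    by (rule lborel_prod_Basis) (rule *)
  show "AE x::'a in lborel. norm (1 / (1 + norm x ^ 2) ^ DIM('a)) \<le> norm (\<Prod>b\<in>Basis. 1 / (1 + (x \<bullet> b)\<^sup>2))"
  proof (rule AE_I2)
    fix x :: 'a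
    have "(\<Prod>b\<in>(Basis::'a set). 1 / (1 + norm x ^ 2)) \<le> (\<Prod>b\<in>Basis. 1 / (1 + (x \<bullet> b)\<^sup>2))"
    proof (rule prod_mono, intro conjI)
      fix b :: 'a assume "b \<in> Basis"
      then have "(x \<bullet> b)\<^sup>2 \<le> (norm x)\<^sup>2"
        using Basis_le_norm[of b x] by (metis abs_ge_zero power2_abs power_mono)
      then show "1 / (1 + (norm x)\<^sup>2) \<le> 1 / (1 + (x \<bullet> b)\<^sup>2)"
        by (intro divide_left_mono) (auto intro!: mult_pos_pos add_pos_nonneg)
    qed auto
    then show "norm (1 / (1 + norm x ^ 2) ^ DIM('a)) \<le> norm (\<Prod>b\<in>Basis. 1 / (1 + (x \<bullet> b)\<^sup>2))"
      by (simp add: prod_nonneg power_one_over)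
  qed
qed measurable

text \<open>A single term of the exponential series already outgrows the polynomial
  \<open>(1 + r^2) ^ d\<close>, which reduces the claim to the polynomial majorant.\<close>

lemma integrable_exp_neg_powr:
  assumes "0 < s" "0 < \<alpha>"
  shows "integrable lborel (\<lambda>x::'a::euclidean_space. exp (- s * norm x powr \<alpha>))"
proof -
  define d where "d = DIM('a)"
  \<comment> \<open>The index of that term, large enough that \<open>\<alpha> * m\<close> reaches
    the degree \<open>2 * d\<close>.\<close>
  define m where "m = nat \<lceil>2 * real d / \<alpha>\<rceil>"
  have m: "2 * real d \<le> \<alpha> * m"
  proof -
    have "2 * real d / \<alpha> \<le> m" unfolding m_def by linarith
    then show ?thesis using assms by (simp add: field_simps)
  qed
  \<comment> \<open>The factor \<open>2 ^ d\<close> serves both ranges: \<open>1 + r^2\<close> is at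
    most 2 for \<open>r \<le> 1\<close> and at most \<open>2 * r^2\<close> beyond.\<close>
  define K where "K = 2 ^ d * (1 + fact m / s ^ m)"
  have bound: "exp (- s * r powr \<alpha>) * (1 + r^2) ^ d \<le> K" if "0 \<le> r" for r
  proof (cases "r \<le> 1")
    case True
    then have "1 + r^2 \<le> 2" using that by (simp add: power_le_one)
    then have "(1 + r^2) ^ d \<le> 2 ^ d" by (intro power_mono) auto
    then have "exp (- s * r powr \<alpha>) * (1 + r^2) ^ d \<le> 1 * 2 ^ d"
      using assms by (intro mult_mono) (auto simp: )
    also have "\<dots> \<le> K" unfolding K_def using assms by (simp add: field_simps)
    finally show ?thesis .
  next
    case False
    then have r: "1 < r" by simp
    let ?u = "s * r powr \<alpha>"
    have u: "0 < ?u" using assms r by simp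
    have "?u ^ m / fact m \<le> exp ?u"
      using sums_le[of "\<lambda>n. if n = m then ?u ^ m / fact m else 0" "\<lambda>n. ?u ^ n /\<^sub>R fact n", OF _ sums_single]
        exp_converges[of ?u] u
      by (auto simp: divide_inverse mult.commute)
    then have "exp (- ?u) \<le> fact m / ?u ^ m"
      using zero_less_power[OF u, of m] by (simp add: exp_minus field_simps del: zero_less_power_eq)
    also have "\<dots> = fact m / s ^ m / r powr (\<alpha> * m)"
      using r by (simp add: power_mult_distrib powr_powr[symmetric] powr_realpow)
    also have "\<dots> \<le> fact m / s ^ m / r powr (2 * d)"
      using m r assms by (intro divide_left_mono powr_mono) auto
    also have "r powr (2 * d) = (r^2) ^ d"
      using r powr_realpow[of r "2 * d"] by (simp add: power_mult)
    finally have e: "exp (- ?u) \<le> fact m / s ^ m / (r^2) ^ d" .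
    have "(1 + r^2) ^ d \<le> (2 * r^2) ^ d"
      using r by (intro power_mono) (auto simp: one_le_power)
    then have "exp (- ?u) * (1 + r^2) ^ d \<le> fact m / s ^ m / (r^2) ^ d * (2 * r^2) ^ d"
      using e assms by (intro mult_mono) auto
    also have "\<dots> = 2 ^ d * (fact m / s ^ m)"
      using r by (simp add: power_mult_distrib)
    also have "\<dots> \<le> K" unfolding K_def by (simp add: field_simps)
    finally show ?thesis by simp
  qed
  show ?thesis
  proof (rule Bochner_Integration.integrable_bound)
    show "integrable lborel (\<lambda>x::'a. K * (1 / (1 + norm x ^ 2) ^ DIM('a)))"
      by (intro integrable_mult_right integrable_inverse_polynomial)
    show "AE x::'a in lborel. norm (exp (- s * norm x powr \<alpha>)) \<le> norm (K * (1 / (1 + norm x ^ 2) ^ DIM('a)))"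
    proof (rule AE_I2)
      fix x :: 'a
      have "0 < 1 + (norm x)\<^sup>2" by (simp add: add_pos_nonneg)
      moreover have "0 \<le> K" unfolding K_def using assms by simp
      ultimately show "norm (exp (- s * norm x powr \<alpha>)) \<le> norm (K * (1 / (1 + norm x ^ 2) ^ DIM('a)))"
        using bound[of "norm x"] by (simp add: d_def field_simps)
    qed
  qed measurable
qed

subsection \<open>The Gaussian and Fourier inversion\<close>

text \<open>The product form reduces integrability and the Fourier transform to dimension one;
  \<open>gauss_eq\<close> gives the radial form.\<close>

definition gauss :: "'a::euclidean_space \<Rightarrow> real" where
  "gauss u = (\<Prod>b\<in>Basis. std_normal_density (u \<bullet> b))"

lemma gauss_eq: "gauss u = (1 / sqrt (2 * pi)) ^ DIM('a) * exp (- (norm u)\<^sup>2 / 2)"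
  for u :: "'a::euclidean_space"
proof -
  have "gauss u = (1 / sqrt (2 * pi)) ^ DIM('a) * exp (\<Sum>b\<in>Basis. - (u \<bullet> b)\<^sup>2 / 2)"
    by (simp add: gauss_def normal_density_def exp_sum prod.distrib prod_dividef power_one_over)
  also have "(\<Sum>b\<in>Basis. - (u \<bullet> b)\<^sup>2 / 2) = - (norm u)\<^sup>2 / 2"
    unfolding power2_norm_eq_inner
    by (subst (2) euclidean_inner) (simp add: sum_negf sum_divide_distrib power2_eq_square)
  finally show ?thesis .
qed

lemma gauss_pos [simp]: "0 < gauss u"
  by (auto simp: gauss_eq intro!: mult_pos_pos)

lemma gauss_le: "gauss u \<le> gauss (0 :: 'a)" for u :: "'a::euclidean_space"
  by (auto simp: gauss_eq intro!: divide_right_mono)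

lemma continuous_gauss: "continuous_on UNIV gauss"
  unfolding gauss_eq[abs_def] by (intro continuous_intros) auto

lemma gauss_measurable [measurable]: "gauss \<in> borel_measurable borel"
  by (intro borel_measurable_continuous_onI continuous_gauss)

lemma integrable_gauss: "integrable lborel gauss"
  and integral_gauss: "(\<integral>u. gauss u \<partial>lborel) = 1"
  unfolding gauss_def[abs_def]
  using lborel_prod_Basis[of "\<lambda>_. std_normal_density"] by auto

text \<open>The transform factors over the coordinates, and each factor is the characteristic
  function of the standard normal law at the negated frequency, because of the sign in
  \<open>fourier\<close>.\<close>

lemma fourier_gauss: "fourier gauss \<xi> = complex_of_real (exp (- (norm \<xi>)\<^sup>2 / 2))"
  for \<xi> :: "'a::euclidean_space"
proof -
  let ?f = "\<lambda>b x. std_normal_density x *\<^sub>R cis (- (x * (\<xi> \<bullet> b)))"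
  have int: "integrable lborel (?f b)" for b
    by (rule Bochner_Integration.integrable_bound[of _ std_normal_density]) (auto simp: cis_conv_exp)
  have one: "(\<integral>x. ?f b x \<partial>lborel) = complex_of_real (exp (- (\<xi> \<bullet> b)\<^sup>2 / 2))" for b
  proof -
    have "char std_normal_distribution (- (\<xi> \<bullet> b)) = (\<integral>x. ?f b x \<partial>lborel)"
      unfolding char_def
      by (subst integral_density) (auto simp: cis_conv_exp mult_ac)
    then show ?thesis by (simp add: char_std_normal_distribution)
  qed
  have "fourier gauss \<xi> = (\<integral>x. (\<Prod>b\<in>Basis. ?f b (x \<bullet> b)) \<partial>lborel)"
    unfolding fourier_def
  proof (intro Bochner_Integration.integral_cong refl)
    fix x :: 'a
    have "x \<bullet> \<xi> = (\<Sum>b\<in>Basis. (x \<bullet> b) * (\<xi> \<bullet> b))" by (rule euclidean_inner)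
    then show "exp (- (\<i> * complex_of_real (x \<bullet> \<xi>))) * complex_of_real (gauss x) = (\<Prod>b\<in>Basis. ?f b (x \<bullet> b))"
      by (simp add: gauss_def cis_conv_exp scaleR_conv_of_real prod.distrib sum_distrib_left exp_sum[symmetric] sum_negf)
  qed
  also have "\<dots> = (\<Prod>b\<in>Basis. complex_of_real (exp (- (\<xi> \<bullet> b)\<^sup>2 / 2)))"
    by (subst lborel_prod_Basis) (auto simp: int one)
  also have "\<dots> = complex_of_real (exp (\<Sum>b\<in>Basis. - (\<xi> \<bullet> b)\<^sup>2 / 2))"
    by (simp add: exp_sum)
  also have "(\<Sum>b\<in>Basis. - (\<xi> \<bullet> b)\<^sup>2 / 2) = - (norm \<xi>)\<^sup>2 / 2"
    unfolding power2_norm_eq_inner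
    by (subst (2) euclidean_inner) (simp add: sum_negf sum_divide_distrib power2_eq_square)
  finally show ?thesis .
qed

lemma (in pair_sigma_finite) integrable_pair_mult:
  fixes f :: "'a \<Rightarrow> real" and g :: "'b \<Rightarrow> real"
  assumes f: "integrable M1 f" and g: "integrable M2 g"
  shows "integrable (M1 \<Otimes>\<^sub>M M2) (\<lambda>(x, y). f x * g y)"
proof (rule Fubini_integrable)
  have [measurable]: "f \<in> borel_measurable M1" "g \<in> borel_measurable M2" using f g by auto
  show "(\<lambda>(x, y). f x * g y) \<in> borel_measurable (M1 \<Otimes>\<^sub>M M2)" by measurable
qed (use f g in \<open>auto simp: abs_mult\<close>)

text \<open>A nonintegrable \<open>f\<close> is covered as well: its integral is the default value
  0, and \<open>g\<close> is nonnegative since it dominates a norm.\<close>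

lemma norm_integral_le_integral:
  fixes f :: "'a \<Rightarrow> 'b::{banach, second_countable_topology}"
  assumes g: "integrable M g" and le: "\<And>x. x \<in> space M \<Longrightarrow> norm (f x) \<le> g x"
  shows "norm (\<integral>x. f x \<partial>M) \<le> (\<integral>x. g x \<partial>M)"
proof (cases "integrable M f")
  case True
  have "norm (\<integral>x. f x \<partial>M) \<le> (\<integral>x. norm (f x) \<partial>M)" by simp
  also have "\<dots> \<le> (\<integral>x. g x \<partial>M)" using True g le by (intro integral_mono) auto
  finally show ?thesis .
next
  case False
  have "0 \<le> (\<integral>x. g x \<partial>M)"
    using le by (intro Bochner_Integration.integral_nonneg) (meson norm_ge_zero order_trans)
  with False show ?thesis by (simp add: not_integrable_integral_eq)
qed

lemma integrable_fourier_integrand: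
  fixes f :: "'a::euclidean_space \<Rightarrow> real"
  assumes "integrable lborel f"
  shows "integrable lborel (\<lambda>x. exp (- (\<i> * complex_of_real (x \<bullet> \<xi>))) * complex_of_real (f x))"
proof (rule Bochner_Integration.integrable_bound)
  show "integrable lborel f" by fact
  have [measurable]: "f \<in> borel_measurable borel" using assms by auto
  show "(\<lambda>x. exp (- (\<i> * complex_of_real (x \<bullet> \<xi>))) * complex_of_real (f x)) \<in> borel_measurable lborel"
    by measurable
qed (simp add: norm_mult norm_exp_i_times)

lemma norm_fourier_le:
  fixes f :: "'a::euclidean_space \<Rightarrow> real"
  assumes "integrable lborel f"
  shows "norm (fourier f \<xi>) \<le> (\<integral>x. \<bar>f x\<bar> \<partial>lborel)"
proof -
  have "norm (fourier f \<xi>) \<le> (\<integral>x. norm (exp (- (\<i> * complex_of_real (x \<bullet> \<xi>))) * complex_of_real (f x)) \<partial>lborel)"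
    unfolding fourier_def by (rule integral_norm_bound)
  then show ?thesis by (simp add: norm_mult)
qed

lemma continuous_fourier:
  fixes f :: "'a::euclidean_space \<Rightarrow> real"
  assumes f: "integrable lborel f"
  shows "continuous_on UNIV (fourier f)"
proof (rule continuous_at_imp_continuous_on, rule ballI)
  fix \<xi> :: 'a
  have [measurable]: "f \<in> borel_measurable borel" using f by auto
  show "isCont (fourier f) \<xi>"
    unfolding isCont_def tendsto_at_iff_sequentially comp_def
  proof (intro allI impI)
    fix X :: "nat \<Rightarrow> 'a" assume "\<forall>i. X i \<in> UNIV - {\<xi>}" and X: "X \<longlonglongrightarrow> \<xi>"
    show "(\<lambda>n. fourier f (X n)) \<longlonglongrightarrow> fourier f \<xi>"
      unfolding fourier_def
    proof (rule integral_dominated_convergence)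
      show "integrable lborel (\<lambda>x. \<bar>f x\<bar>)" using f by simp
      show "AE x in lborel. (\<lambda>n. exp (- (\<i> * complex_of_real (x \<bullet> X n))) * complex_of_real (f x))
              \<longlonglongrightarrow> exp (- (\<i> * complex_of_real (x \<bullet> \<xi>))) * complex_of_real (f x)"
        by (intro AE_I2 tendsto_intros X)
    qed (auto simp: norm_mult)
  qed
qed

lemma fourier_measurable [measurable]:
  "integrable lborel f \<Longrightarrow> fourier f \<in> borel_measurable borel"
  by (intro borel_measurable_continuous_onI continuous_fourier)

text \<open>
  Fubini moves the Gaussian from \<open>f\<close> to its Fourier transform, because \<open>gauss\<close> is up to a constant
  its own Fourier transform.
\<close>

lemma gauss_convolution_fourier:
  fixes f :: "'a::euclidean_space \<Rightarrow> real"
  assumes f: "integrable lborel f" and \<delta>: "0 < \<delta>"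
  shows "complex_of_real (\<integral>u. f (x + \<delta> *\<^sub>R u) * gauss u \<partial>lborel) =
         (1 / sqrt (2 * pi)) ^ DIM('a) *\<^sub>R
           (\<integral>\<eta>. gauss (\<delta> *\<^sub>R \<eta>) *\<^sub>R (exp (\<i> * complex_of_real (x \<bullet> \<eta>)) * fourier f \<eta>) \<partial>lborel)"
proof -
  let ?g = "\<lambda>u. f (x + \<delta> *\<^sub>R u)"
  let ?e = "\<lambda>u \<xi>. exp (- (\<i> * complex_of_real (\<xi> \<bullet> u)))"
  have [measurable]: "f \<in> borel_measurable borel" using f by auto
  have g: "integrable lborel ?g" using \<delta> f integral_lborel_affine(2)[of \<delta> f x] by simp
  define c where "c = complex_of_real ((1 / sqrt (2 * pi)) ^ DIM('a))"
  have gau: "complex_of_real (gauss u) = c * (\<integral>\<xi>. ?e u \<xi> * complex_of_real (gauss \<xi>) \<partial>lborel)" for u :: 'a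
    using fourier_gauss[of u] unfolding fourier_def by (simp add: gauss_eq c_def)
  \<comment> \<open>Substituting \<open>y = x + \<delta> *\<^sub>R u\<close> divides the frequency
    by \<open>\<delta>\<close> and brings out the shift by \<open>x\<close> as a phase.\<close>
  have inner: "(\<integral>u. complex_of_real (?g u) * ?e u \<xi> \<partial>lborel) =
      (1 / \<delta>) ^ DIM('a) *\<^sub>R (exp (\<i> * complex_of_real (x \<bullet> (\<xi> /\<^sub>R \<delta>))) * fourier f (\<xi> /\<^sub>R \<delta>))" for \<xi> :: 'a
  proof -
    let ?F = "\<lambda>y. exp (\<i> * complex_of_real (x \<bullet> (\<xi> /\<^sub>R \<delta>))) *
         (exp (- (\<i> * complex_of_real (y \<bullet> (\<xi> /\<^sub>R \<delta>)))) * complex_of_real (f y))"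
    have "?F (x + \<delta> *\<^sub>R u) = complex_of_real (?g u) * ?e u \<xi>" for u
    proof -
      have "(x + \<delta> *\<^sub>R u) \<bullet> (\<xi> /\<^sub>R \<delta>) = x \<bullet> (\<xi> /\<^sub>R \<delta>) + \<xi> \<bullet> u"
        using \<delta> by (simp add: inner_add_left inner_commute[of u] distrib_left)
      then show ?thesis
        by (simp add: exp_add[symmetric] mult.assoc[symmetric] distrib_left)
    qed
    then have "(\<integral>y. ?F y \<partial>lborel) = \<delta> ^ DIM('a) *\<^sub>R (\<integral>u. complex_of_real (?g u) * ?e u \<xi> \<partial>lborel)"
      using integral_lborel_affine(1)[of \<delta> ?F x] \<delta> by (simp only: abs_of_pos)
    then have "(1 / \<delta>) ^ DIM('a) *\<^sub>R (\<integral>y. ?F y \<partial>lborel) = (\<integral>u. complex_of_real (?g u) * ?e u \<xi> \<partial>lborel)"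
      using \<delta> by (simp add: power_one_over)
    then show ?thesis by (simp add: fourier_def)
  qed
  have int: "integrable (lborel \<Otimes>\<^sub>M lborel) (\<lambda>(u, \<xi>). complex_of_real (?g u) * ?e u \<xi> * complex_of_real (gauss \<xi>))"
  proof (rule Bochner_Integration.integrable_bound)
    show "integrable (lborel \<Otimes>\<^sub>M lborel) (\<lambda>(u, \<xi>). ?g u * gauss \<xi>)"
      by (intro lborel_pair.integrable_pair_mult g integrable_gauss)
  qed (auto simp: norm_mult split_beta)
  let ?H = "\<lambda>\<xi>. exp (\<i> * complex_of_real (x \<bullet> (\<xi> /\<^sub>R \<delta>))) * fourier f (\<xi> /\<^sub>R \<delta>)"
  have pt: "complex_of_real (?g u * gauss u) =
      c * (\<integral>\<xi>. complex_of_real (?g u) * ?e u \<xi> * complex_of_real (gauss \<xi>) \<partial>lborel)" for u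
    unfolding of_real_mult mult.assoc integral_mult_right_zero by (subst gau[of u]) (simp only: mult.left_commute)
  have "complex_of_real (\<integral>u. ?g u * gauss u \<partial>lborel) = (\<integral>u. complex_of_real (?g u * gauss u) \<partial>lborel)"
    by (rule integral_complex_of_real[symmetric])
  also have "\<dots> = c * (\<integral>u. (\<integral>\<xi>. complex_of_real (?g u) * ?e u \<xi> * complex_of_real (gauss \<xi>) \<partial>lborel) \<partial>lborel)"
    by (simp only: pt integral_mult_right_zero)
  also have "(\<integral>u. (\<integral>\<xi>. complex_of_real (?g u) * ?e u \<xi> * complex_of_real (gauss \<xi>) \<partial>lborel) \<partial>lborel) =
      (\<integral>\<xi>. (\<integral>u. complex_of_real (?g u) * ?e u \<xi> * complex_of_real (gauss \<xi>) \<partial>lborel) \<partial>lborel)"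
    by (rule lborel_pair.Fubini_integral[OF int, symmetric])
  also have "\<dots> = (\<integral>\<xi>. (1 / \<delta>) ^ DIM('a) *\<^sub>R (gauss \<xi> *\<^sub>R ?H \<xi>) \<partial>lborel)"
    by (simp only: integral_mult_left_zero inner)
       (simp only: scaleR_conv_of_real mult.assoc mult.commute mult.left_commute)
  \<comment> \<open>Rescaling the frequency by \<open>\<delta>\<close> cancels the Jacobian of the
    earlier substitution and clears the division inside \<open>?H\<close>.\<close>
  also have "\<dots> = \<delta> ^ DIM('a) *\<^sub>R (1 / \<delta>) ^ DIM('a) *\<^sub>R (\<integral>\<eta>. gauss (\<delta> *\<^sub>R \<eta>) *\<^sub>R ?H (\<delta> *\<^sub>R \<eta>) \<partial>lborel)"
    using integral_lborel_affine(1)[of \<delta> "\<lambda>\<xi>. gauss \<xi> *\<^sub>R ?H \<xi>" 0] \<delta>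
    by (simp only: integral_scaleR_right abs_of_pos add_0_left) (simp only: scaleR_left_commute)
  also have "\<dots> = (\<integral>\<eta>. gauss (\<delta> *\<^sub>R \<eta>) *\<^sub>R (exp (\<i> * complex_of_real (x \<bullet> \<eta>)) * fourier f \<eta>) \<partial>lborel)"
    using \<delta> by (simp add: power_one_over)
  finally show ?thesis by (simp only: scaleR_conv_of_real c_def)
qed

text \<open>
  Fatou's lemma applied to the Gaussian means of \<open>f\<close> shows that \<open>f\<close> is bounded, after which
  dominated convergence identifies their limit.
\<close>

lemma fourier_inversion:
  fixes f :: "'a::euclidean_space \<Rightarrow> real"
  assumes cont: "continuous_on UNIV f" and nn: "\<And>x. 0 \<le> f x" and f: "integrable lborel f"
    and ff: "integrable lborel (fourier f)"
  shows "complex_of_real (f x) = (1 / (2 * pi) ^ DIM('a)) *\<^sub>R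
           (\<integral>\<eta>. exp (\<i> * complex_of_real (x \<bullet> \<eta>)) * fourier f \<eta> \<partial>lborel)"
proof -
  let ?c = "(1 / sqrt (2 * pi)) ^ DIM('a)"
  let ?\<delta> = "\<lambda>n. 1 / real (Suc n)"
  have [measurable]: "f \<in> borel_measurable borel" "fourier f \<in> borel_measurable borel" using f by auto
  have c1: "gauss (0::'a) = ?c" by (simp add: gauss_eq)
  have gle: "gauss u \<le> ?c" for u :: 'a using gauss_le[of u] unfolding c1 .
  have conv: "(\<lambda>n. f (x + ?\<delta> n *\<^sub>R u)) \<longlonglongrightarrow> f x" for x u
  proof -
    have "(\<lambda>n. x + ?\<delta> n *\<^sub>R u) \<longlonglongrightarrow> x + 0 *\<^sub>R u"
      by (intro tendsto_intros LIMSEQ_inverse_real_of_nat[unfolded inverse_eq_divide])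
    then show ?thesis
      using cont by (intro isCont_tendsto_compose[of x f]) (auto simp: continuous_on_eq_continuous_at)
  qed
  \<comment> \<open>A bound for the Gaussian means that is uniform in the scale and in the centre:
    the phase has modulus one and \<open>gauss\<close> is at most \<open>?c\<close>.\<close>
  define K where "K = ?c * (?c * (\<integral>\<eta>. norm (fourier f \<eta>) \<partial>lborel))"
  have bound: "(\<integral>u. f (x + \<delta> *\<^sub>R u) * gauss u \<partial>lborel) \<le> K" if "0 < \<delta>" for \<delta> x
  proof -
    have "norm (\<integral>\<eta>. gauss (\<delta> *\<^sub>R \<eta>) *\<^sub>R (exp (\<i> * complex_of_real (x \<bullet> \<eta>)) * fourier f \<eta>) \<partial>lborel)
       \<le> (\<integral>\<eta>. ?c * norm (fourier f \<eta>) \<partial>lborel)"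
    proof (rule Bochner_Integration.integral_norm_bound_integral)
      show i: "integrable lborel (\<lambda>\<eta>. ?c * norm (fourier f \<eta>))" using ff by simp
      show n: "norm (gauss (\<delta> *\<^sub>R \<eta>) *\<^sub>R (exp (\<i> * complex_of_real (x \<bullet> \<eta>)) * fourier f \<eta>)) \<le> ?c * norm (fourier f \<eta>)"
        for \<eta> using gauss_le[of "\<delta> *\<^sub>R \<eta>"] by (simp add: norm_mult c1 mult_right_mono less_imp_le)
      show "integrable lborel (\<lambda>\<eta>. gauss (\<delta> *\<^sub>R \<eta>) *\<^sub>R (exp (\<i> * complex_of_real (x \<bullet> \<eta>)) * fourier f \<eta>))"
        by (rule Bochner_Integration.integrable_bound[OF i]) (use n in \<open>auto intro!: order_trans[OF n]\<close>)
    qed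
    then have "norm (complex_of_real (\<integral>u. f (x + \<delta> *\<^sub>R u) * gauss u \<partial>lborel)) \<le> K"
      unfolding gauss_convolution_fourier[OF f that] K_def
      by (auto simp: intro!: divide_right_mono)
    then show ?thesis by simp
  qed
  have intg: "integrable lborel (\<lambda>u. f (x + \<delta> *\<^sub>R u) * gauss u)" if "0 < \<delta>" for \<delta> x
  proof (rule Bochner_Integration.integrable_bound)
    show "integrable lborel (\<lambda>u. f (x + \<delta> *\<^sub>R u) * gauss 0)"
      using that f integral_lborel_affine(2)[of \<delta> f x] by simp
  qed (use nn gauss_le in \<open>auto simp: abs_mult intro!: mult_left_mono AE_I2 simp: less_imp_le\<close>)
  have "f x \<le> K" for x
  proof -
    have "ennreal (f x) = (\<integral>\<^sup>+u. ennreal (f x * gauss (u::'a)) \<partial>lborel)"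
      using nn integrable_gauss integral_gauss
      by (subst nn_integral_eq_integral) (auto simp: less_imp_le)
    also have "\<dots> = (\<integral>\<^sup>+u. liminf (\<lambda>n. ennreal (f (x + ?\<delta> n *\<^sub>R u) * gauss u)) \<partial>lborel)"
      by (intro nn_integral_cong lim_imp_Liminf[symmetric] tendsto_ennrealI tendsto_intros conv) auto
    also have "\<dots> \<le> liminf (\<lambda>n. \<integral>\<^sup>+u. ennreal (f (x + ?\<delta> n *\<^sub>R u) * gauss u) \<partial>lborel)"
      by (rule nn_integral_liminf) auto
    also have "\<dots> \<le> ennreal K"
    proof (rule Liminf_le)
      show "\<forall>\<^sub>F n in sequentially. (\<integral>\<^sup>+u. ennreal (f (x + ?\<delta> n *\<^sub>R u) * gauss u) \<partial>lborel) \<le> ennreal K"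
        using bound nn by (intro always_eventually allI, subst nn_integral_eq_integral)
           (auto intro!: intg ennreal_leI simp: less_imp_le)
    qed simp
    finally show ?thesis
      by (subst (asm) ennreal_le_iff) (auto simp: K_def)
  qed
  note fK = this
  have "(\<lambda>n. \<integral>u. f (x + ?\<delta> n *\<^sub>R u) * gauss u \<partial>lborel) \<longlonglongrightarrow> (\<integral>u. f x * gauss (u::'a) \<partial>lborel)"
  proof (rule integral_dominated_convergence)
    show "integrable lborel (\<lambda>u::'a. K * gauss u)" by (intro integrable_mult_right integrable_gauss)
    show "AE u in lborel. (\<lambda>n. f (x + ?\<delta> n *\<^sub>R u) * gauss u) \<longlonglongrightarrow> f x * gauss u"
      by (intro AE_I2 tendsto_intros conv)
    show "AE u in lborel. norm (f (x + ?\<delta> n *\<^sub>R u) * gauss u) \<le> K * gauss u" for n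
      using fK nn by (auto intro!: mult_right_mono simp: less_imp_le abs_mult)
  qed auto
  then have 1: "(\<lambda>n. complex_of_real (\<integral>u. f (x + ?\<delta> n *\<^sub>R u) * gauss u \<partial>lborel)) \<longlonglongrightarrow> complex_of_real (f x)"
    by (simp only: integral_mult_right_zero integral_gauss mult_1_right tendsto_of_real_iff)
  have "(\<lambda>n. \<integral>\<eta>. gauss (?\<delta> n *\<^sub>R \<eta>) *\<^sub>R (exp (\<i> * complex_of_real (x \<bullet> \<eta>)) * fourier f \<eta>) \<partial>lborel)
     \<longlonglongrightarrow> (\<integral>\<eta>. gauss (0::'a) *\<^sub>R (exp (\<i> * complex_of_real (x \<bullet> \<eta>)) * fourier f \<eta>) \<partial>lborel)"
  proof (rule integral_dominated_convergence)
    show "integrable lborel (\<lambda>\<eta>. ?c * norm (fourier f \<eta>))" using ff by simp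
    have "(\<lambda>n. gauss (?\<delta> n *\<^sub>R \<eta>)) \<longlonglongrightarrow> gauss (0 *\<^sub>R \<eta>)" for \<eta> :: 'a
      using continuous_gauss
      by (intro isCont_tendsto_compose[of _ gauss] tendsto_intros LIMSEQ_inverse_real_of_nat[unfolded inverse_eq_divide])
         (auto simp: continuous_on_eq_continuous_at)
    then show "AE \<eta> in lborel. (\<lambda>n. gauss (?\<delta> n *\<^sub>R \<eta>) *\<^sub>R (exp (\<i> * complex_of_real (x \<bullet> \<eta>)) * fourier f \<eta>))
        \<longlonglongrightarrow> gauss (0::'a) *\<^sub>R (exp (\<i> * complex_of_real (x \<bullet> \<eta>)) * fourier f \<eta>)"
      by (intro AE_I2 tendsto_intros) simp
    show "AE \<eta> in lborel. norm (gauss (?\<delta> n *\<^sub>R \<eta>) *\<^sub>R (exp (\<i> * complex_of_real (x \<bullet> \<eta>)) * fourier f \<eta>)) \<le> ?c * norm (fourier f \<eta>)" for n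
      using gle by (intro AE_I2) (simp add: norm_mult mult_right_mono less_imp_le del: of_nat_Suc power_one_over)
  qed measurable
  then have 2: "(\<lambda>n. complex_of_real (\<integral>u. f (x + ?\<delta> n *\<^sub>R u) * gauss u \<partial>lborel)) \<longlonglongrightarrow>
     ?c *\<^sub>R (\<integral>\<eta>. gauss (0::'a) *\<^sub>R (exp (\<i> * complex_of_real (x \<bullet> \<eta>)) * fourier f \<eta>) \<partial>lborel)"
    unfolding gauss_convolution_fourier[OF f divide_pos_pos[OF zero_less_one of_nat_0_less_iff[THEN iffD2, OF zero_less_Suc]]]
    by (intro tendsto_scaleR tendsto_const)
  \<comment> \<open>One factor \<open>?c\<close> comes from the convolution identity, the other is
    the limit \<open>gauss 0\<close> of the rescaled Gaussian.\<close>
  have "?c * ?c = 1 / (2 * pi) ^ DIM('a)"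
    unfolding power_mult_distrib[symmetric] by (simp add: power_one_over)
  then show ?thesis
    using LIMSEQ_unique[OF 1 2] by (simp only: c1 integral_scaleR_right scaleR_scaleR)
qed


section \<open>Stable densities as inverse Fourier transforms\<close>

lemma stable_density_inversion:
  fixes p :: "real \<Rightarrow> 'a::euclidean_space \<Rightarrow> real"
  assumes p: "stable_density \<alpha> p" and "0 < \<alpha>" "0 < t"
  shows "complex_of_real (p t x) = (1 / (2 * pi) ^ DIM('a)) *\<^sub>R
           (\<integral>\<xi>. exp (\<i> * complex_of_real (x \<bullet> \<xi>)) * complex_of_real (exp (- t * norm \<xi> powr \<alpha>)) \<partial>lborel)"
proof -
  have f: "fourier (p t) = (\<lambda>\<xi>. complex_of_real (exp (- t * norm \<xi> powr \<alpha>)))"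
    using p \<open>0 < t\<close> by (auto simp: stable_density_def)
  have "integrable lborel (\<lambda>\<xi>::'a. complex_of_real (exp (- t * norm \<xi> powr \<alpha>)))"
    using integrable_exp_neg_powr[OF \<open>0 < t\<close> \<open>0 < \<alpha>\<close>, where ?'a='a] by (rule integrable_of_real)
  then show ?thesis
    using fourier_inversion[of "p t" x] p \<open>0 < t\<close> unfolding f by (auto simp: stable_density_def)
qed

text \<open>The mass is the Fourier transform at frequency 0, where \<open>0 powr \<alpha>\<close>
  is 0.\<close>

lemma stable_density_integral:
  assumes p: "stable_density \<alpha> p" and "0 < \<alpha>" "0 < t"
  shows "(\<integral>x. p t x \<partial>lborel) = 1"
proof -
  have "fourier (p t) 0 = 1" using p \<open>0 < t\<close> \<open>0 < \<alpha>\<close> by (simp add: stable_density_def)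
  then have "complex_of_real (\<integral>x. p t x \<partial>lborel) = 1" by (simp add: fourier_def)
  then show ?thesis by (simp only: of_real_eq_1_iff)
qed

text \<open>\<open>stable_density\<close> constrains each time separately and says nothing about
  \<open>t \<le> 0\<close>. Joint measurability in time and space comes from the inversion formula,
  read as an integral depending measurably on a parameter.\<close>

lemma stable_density_jointly_measurable:
  fixes p :: "real \<Rightarrow> 'a::euclidean_space \<Rightarrow> real"
  assumes p: "stable_density \<alpha> p" and "0 < \<alpha>"
  shows "(\<lambda>(t, x). if 0 < t then p t x else 0) \<in> borel_measurable (borel \<Otimes>\<^sub>M borel)"
proof -
  define q :: "real \<times> 'a \<Rightarrow> complex" where "q z = (1 / (2 * pi) ^ DIM('a)) *\<^sub>R
      (\<integral>\<xi>. exp (\<i> * complex_of_real (snd z \<bullet> \<xi>)) * complex_of_real (exp (- fst z * norm \<xi> powr \<alpha>)) \<partial>lborel)" for z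
  have [measurable]: "q \<in> borel_measurable (borel \<Otimes>\<^sub>M borel)"
    unfolding q_def by measurable
  have "p t x = Re (q (t, x))" if "0 < t" for t x
    using stable_density_inversion[OF p \<open>0 < \<alpha>\<close> that, of x] unfolding q_def
    by (metis Re_complex_of_real fst_conv snd_conv)
  then have "(\<lambda>(t, x). if 0 < t then p t x else 0) = (\<lambda>z. if 0 < fst z then Re (q z) else 0)"
    by (auto simp: fun_eq_iff)
  then show ?thesis by simp
qed

subsection \<open>Rapidly decreasing smooth functions\<close>

lemma iterated_partial_append:
  "iterated_partial (bs @ cs) f = iterated_partial bs (iterated_partial cs f)"
  by (induction bs) auto

text \<open>The last entry of the list acts first, so differentiating \<open>f\<close> beforehand
  means appending \<open>b\<close> at the end.\<close>

lemma rapidly_decreasing_smooth_partial: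
  assumes "rapidly_decreasing_smooth f" "b \<in> Basis"
  shows "rapidly_decreasing_smooth (\<lambda>x. frechet_derivative f (at x) b)"
  unfolding rapidly_decreasing_smooth_def
proof
  fix bs :: "'a list" assume "bs \<in> lists Basis"
  with \<open>b \<in> Basis\<close> have "bs @ [b] \<in> lists Basis" by simp
  then show "(\<forall>x. iterated_partial bs (\<lambda>x. frechet_derivative f (at x) b) differentiable (at x)) \<and>
      (\<forall>m::nat. bounded (range (\<lambda>x. norm x ^ m * iterated_partial bs (\<lambda>x. frechet_derivative f (at x) b) x)))"
    using assms(1) unfolding rapidly_decreasing_smooth_def
    by (auto simp: iterated_partial_append dest!: bspec[of _ _ "bs @ [b]"])
qed

lemma rapidly_decreasing_smooth_differentiable:
  "rapidly_decreasing_smooth f \<Longrightarrow> f differentiable (at x)"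
  unfolding rapidly_decreasing_smooth_def by (metis iterated_partial.simps(1) lists.Nil)

lemma rapidly_decreasing_smooth_continuous:
  "rapidly_decreasing_smooth f \<Longrightarrow> continuous_on UNIV f"
  by (intro continuous_at_imp_continuous_on ballI differentiable_imp_continuous_within
      rapidly_decreasing_smooth_differentiable)

lemma rapidly_decreasing_smooth_bound:
  assumes "rapidly_decreasing_smooth f"
  obtains C where "0 \<le> C" "\<And>x. norm x ^ m * \<bar>f x\<bar> \<le> C"
proof -
  have "bounded (range (\<lambda>x. norm x ^ m * f x))"
    using assms unfolding rapidly_decreasing_smooth_def by (metis iterated_partial.simps(1) lists.Nil)
  then obtain C where C: "norm (norm x ^ m * f x) \<le> C" for x
    unfolding bounded_iff by auto
  then have "norm x ^ m * \<bar>f x\<bar> \<le> C" for x by (simp add: abs_mult)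
  moreover have "0 \<le> C" using C[of 0] order_trans[OF norm_ge_zero] by blast
  ultimately show ?thesis using that by blast
qed

lemma one_plus_power_le: "(1 + r) ^ n \<le> 2 ^ n * (1 + r ^ n)" if "0 \<le> r" for r :: real
proof -
  have "(1 + r) ^ n \<le> (2 * max 1 r) ^ n" using that by (intro power_mono) auto
  also have "\<dots> \<le> 2 ^ n * (1 + r ^ n)"
    using that by (auto simp: power_mult_distrib max_def)
  finally show ?thesis .
qed

lemma rapidly_decreasing_smooth_integrable:
  fixes f :: "'a::euclidean_space \<Rightarrow> real"
  assumes f: "rapidly_decreasing_smooth f"
  shows "integrable lborel f"
proof -
  obtain A where A: "0 \<le> A" "\<And>x. norm x ^ 0 * \<bar>f x\<bar> \<le> A"
    using rapidly_decreasing_smooth_bound[OF f, of 0] by metis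
  obtain B where B: "0 \<le> B" "\<And>x. norm x ^ (2 * DIM('a)) * \<bar>f x\<bar> \<le> B"
    using rapidly_decreasing_smooth_bound[OF f] by metis
  show ?thesis
  proof (rule Bochner_Integration.integrable_bound)
    show "integrable lborel (\<lambda>x::'a. 2 ^ DIM('a) * (A + B) * (1 / (1 + norm x ^ 2) ^ DIM('a)))"
      by (intro integrable_mult_right integrable_inverse_polynomial)
    show "AE x in lborel. norm (f x) \<le> norm (2 ^ DIM('a) * (A + B) * (1 / (1 + norm x ^ 2) ^ DIM('a)))"
    proof (rule AE_I2)
      fix x :: 'a
      have "(1 + norm x ^ 2) ^ DIM('a) * \<bar>f x\<bar> \<le> 2 ^ DIM('a) * (1 + (norm x ^ 2) ^ DIM('a)) * \<bar>f x\<bar>"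
        by (intro mult_right_mono one_plus_power_le) auto
      also have "\<dots> = 2 ^ DIM('a) * (norm x ^ 0 * \<bar>f x\<bar> + norm x ^ (2 * DIM('a)) * \<bar>f x\<bar>)"
        by (simp add: power_mult distrib_left distrib_right)
      also have "\<dots> \<le> 2 ^ DIM('a) * (A + B)"
        using A(2)[of x] B(2)[of x] by (intro mult_left_mono add_mono) auto
      finally have "(1 + norm x ^ 2) ^ DIM('a) * \<bar>f x\<bar> \<le> 2 ^ DIM('a) * (A + B)" .
      moreover have "0 < (1 + norm x ^ 2) ^ DIM('a)" by (intro zero_less_power add_pos_nonneg) auto
      ultimately show "norm (f x) \<le> norm (2 ^ DIM('a) * (A + B) * (1 / (1 + norm x ^ 2) ^ DIM('a)))"
        using A(1) B(1) by (simp add: field_simps)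
    qed
    show "f \<in> borel_measurable lborel"
      using borel_measurable_continuous_onI[OF rapidly_decreasing_smooth_continuous[OF f]] by simp
  qed
qed

text \<open>The integral of \<open>h\<close> is translation invariant and \<open>h (x + b) - h x\<close> integrates \<open>k\<close> along \<open>b\<close>.\<close>

lemma integral_directional_derivative_zero:
  fixes h k :: "'a::euclidean_space \<Rightarrow> complex"
  assumes h: "integrable lborel h" and k: "integrable lborel k" and cont: "continuous_on UNIV k"
    and deriv: "\<And>x s. ((\<lambda>s. h (x + s *\<^sub>R b)) has_vector_derivative k (x + s *\<^sub>R b)) (at s)"
  shows "(\<integral>x. k x \<partial>lborel) = 0"
proof -
  let ?F = "\<lambda>s x. indicator {0..1::real} s *\<^sub>R k (x + s *\<^sub>R b)"
  have [measurable]: "k \<in> borel_measurable borel" using k by auto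
  have int: "integrable (lborel \<Otimes>\<^sub>M lborel) (\<lambda>(s, x). ?F s x)"
  proof (rule lborel_pair.Fubini_integrable)
    have "integrable lborel (\<lambda>s::real. indicator {0..1} s * (\<integral>x. norm (k x) \<partial>lborel))"
      by (intro integrable_mult_left integrable_real_indicator) auto
    moreover have "(\<integral>x. norm (k (x + s *\<^sub>R b)) \<partial>lborel) = (\<integral>x. norm (k x) \<partial>lborel)" for s
      using integral_lborel_shift(1)[of "\<lambda>x. norm (k x)" "s *\<^sub>R b"] by (simp add: add.commute)
    ultimately show "integrable lborel (\<lambda>s. \<integral>x. norm (case (s, x) of (s, x) \<Rightarrow> ?F s x) \<partial>lborel)"
      by simp
    show "AE s in lborel. integrable lborel (\<lambda>x. case (s, x) of (s, x) \<Rightarrow> ?F s x)"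
      using k integral_lborel_shift(3)[of k] by (auto simp: add.commute[of _ "_ *\<^sub>R b"])
  qed measurable
  have inner: "(\<integral>s. ?F s x \<partial>lborel) = h (b + x) - h x" for x
  proof -
    have "continuous_on {0..1} (\<lambda>s. k (x + s *\<^sub>R b))"
      by (intro continuous_on_compose2[OF cont] continuous_intros) auto
    then have "(\<integral>s. indicator {0..1} s *\<^sub>R k (x + s *\<^sub>R b) \<partial>lborel) = h (x + 1 *\<^sub>R b) - h (x + 0 *\<^sub>R b)"
      using deriv by (intro integral_FTC_Icc) (auto intro: has_vector_derivative_at_within)
    then show ?thesis by (simp add: add.commute)
  qed
  have "(\<integral>x. k x \<partial>lborel) = (\<integral>s. indicator {0..1::real} s *\<^sub>R (\<integral>x. k x \<partial>lborel) \<partial>lborel)"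
    by (subst integral_scaleR_left) auto
  also have "\<dots> = (\<integral>s. (\<integral>x. ?F s x \<partial>lborel) \<partial>lborel)"
    using integral_lborel_shift(1)[of k] by (simp add: add.commute[of _ "_ *\<^sub>R b"])
  also have "\<dots> = (\<integral>x. (\<integral>s. ?F s x \<partial>lborel) \<partial>lborel)"
    by (rule lborel_pair.Fubini_integral[OF int, symmetric])
  also have "\<dots> = (\<integral>x. h (b + x) - h x \<partial>lborel)"
    by (simp only: inner)
  also have "\<dots> = 0"
    using h integral_lborel_shift(1,3)[where f=h and t=b] by (subst Bochner_Integration.integral_diff) auto
  finally show ?thesis .
qed

text \<open>Integration by parts without boundary terms: an integrable directional derivative of an
  integrable function has integral zero.\<close>

lemma fourier_partial:
  fixes f :: "'a::euclidean_space \<Rightarrow> real"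
  assumes f: "rapidly_decreasing_smooth f" and b: "b \<in> Basis"
  shows "fourier (\<lambda>x. frechet_derivative f (at x) b) \<xi> = \<i> * complex_of_real (\<xi> \<bullet> b) * fourier f \<xi>"
proof -
  let ?g = "\<lambda>x. frechet_derivative f (at x) b"
  let ?e = "\<lambda>x. exp (- (\<i> * complex_of_real (x \<bullet> \<xi>)))"
  \<comment> \<open>The derivative along \<open>b\<close> of the integrand of
    \<open>fourier f \<xi>\<close>.\<close>
  let ?k = "\<lambda>x. ?e x * complex_of_real (?g x) - \<i> * complex_of_real (\<xi> \<bullet> b) * (?e x * complex_of_real (f x))"
  note g = rapidly_decreasing_smooth_partial[OF f b]
  note fi = integrable_fourier_integrand[OF rapidly_decreasing_smooth_integrable[OF f], of \<xi>]
  note gi = integrable_fourier_integrand[OF rapidly_decreasing_smooth_integrable[OF g], of \<xi>]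
  have "(\<integral>x. ?k x \<partial>lborel) = 0"
  proof (rule integral_directional_derivative_zero)
    show "integrable lborel (\<lambda>x. ?e x * complex_of_real (f x))" by (rule fi)
    show "integrable lborel ?k" by (intro Bochner_Integration.integrable_diff integrable_mult_right fi gi)
    show "continuous_on UNIV ?k"
      by (intro continuous_intros rapidly_decreasing_smooth_continuous f g)
    fix x s
    have "((\<lambda>s. f (x + s *\<^sub>R b)) has_derivative (\<lambda>r. frechet_derivative f (at (x + s *\<^sub>R b)) (r *\<^sub>R b))) (at s)"
      using rapidly_decreasing_smooth_differentiable[OF f, of "x + s *\<^sub>R b"]
      by (intro has_derivative_compose[where g=f and f="\<lambda>s. x + s *\<^sub>R b"])
         (auto intro!: derivative_eq_intros simp: frechet_derivative_works)
    moreover have "frechet_derivative f (at y) (r *\<^sub>R b) = r *\<^sub>R ?g y" for r y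
      using linear_frechet_derivative[OF rapidly_decreasing_smooth_differentiable[OF f]] by (simp add: linear_scale)
    ultimately have "((\<lambda>s. f (x + s *\<^sub>R b)) has_vector_derivative ?g (x + s *\<^sub>R b)) (at s)"
      by (simp add: has_vector_derivative_def)
    then have 1: "((\<lambda>s. complex_of_real (f (x + s *\<^sub>R b))) has_vector_derivative complex_of_real (?g (x + s *\<^sub>R b))) (at s)"
      by (intro has_vector_derivative_of_real) (simp add: has_real_derivative_iff_has_vector_derivative)
    have 2: "((\<lambda>s. ?e (x + s *\<^sub>R b)) has_vector_derivative - (\<i> * complex_of_real (\<xi> \<bullet> b)) * ?e (x + s *\<^sub>R b)) (at s)"
    proof -
      let ?A = "- (\<i> * complex_of_real (\<xi> \<bullet> b))"
      have e: "?e (x + s *\<^sub>R b) = ?e x * exp (s *\<^sub>R ?A)" for s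
        by (simp add: exp_add[symmetric] inner_add_left inner_commute[of b] scaleR_conv_of_real algebra_simps)
      have "((\<lambda>s. ?e x * exp (s *\<^sub>R ?A)) has_vector_derivative ?e x * (exp (s *\<^sub>R ?A) * ?A)) (at s)"
        by (intro has_vector_derivative_mult_right exp_scaleR_has_vector_derivative_right)
      then show ?thesis unfolding e by (simp only: mult.commute mult.left_commute)
    qed
    show "((\<lambda>s. ?e (x + s *\<^sub>R b) * complex_of_real (f (x + s *\<^sub>R b))) has_vector_derivative ?k (x + s *\<^sub>R b)) (at s)"
      using has_vector_derivative_mult[OF 2 1] by (simp add: algebra_simps)
  qed
  then have "(\<integral>x. ?e x * complex_of_real (?g x) \<partial>lborel) -
      \<i> * complex_of_real (\<xi> \<bullet> b) * (\<integral>x. ?e x * complex_of_real (f x) \<partial>lborel) = 0"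
    unfolding Bochner_Integration.integral_diff[OF gi integrable_mult_right[OF fi]] by (simp only: integral_mult_right_zero)
  then show ?thesis by (simp add: fourier_def)
qed

text \<open>One power of the norm is at most the sum of the coordinates in absolute value, and each
  coordinate is absorbed by a partial derivative, which is again rapidly decreasing. Hence the
  induction is over all \<open>f\<close>.\<close>

lemma fourier_decay:
  fixes f :: "'a::euclidean_space \<Rightarrow> real"
  assumes "rapidly_decreasing_smooth f"
  shows "\<exists>C. \<forall>\<xi>. norm \<xi> ^ m * norm (fourier f \<xi>) \<le> C"
  using assms
proof (induction m arbitrary: f)
  case 0
  then show ?case using norm_fourier_le[OF rapidly_decreasing_smooth_integrable] by auto
next
  case (Suc m)
  let ?g = "\<lambda>b x. frechet_derivative f (at x) b"
  have "\<forall>b\<in>Basis. \<exists>C. \<forall>\<xi>. norm \<xi> ^ m * norm (fourier (?g b) \<xi>) \<le> C"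
    using Suc.IH rapidly_decreasing_smooth_partial[OF Suc.prems] by blast
  then obtain C where C: "\<And>b \<xi>. b \<in> Basis \<Longrightarrow> norm \<xi> ^ m * norm (fourier (?g b) \<xi>) \<le> C b"
    by metis
  have "norm \<xi> ^ Suc m * norm (fourier f \<xi>) \<le> (\<Sum>b\<in>Basis. C b)" for \<xi>
  proof -
    have "norm \<xi> ^ Suc m * norm (fourier f \<xi>) \<le> (\<Sum>b\<in>Basis. \<bar>\<xi> \<bullet> b\<bar>) * (norm \<xi> ^ m * norm (fourier f \<xi>))"
      using norm_le_l1[of \<xi>] by (simp add: mult.assoc mult_right_mono)
    also have "\<dots> = (\<Sum>b\<in>Basis. norm \<xi> ^ m * norm (fourier (?g b) \<xi>))"
      unfolding sum_distrib_right
      by (intro sum.cong refl) (simp add: fourier_partial[OF Suc.prems] norm_mult)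
    also have "\<dots> \<le> (\<Sum>b\<in>Basis. C b)" by (intro sum_mono C)
    finally show ?thesis .
  qed
  then show ?case by blast
qed

text \<open>Expanding the phase produces powers of the frequencies; these weighted integrals keep
  both the coefficients and the Taylor remainder finite.\<close>

lemma integrable_fourier_weighted:
  fixes f :: "'a::euclidean_space \<Rightarrow> real"
  assumes f: "rapidly_decreasing_smooth f"
  shows "integrable lborel (\<lambda>\<xi>. (1 + norm \<xi>) ^ n * norm (fourier f \<xi>))"
proof -
  \<comment> \<open>The surplus of \<open>2 * DIM('a)\<close> powers pays for the majorant
    \<open>1 / (1 + norm x ^ 2) ^ DIM('a)\<close>.\<close>
  define k where "k = n + 2 * DIM('a)"
  obtain A where A: "\<And>\<xi>. norm \<xi> ^ 0 * norm (fourier f \<xi>) \<le> A" using fourier_decay[OF f] by metis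
  obtain B where B: "\<And>\<xi>. norm \<xi> ^ k * norm (fourier f \<xi>) \<le> B" using fourier_decay[OF f] by metis
  have [measurable]: "fourier f \<in> borel_measurable borel"
    by (intro fourier_measurable rapidly_decreasing_smooth_integrable f)
  show ?thesis
  proof (rule Bochner_Integration.integrable_bound)
    show "integrable lborel (\<lambda>x::'a. 2 ^ k * (A + B) * (1 / (1 + norm x ^ 2) ^ DIM('a)))"
      by (intro integrable_mult_right integrable_inverse_polynomial)
    show "AE \<xi> in lborel. norm ((1 + norm \<xi>) ^ n * norm (fourier f \<xi>)) \<le> norm (2 ^ k * (A + B) * (1 / (1 + norm \<xi> ^ 2) ^ DIM('a)))"
    proof (rule AE_I2)
      fix \<xi> :: 'a
      let ?F = "norm (fourier f \<xi>)"
      have "1 + norm \<xi> ^ 2 \<le> (1 + norm \<xi>)\<^sup>2" by (simp add: power2_eq_square algebra_simps)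
      then have "(1 + norm \<xi> ^ 2) ^ DIM('a) * ((1 + norm \<xi>) ^ n * ?F) \<le> ((1 + norm \<xi>)\<^sup>2) ^ DIM('a) * ((1 + norm \<xi>) ^ n * ?F)"
        by (intro mult_right_mono power_mono) auto
      also have "\<dots> = (1 + norm \<xi>) ^ k * ?F"
        by (simp add: k_def power_add power_mult)
      also have "\<dots> \<le> 2 ^ k * (1 + norm \<xi> ^ k) * ?F"
        by (intro mult_right_mono one_plus_power_le) auto
      also have "\<dots> = 2 ^ k * (norm \<xi> ^ 0 * ?F + norm \<xi> ^ k * ?F)"
        by (simp add: algebra_simps)
      also have "\<dots> \<le> 2 ^ k * (A + B)"
        using A[of \<xi>] B[of \<xi>] by (intro mult_left_mono add_mono) auto
      finally have "(1 + norm \<xi> ^ 2) ^ DIM('a) * ((1 + norm \<xi>) ^ n * ?F) \<le> 2 ^ k * (A + B)" .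
      moreover have "0 < (1 + norm \<xi> ^ 2) ^ DIM('a)" by (intro zero_less_power add_pos_nonneg) auto
      moreover have "0 \<le> A + B" using A[of 0] B[of 0]
        by (meson add_nonneg_nonneg mult_nonneg_nonneg norm_ge_zero order_trans zero_le_power)
      ultimately show "norm ((1 + norm \<xi>) ^ n * ?F) \<le> norm (2 ^ k * (A + B) * (1 / (1 + norm \<xi> ^ 2) ^ DIM('a)))"
        by (simp add: field_simps)
    qed
  qed measurable
qed

subsection \<open>Powers of an integral as integrals over a simplex\<close>

text \<open>Formally \<open>F\<close> has derivative \<open>- g\<close>, but \<open>g\<close> is
  only integrable, so the antiderivative is replaced by Fubini. Exchanging the order of integration
  expresses the integral \<open>I\<close> for \<open>Suc k\<close> through itself, and the resulting
  linear equation is solved for \<open>I\<close>.\<close>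

lemma integral_tail_power:
  fixes g :: "real \<Rightarrow> real"
  assumes g: "integrable lborel g"
  defines "F \<equiv> \<lambda>s. \<integral>u. (if s < u then g u else 0) \<partial>lborel"
  shows "(\<integral>s. (if a < s then g s * F s ^ k else 0) \<partial>lborel) = F a ^ Suc k / Suc k"
proof -
  have [measurable]: "g \<in> borel_measurable borel" using g by auto
  have F[measurable]: "F \<in> borel_measurable borel" unfolding F_def by measurable
  define K where "K = (\<integral>u. \<bar>g u\<bar> \<partial>lborel)"
  have FK: "\<bar>F s\<bar> \<le> K" for s
    unfolding F_def K_def using norm_integral_le_integral[of lborel "\<lambda>u. \<bar>g u\<bar>" "\<lambda>u. if s < u then g u else 0"] g by simp
  have int: "integrable lborel (\<lambda>s. if P s then g s * F s ^ k else 0)" if "Measurable.pred borel P" for P k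
  proof (rule Bochner_Integration.integrable_bound)
    show "integrable lborel (\<lambda>s. g s * K ^ k)" using g by simp
    show "AE s in lborel. norm (if P s then g s * F s ^ k else 0) \<le> norm (g s * K ^ k)"
      using FK by (auto intro!: AE_I2 mult_left_mono power_mono simp: abs_mult power_abs intro: order_trans[OF FK])
  qed (use that in measurable)
  show ?thesis
  proof (induction k arbitrary: a)
    case 0
    then show ?case by (simp add: F_def cong: if_cong)
  next
    case (Suc k)
    define I where "I = (\<integral>s. (if a < s then g s * F s ^ Suc k else 0) \<partial>lborel)"
    let ?H = "\<lambda>s u. if a < s \<and> s < u then g s * F s ^ k * g u else 0"
    have H: "integrable (lborel \<Otimes>\<^sub>M lborel) (\<lambda>(s, u). ?H s u)"
    proof (rule Bochner_Integration.integrable_bound)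
      show "integrable (lborel \<Otimes>\<^sub>M lborel) (\<lambda>(s, u). (g s * F s ^ k) * g u)"
        using int[of "\<lambda>_. True" k] by (intro lborel_pair.integrable_pair_mult g) simp
    qed auto
    have "I = (\<integral>s. (\<integral>u. ?H s u \<partial>lborel) \<partial>lborel)"
      unfolding I_def
    proof (intro Bochner_Integration.integral_cong refl)
      fix s
      have "(\<integral>u. ?H s u \<partial>lborel) = (\<integral>u. (if a < s then g s * F s ^ k else 0) * (if s < u then g u else 0) \<partial>lborel)"
        by (intro Bochner_Integration.integral_cong) auto
      also have "\<dots> = (if a < s then g s * F s ^ k else 0) * F s"
        unfolding F_def by (rule integral_mult_right_zero)
      finally show "(if a < s then g s * F s ^ Suc k else 0) = (\<integral>u. ?H s u \<partial>lborel)" by simp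
    qed
    also have "\<dots> = (\<integral>u. (\<integral>s. ?H s u \<partial>lborel) \<partial>lborel)"
      by (rule lborel_pair.Fubini_integral[OF H, symmetric])
    also have "\<dots> = (\<integral>u. (if a < u then g u else 0) * (F a ^ Suc k / Suc k) - (if a < u then g u * F u ^ Suc k else 0) / Suc k \<partial>lborel)"
    proof (intro Bochner_Integration.integral_cong refl)
      fix u
      show "(\<integral>s. ?H s u \<partial>lborel) =
        (if a < u then g u else 0) * (F a ^ Suc k / Suc k) - (if a < u then g u * F u ^ Suc k else 0) / Suc k"
      proof (cases "a < u")
        case True
        \<comment> \<open>The range between \<open>a\<close> and \<open>u\<close> is the tail above
          \<open>a\<close> minus the tail above \<open>u\<close>, up to the null set consisting of
          \<open>u\<close>.\<close>
        have "(\<integral>s. ?H s u \<partial>lborel) = (\<integral>s. g u * ((if a < s then g s * F s ^ k else 0) - (if u < s then g s * F s ^ k else 0)) \<partial>lborel)"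
          using AE_lborel_singleton[of u] True by (intro integral_cong_AE) (auto intro!: AE_I2 elim!: eventually_mono)
        also have "\<dots> = g u * (F a ^ Suc k / Suc k - F u ^ Suc k / Suc k)"
          by (subst integral_mult_right_zero, subst Bochner_Integration.integral_diff) (auto intro!: int simp del: power_Suc simp: Suc)
        finally show ?thesis using True by (simp add: algebra_simps)
      next
        case False
        then have "?H s u = 0" for s by auto
        with False show ?thesis by simp
      qed
    qed
    also have "\<dots> = F a * (F a ^ Suc k / Suc k) - I / Suc k"
    proof (subst Bochner_Integration.integral_diff)
      show "integrable lborel (\<lambda>u. (if a < u then g u else 0) * (F a ^ Suc k / Suc k))"
        using int[of "\<lambda>u. a < u" 0] by (intro integrable_mult_left) (simp cong: if_cong)
      show "integrable lborel (\<lambda>u. (if a < u then g u * F u ^ Suc k else 0) / Suc k)"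
        by (intro integrable_divide int) measurable
    qed (simp only: integral_mult_left_zero integral_divide_zero I_def F_def)
    finally have "I * real (Suc k) = F a * F a ^ Suc k - I"
      by (simp add: field_simps del: of_nat_Suc power_Suc)
    then have "I * real (Suc (Suc k)) = F a ^ Suc (Suc k)" by (simp add: algebra_simps)
    then show ?case unfolding I_def[symmetric] by (simp add: eq_divide_eq del: power_Suc of_nat_Suc)
  qed
qed

text \<open>The chain \<open>a < l k < \<dots> < l 1\<close>. The recursion peels off the largest
  index, which carries the smallest value; this is the coordinate inserted when the product measure
  grows from \<open>{1..k}\<close> to \<open>{1..Suc k}\<close>.\<close>

primrec decreasing_above :: "real \<Rightarrow> nat \<Rightarrow> (nat \<Rightarrow> real) \<Rightarrow> bool" where
  "decreasing_above a 0 l = True"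
| "decreasing_above a (Suc k) l = (a < l (Suc k) \<and> decreasing_above (l (Suc k)) k l)"

lemma decreasing_above_iff:
  "decreasing_above a k l \<longleftrightarrow> (1 \<le> k \<longrightarrow> a < l k) \<and> (\<forall>i\<in>{1..<k}. l (i + 1) < l i)"
proof (induction k arbitrary: a)
  case (Suc k)
  then show ?case by (cases k) (auto simp: atLeastLessThanSuc)
qed simp

lemma decreasing_above_cong:
  "(\<And>i. i \<in> {1..k} \<Longrightarrow> l i = l' i) \<Longrightarrow> decreasing_above a k l = decreasing_above a k l'"
  by (induction k arbitrary: a) auto

lemma pred_decreasing_above [measurable]:
  assumes [measurable]: "f \<in> borel_measurable N" and "\<And>i. i \<in> {1..k} \<Longrightarrow> (\<lambda>x. l x i) \<in> borel_measurable N"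
  shows "Measurable.pred N (\<lambda>x. decreasing_above (f x) k (l x))"
  using assms
proof (induction k arbitrary: f)
  case (Suc k)
  have [measurable]: "(\<lambda>x. l x (Suc k)) \<in> borel_measurable N" by (intro Suc.prems) auto
  have [measurable]: "Measurable.pred N (\<lambda>x. decreasing_above (l x (Suc k)) k (l x))"
    by (intro Suc.IH Suc.prems) auto
  note Suc.prems(1)[measurable]
  show ?case by simp
qed simp

text \<open>The new smallest variable becomes the lower bound for the others. The induction
  hypothesis turns their integral into a power of the tail integral, which
  \<open>integral_tail_power\<close> integrates.\<close>

lemma integral_decreasing_above:
  fixes g :: "real \<Rightarrow> real"
  assumes g: "integrable lborel g"
  shows "(\<integral>l. (if decreasing_above a k l then \<Prod>i=1..k. g (l i) else 0) \<partial>(\<Pi>\<^sub>M i\<in>{1..k}. lborel)) =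
         (\<integral>u. (if a < u then g u else 0) \<partial>lborel) ^ k / fact k"
proof (induction k arbitrary: a)
  case 0
  interpret product_sigma_finite "\<lambda>_::nat. lborel :: real measure" ..
  show ?case by (simp add: PiM_empty lebesgue_integral_count_space_finite)
next
  case (Suc k)
  interpret product_sigma_finite "\<lambda>_::nat. lborel :: real measure" ..
  interpret k: finite_product_sigma_finite "\<lambda>_::nat. lborel :: real measure" "{1..k}" by standard auto
  interpret kp: pair_sigma_finite "\<Pi>\<^sub>M i\<in>{1..k}. lborel :: real measure" "lborel :: real measure" ..
  have [measurable]: "g \<in> borel_measurable borel" using g by auto
  let ?f = "\<lambda>l. if decreasing_above a (Suc k) l then \<Prod>i=1..Suc k. g (l i) else 0"
  let ?F = "\<lambda>s. \<integral>u. (if s < u then g u else 0) \<partial>lborel"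
  have ins: "{1..Suc k} = insert (Suc k) {1..k}" by auto
  have f: "integrable (\<Pi>\<^sub>M i\<in>{1..Suc k}. lborel) ?f"
  proof (rule Bochner_Integration.integrable_bound)
    show "integrable (\<Pi>\<^sub>M i\<in>{1..Suc k}. lborel) (\<lambda>l. \<Prod>i=1..Suc k. g (l i))"
      by (intro product_integrable_prod g) auto
    show "?f \<in> borel_measurable (\<Pi>\<^sub>M i\<in>{1..Suc k}. lborel)"
    proof -
      have comp[measurable]: "(\<lambda>l. l i) \<in> borel_measurable (\<Pi>\<^sub>M i\<in>{1..Suc k}. (lborel :: real measure))"
        if "i \<in> {1..Suc k}" for i
        using measurable_component_singleton[OF that, of "\<lambda>_. lborel"] by simp
      have [measurable]: "Measurable.pred (\<Pi>\<^sub>M i\<in>{1..Suc k}. (lborel :: real measure)) (\<lambda>l. decreasing_above a (Suc k) l)"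
        by (rule pred_decreasing_above[where f="\<lambda>_. a" and l="\<lambda>l. l"]) (use comp in auto)
      have [measurable]: "(\<lambda>l. \<Prod>i=1..Suc k. g (l i)) \<in> borel_measurable (\<Pi>\<^sub>M i\<in>{1..Suc k}. lborel)"
        by (intro borel_measurable_prod measurable_compose[OF comp, of _ g]) auto
      show ?thesis by measurable
    qed
  qed auto
  have upd: "?f (x(Suc k := y)) = (if a < y then g y * (if decreasing_above y k x then \<Prod>i=1..k. g (x i) else 0) else 0)" for x y
  proof -
    have "decreasing_above y k (x(Suc k := y)) = decreasing_above y k x"
      by (intro decreasing_above_cong) auto
    moreover have "(\<Prod>i=1..k. g ((x(Suc k := y)) i)) = (\<Prod>i=1..k. g (x i))"
      by (intro prod.cong) auto
    ultimately show ?thesis by (simp add: mult.commute)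
  qed
  have int2: "integrable ((\<Pi>\<^sub>M i\<in>{1..k}. lborel) \<Otimes>\<^sub>M lborel) (\<lambda>(x, y). ?f (x(Suc k := y)))"
  proof (rule Bochner_Integration.integrable_bound)
    show "integrable ((\<Pi>\<^sub>M i\<in>{1..k}. lborel) \<Otimes>\<^sub>M lborel) (\<lambda>(x, y). (\<Prod>i=1..k. g (x i)) * g y)"
      by (intro kp.integrable_pair_mult product_integrable_prod g) auto
    have m: "(\<lambda>x. fst x i) \<in> borel_measurable ((\<Pi>\<^sub>M i\<in>{1..k}. (lborel :: real measure)) \<Otimes>\<^sub>M (lborel::real measure))" if "i \<in> {1..k}" for i
      using measurable_compose[OF measurable_fst measurable_component_singleton[OF that, of "\<lambda>_. lborel :: real measure"], of lborel]
      by simp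
    show "(\<lambda>(x, y). ?f (x(Suc k := y))) \<in> borel_measurable ((\<Pi>\<^sub>M i\<in>{1..k}. lborel) \<Otimes>\<^sub>M lborel)"
    proof -
      have [measurable]: "Measurable.pred ((\<Pi>\<^sub>M i\<in>{1..k}. lborel) \<Otimes>\<^sub>M (lborel::real measure)) (\<lambda>x. decreasing_above (snd x) k (fst x))"
        by (rule pred_decreasing_above[where f=snd and l=fst]) (use m in auto)
      have [measurable]: "(\<lambda>x. \<Prod>i=1..k. g (fst x i)) \<in> borel_measurable ((\<Pi>\<^sub>M i\<in>{1..k}. lborel) \<Otimes>\<^sub>M (lborel::real measure))"
        by (intro borel_measurable_prod measurable_compose[OF m, of _ g]) auto
      have eq: "(\<lambda>(x, y). ?f (x(Suc k := y))) = (\<lambda>x. if a < snd x then g (snd x) *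
          (if decreasing_above (snd x) k (fst x) then \<Prod>i=1..k. g (fst x i) else 0) else 0)"
        by (simp only: upd fun_eq_iff split_beta simp_thms)
      show ?thesis unfolding eq by measurable
    qed
  qed (auto simp: upd abs_mult)
  have "(\<integral>l. ?f l \<partial>(\<Pi>\<^sub>M i\<in>{1..Suc k}. lborel)) = (\<integral>x. (\<integral>y. ?f (x(Suc k := y)) \<partial>lborel) \<partial>(\<Pi>\<^sub>M i\<in>{1..k}. lborel))"
    using f unfolding ins by (intro product_integral_insert) auto
  also have "\<dots> = (\<integral>y. (\<integral>x. ?f (x(Suc k := y)) \<partial>(\<Pi>\<^sub>M i\<in>{1..k}. lborel)) \<partial>lborel)"
    by (rule kp.Fubini_integral[OF int2, symmetric])
  also have "\<dots> = (\<integral>y. (if a < y then g y * ?F y ^ k else 0) / fact k \<partial>lborel)"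
  proof (intro Bochner_Integration.integral_cong refl)
    fix y
    show "(\<integral>x. ?f (x(Suc k := y)) \<partial>(\<Pi>\<^sub>M i\<in>{1..k}. lborel)) = (if a < y then g y * ?F y ^ k else 0) / fact k"
      unfolding upd by (cases "a < y") (simp_all only: if_True if_False integral_mult_right_zero Suc, simp_all)
  qed
  also have "\<dots> = ?F a ^ Suc k / fact (Suc k)"
    using integral_tail_power[OF g, of a k] by (simp add: mult.commute)
  finally show ?case .
qed

lemma ordered_simplex_iff:
  assumes "1 \<le> k"
  shows "l \<in> ordered_simplex k \<longleftrightarrow>
    l \<in> extensional {1..k} \<and> decreasing_above 0 k l \<and> (\<forall>i\<in>{1..k}. 0 < l i \<and> l i < 1)"
proof
  assume l: "l \<in> ordered_simplex k"
  then have dec: "\<And>i. i \<in> {1..<k} \<Longrightarrow> l (i + 1) < l i" and "0 < l k" "l 1 < 1" "l \<in> extensional {1..k}"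
    by (auto simp: ordered_simplex_def PiE_def)
  have "1 \<le> i \<Longrightarrow> i \<le> k \<Longrightarrow> l i < 1" for i
  proof (induction i rule: dec_induct)
    case (step n) then show ?case using dec[of n] by simp
  qed (use \<open>l 1 < 1\<close> in simp)
  moreover have "i \<le> k \<Longrightarrow> 1 \<le> i \<Longrightarrow> 0 < l i" for i
  proof (induction i rule: inc_induct)
    case (step n) then show ?case using dec[of n] by simp
  qed (use \<open>0 < l k\<close> in simp)
  ultimately show "l \<in> extensional {1..k} \<and> decreasing_above 0 k l \<and> (\<forall>i\<in>{1..k}. 0 < l i \<and> l i < 1)"
    using dec \<open>0 < l k\<close> \<open>l \<in> extensional _\<close> by (auto simp: decreasing_above_iff)
next
  assume "l \<in> extensional {1..k} \<and> decreasing_above 0 k l \<and> (\<forall>i\<in>{1..k}. 0 < l i \<and> l i < 1)"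
  then show "l \<in> ordered_simplex k"
    using assms by (auto simp: ordered_simplex_def decreasing_above_iff PiE_def less_imp_le)
qed

lemma ordered_simplex_sets [measurable]:
  assumes "1 \<le> k"
  shows "ordered_simplex k \<in> sets (\<Pi>\<^sub>M i\<in>{1..k}. lborel)"
proof -
  have [measurable]: "Measurable.pred (\<Pi>\<^sub>M i\<in>{1..k}. (lborel::real measure)) (decreasing_above 0 k)"
    by (rule pred_decreasing_above) auto
  have "ordered_simplex k = {l \<in> space (\<Pi>\<^sub>M i\<in>{1..k}. lborel). decreasing_above 0 k l \<and> (\<forall>i\<in>{1..k}. 0 < l i \<and> l i < 1)}"
    using ordered_simplex_iff[OF assms] by (auto simp: space_PiM PiE_def)
  then show ?thesis by simp
qed

text \<open>The lower limit 0 is the parameter of \<open>decreasing_above\<close>; the upper limit 1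
  is absorbed into the integrand by cutting \<open>h\<close> off outside the unit interval.\<close>

lemma integral_ordered_simplex_prod:
  fixes h :: "real \<Rightarrow> real"
  assumes k: "1 \<le> k" and h: "set_integrable lborel {0<..<1} h"
  shows "(LINT l:ordered_simplex k|(\<Pi>\<^sub>M i\<in>{1..k}. lborel). \<Prod>i=1..k. h (l i)) =
         (LINT s:{0<..<1}|lborel. h s) ^ k / fact k"
proof -
  let ?g = "\<lambda>s. indicator {0<..<1} s * h s"
  have g: "integrable lborel ?g" using h by (simp add: set_integrable_def)
  have "(LINT l:ordered_simplex k|(\<Pi>\<^sub>M i\<in>{1..k}. lborel). \<Prod>i=1..k. h (l i)) =
     (\<integral>l. (if decreasing_above 0 k l then \<Prod>i=1..k. ?g (l i) else 0) \<partial>(\<Pi>\<^sub>M i\<in>{1..k}. lborel))"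
    unfolding set_lebesgue_integral_def
  proof (intro Bochner_Integration.integral_cong refl)
    fix l assume "l \<in> space (\<Pi>\<^sub>M i\<in>{1..k}. (lborel :: real measure))"
    then have "l \<in> extensional {1..k}" by (simp add: space_PiM PiE_def)
    then show "indicator (ordered_simplex k) l *\<^sub>R (\<Prod>i=1..k. h (l i)) =
        (if decreasing_above 0 k l then \<Prod>i=1..k. ?g (l i) else 0)"
      by (auto simp: ordered_simplex_iff[OF k] indicator_def prod_zero_iff intro!: prod.cong)
  qed
  also have "\<dots> = (\<integral>u. (if 0 < u then ?g u else 0) \<partial>lborel) ^ k / fact k"
    by (rule integral_decreasing_above[OF g])
  also have "(\<integral>u. (if 0 < u then ?g u else 0) \<partial>lborel) = (LINT s:{0<..<1}|lborel. h s)"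
    unfolding set_lebesgue_integral_def by (intro Bochner_Integration.integral_cong) auto
  finally show ?thesis .
qed

lemma emeasure_ordered_simplex_finite:
  assumes k: "1 \<le> k"
  shows "emeasure (\<Pi>\<^sub>M i\<in>{1..k}. lborel) (ordered_simplex k) < \<infinity>"
proof -
  interpret product_sigma_finite "\<lambda>_::nat. lborel :: real measure" ..
  have "ordered_simplex k \<subseteq> ({1..k} \<rightarrow>\<^sub>E {0..1})" by (auto simp: ordered_simplex_def)
  then have "emeasure (\<Pi>\<^sub>M i\<in>{1..k}. lborel) (ordered_simplex k) \<le> emeasure (\<Pi>\<^sub>M i\<in>{1..k}. lborel) ({1..k} \<rightarrow>\<^sub>E {0..1::real})"
    by (intro emeasure_mono) auto
  also have "\<dots> = 1" by (subst emeasure_PiM) auto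
  finally show ?thesis by (simp add: order_le_less_trans)
qed

subsection \<open>Moments of the bridge\<close>

text \<open>Otherwise the simplifier turns \<open>{1..k}\<close> into \<open>{Suc 0..k}\<close>, where measurability rules no longer match.\<close>

declare One_nat_def [simp del]

text \<open>The probabilistic part treats the stable densities only as jointly measurable
  probability densities, at a fixed time \<open>t\<close>. The space \<open>M x y\<close> may change
  arbitrarily with the endpoints.\<close>

locale bridge_family =
  fixes p :: "real \<Rightarrow> 'a::euclidean_space \<Rightarrow> real" and t :: real
    and M :: "'a \<Rightarrow> 'a \<Rightarrow> 'w measure" and X :: "'a \<Rightarrow> 'a \<Rightarrow> real \<Rightarrow> 'w \<Rightarrow> 'a"
  assumes t_pos: "0 < t"
    and p_nonneg: "\<And>s x. 0 < s \<Longrightarrow> 0 \<le> p s x"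
    and p_measurable: "(\<lambda>(s, x). p s x) \<in> borel_measurable (borel \<Otimes>\<^sub>M borel)"
    and p_integrable: "\<And>s. 0 < s \<Longrightarrow> integrable lborel (p s)"
    and p_integral: "\<And>s. 0 < s \<Longrightarrow> (\<integral>x. p s x \<partial>lborel) = 1"
    and bridge: "\<And>x y. stable_bridge p t x y (M x y) (X x y)"
begin

abbreviation L :: "nat \<Rightarrow> (nat \<Rightarrow> real) measure" where "L k \<equiv> \<Pi>\<^sub>M i\<in>{1..k}. lborel"
abbreviation Z :: "nat \<Rightarrow> (nat \<Rightarrow> 'a) measure" where "Z k \<equiv> \<Pi>\<^sub>M i\<in>{1..k}. lborel"

text \<open>The sequences \<open>l\<close> and \<open>z\<close> carry information on
  \<open>{1..k}\<close> only; the updates at 0 and \<open>k + 1\<close> supply the end times and the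
  endpoints in the order used by \<open>stable_bridge\<close>.\<close>

definition path_density :: "nat \<Rightarrow> (nat \<Rightarrow> real) \<Rightarrow> 'a \<Rightarrow> 'a \<Rightarrow> (nat \<Rightarrow> 'a) \<Rightarrow> real" where
  "path_density k l x y z = (let l' = l(0 := 1, k + 1 := 0); z' = z(0 := y, k + 1 := x) in
     \<Prod>j=0..k. p (t * (l' j - l' (j + 1))) (z' j - z' (j + 1)))"

text \<open>The transition factors that involve neither endpoint; for \<open>k = 1\<close> the
  product is empty.\<close>

definition inner_density :: "nat \<Rightarrow> (nat \<Rightarrow> real) \<Rightarrow> (nat \<Rightarrow> 'a) \<Rightarrow> real" where
  "inner_density k l z = (\<Prod>j=1..k - 1. p (t * (l j - l (j + 1))) (z j - z (j + 1)))"

lemma p_measurable' [measurable (raw)]: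
  assumes "f \<in> borel_measurable N" "g \<in> borel_measurable N"
  shows "(\<lambda>w. p (f w) (g w)) \<in> borel_measurable N"
  using measurable_compose[OF measurable_Pair[OF assms] p_measurable] by simp

lemma path_density_measurable:
  assumes l: "\<And>i. i \<in> {1..k} \<Longrightarrow> (\<lambda>w. l w i) \<in> borel_measurable N"
    and z: "\<And>i. i \<in> {1..k} \<Longrightarrow> (\<lambda>w. z w i) \<in> borel_measurable N"
    and x: "x \<in> borel_measurable N" and y: "y \<in> borel_measurable N"
  shows "(\<lambda>w. path_density k (l w) (x w) (y w) (z w)) \<in> borel_measurable N"
proof -
  have l': "(\<lambda>w. ((l w)(0 := 1, k + 1 := 0)) j) \<in> borel_measurable N" if "j \<le> k + 1" for j
    using that l[of j] by (cases "j = 0"; cases "j = k + 1") auto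
  have z': "(\<lambda>w. ((z w)(0 := y w, k + 1 := x w)) j) \<in> borel_measurable N" if "j \<le> k + 1" for j
    using that z[of j] x y by (cases "j = 0"; cases "j = k + 1") auto
  show ?thesis
    unfolding path_density_def Let_def
    by (intro borel_measurable_prod p_measurable' borel_measurable_times borel_measurable_diff measurable_const l' z') auto
qed

lemma path_density_eq:
  assumes "1 \<le> k"
  shows "path_density k l x y z =
    (p (t * (1 - l 1)) (y - z 1) * p (t * l k) (z k - x)) * inner_density k l z"
proof -
  let ?l = "l(0 := 1, k + 1 := 0)" and ?z = "z(0 := y, k + 1 := x)"
  let ?f = "\<lambda>j. p (t * (?l j - ?l (j + 1))) (?z j - ?z (j + 1))"
  have "{0..k} = insert 0 (insert k {1..k - 1})" using assms by auto
  then have "path_density k l x y z = ?f 0 * (?f k * (\<Prod>j=1..k - 1. ?f j))"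
    unfolding path_density_def Let_def using assms by (simp del: fun_upd_apply)
  moreover have "(\<Prod>j=1..k - 1. ?f j) = inner_density k l z"
    unfolding inner_density_def by (intro prod.cong refl) auto
  ultimately show ?thesis using assms by simp
qed

lemma simplex_decreasing:
  assumes "1 \<le> k" "l \<in> ordered_simplex k" "j \<le> k"
  shows "(l(0 := 1, k + 1 := 0)) (j + 1) < (l(0 := 1, k + 1 := 0)) j"
  using assms by (cases "j = 0"; cases "j = k") (auto simp: ordered_simplex_iff[OF assms(1)] decreasing_above_iff)

lemma path_density_nonneg:
  assumes "1 \<le> k" "l \<in> ordered_simplex k"
  shows "0 \<le> path_density k l x y z"
  unfolding path_density_def Let_def
proof (intro prod_nonneg ballI p_nonneg mult_pos_pos t_pos)
  fix j assume "j \<in> {0..k}"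
  then show "0 < (l(0 := 1, k + 1 := 0)) j - (l(0 := 1, k + 1 := 0)) (j + 1)"
    using simplex_decreasing[OF assms, of j] by (simp del: fun_upd_apply)
qed

lemma bridge_distributed:
  assumes "1 \<le> k" "l \<in> ordered_simplex k"
  shows "distributed (M x y) (Z k) (\<lambda>\<omega>. \<lambda>i\<in>{1..k}. X x y (t * l i) \<omega>)
           (\<lambda>z. ennreal (path_density k l x y z / p t (x - y)))"
proof -
  let ?l = "l(0 := 1, k + 1 := 0)"
  have "distributed (M x y) (Z k) (\<lambda>\<omega>. \<lambda>i\<in>{1..k}. X x y (t * ?l i) \<omega>)
           (\<lambda>z. ennreal (path_density k l x y z / p t (x - y)))"
    using bridge[of x y, unfolded stable_bridge_def, THEN conjunct2, THEN conjunct2, THEN conjunct2, THEN conjunct2,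
        rule_format, of k ?l, OF assms(1) _ _ simplex_decreasing[OF assms]]
    unfolding path_density_def Let_def by simp
  also have "(\<lambda>\<omega>. \<lambda>i\<in>{1..k}. X x y (t * ?l i) \<omega>) = (\<lambda>\<omega>. \<lambda>i\<in>{1..k}. X x y (t * l i) \<omega>)"
    by (auto simp: restrict_def fun_eq_iff)
  finally show ?thesis .
qed

lemma prob_space_bridge: "prob_space (M x y)"
  using bridge[of x y] by (simp add: stable_bridge_def)

text \<open>If the denominator vanished, division by zero would make the density of every marginal
  0, although the bridge has total mass one.\<close>

lemma p_pos: "0 < p t (x - y)"
proof -
  interpret prob_space "M x y" by (rule prob_space_bridge)
  \<comment> \<open>The marginal at half time is as good as any other.\<close>
  let ?l = "\<lambda>i\<in>{1..1::nat}. 1 / 2 :: real"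
  have l: "?l \<in> ordered_simplex 1" by (auto simp: ordered_simplex_def)
  have d: "distributed (M x y) (Z 1) (\<lambda>\<omega>. \<lambda>i\<in>{1..1}. X x y (t * ?l i) \<omega>)
     (\<lambda>z. ennreal (path_density 1 ?l x y z / p t (x - y)))"
    by (rule bridge_distributed[OF _ l]) simp
  have "p t (x - y) \<noteq> 0"
  proof
    assume "p t (x - y) = 0"
    with distributed_nn_integral[OF d, of "\<lambda>_. 1"] emeasure_space_1 show False by simp
  qed
  then show ?thesis using p_nonneg[OF t_pos, of "x - y"] by simp
qed

text \<open>Multiplying by \<open>p t (x - y)\<close>, the weight carried by the heat kernel,
  cancels the denominator of the bridge density.\<close>

lemma bridge_expectation:
  fixes f :: "(nat \<Rightarrow> 'a) \<Rightarrow> real"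
  assumes "1 \<le> k" "l \<in> ordered_simplex k" and f: "f \<in> borel_measurable (Z k)"
  shows "p t (x - y) * (\<integral>\<omega>. f (\<lambda>i\<in>{1..k}. X x y (t * l i) \<omega>) \<partial>M x y) =
         (\<integral>z. path_density k l x y z * f z \<partial>Z k)"
proof -
  have "(\<integral>z. (path_density k l x y z / p t (x - y)) * f z \<partial>Z k) = (\<integral>\<omega>. f (\<lambda>i\<in>{1..k}. X x y (t * l i) \<omega>) \<partial>M x y)"
    using bridge_distributed[OF assms(1,2), of x y] f path_density_nonneg[OF assms(1,2)] p_pos[of x y]
    by (intro distributed_integral) (auto simp: less_imp_le)
  moreover have "(\<integral>z. (path_density k l x y z / p t (x - y)) * f z \<partial>Z k) = (\<integral>z. path_density k l x y z * f z \<partial>Z k) / p t (x - y)"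
    by (subst integral_divide_zero[symmetric]) (simp add: mult.commute)
  ultimately show ?thesis using p_pos[of x y] by (simp add: field_simps)
qed

lemma bridge_nn_expectation:
  fixes f :: "(nat \<Rightarrow> 'a) \<Rightarrow> ennreal"
  assumes "1 \<le> k" "l \<in> ordered_simplex k" and f[measurable]: "f \<in> borel_measurable (Z k)"
  shows "ennreal (p t (x - y)) * (\<integral>\<^sup>+\<omega>. f (\<lambda>i\<in>{1..k}. X x y (t * l i) \<omega>) \<partial>M x y) =
         (\<integral>\<^sup>+z. ennreal (path_density k l x y z) * f z \<partial>Z k)"
proof -
  have [measurable]: "path_density k l x y \<in> borel_measurable (Z k)"
    by (rule path_density_measurable) auto
  have "ennreal (p t (x - y)) * (\<integral>\<^sup>+\<omega>. f (\<lambda>i\<in>{1..k}. X x y (t * l i) \<omega>) \<partial>M x y) =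
      ennreal (p t (x - y)) * (\<integral>\<^sup>+z. ennreal (path_density k l x y z / p t (x - y)) * f z \<partial>Z k)"
    by (subst distributed_nn_integral[OF bridge_distributed[OF assms(1,2)] f]) simp
  also have "\<dots> = (\<integral>\<^sup>+z. ennreal (p t (x - y)) * (ennreal (path_density k l x y z / p t (x - y)) * f z) \<partial>Z k)"
    by (subst nn_integral_cmult) measurable
  also have "\<dots> = (\<integral>\<^sup>+z. ennreal (path_density k l x y z) * f z \<partial>Z k)"
    using p_pos[of x y] path_density_nonneg[OF assms(1,2), of x y]
    by (intro nn_integral_cong) (simp add: mult.assoc[symmetric] ennreal_mult[symmetric])
  finally show ?thesis .
qed

text \<open>Clamping the time makes the bridge jointly measurable on the whole time axis.\<close>

definition clamped_path :: "'a \<Rightarrow> 'a \<Rightarrow> real \<Rightarrow> 'w \<Rightarrow> 'a" where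
  "clamped_path x y s \<omega> = X x y (max 0 (min t s)) \<omega>"

lemma clamped_path_eq: "0 \<le> s \<Longrightarrow> s \<le> t \<Longrightarrow> clamped_path x y s \<omega> = X x y s \<omega>"
  by (simp add: clamped_path_def)

lemma clamped_path_measurable:
  assumes f: "f \<in> borel_measurable N" and g: "g \<in> measurable N (M x y)"
  shows "(\<lambda>w. clamped_path x y (f w) (g w)) \<in> borel_measurable N"
proof -
  have "(\<lambda>w. max 0 (min t (f w))) \<in> measurable N (restrict_space borel {0..t})"
    using f t_pos by (intro measurable_restrict_space2) auto
  moreover have "(\<lambda>(s, \<omega>). X x y s \<omega>) \<in> borel_measurable (restrict_space borel {0..t} \<Otimes>\<^sub>M M x y)"
    using bridge[of x y] by (simp add: stable_bridge_def)
  ultimately show ?thesis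
    unfolding clamped_path_def using measurable_compose[OF measurable_Pair[OF _ g], of _ _ "\<lambda>(s, \<omega>). X x y s \<omega>" borel] by simp
qed

end

text \<open>Boundedness and integrability are inherited by the absolute value of the potential, so
  that it gives another instance of the locale; smoothness would be lost.\<close>

locale bounded_potential = bridge_family p t M X
  for p :: "real \<Rightarrow> 'a::euclidean_space \<Rightarrow> real" and t :: real
    and M :: "'a \<Rightarrow> 'a \<Rightarrow> 'w measure" and X :: "'a \<Rightarrow> 'a \<Rightarrow> real \<Rightarrow> 'w \<Rightarrow> 'a" +
  fixes v :: "'a \<Rightarrow> real" and B :: real
  assumes v_integrable: "integrable lborel v" and v_bound: "\<And>x. \<bar>v x\<bar> \<le> B"
begin

sublocale L: sigma_finite_measure "L k" for k
proof -
  interpret product_sigma_finite "\<lambda>_::nat. lborel :: real measure" ..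
  show "sigma_finite_measure (L k)" by (rule sigma_finite) simp
qed

sublocale Z: sigma_finite_measure "Z k" for k
proof -
  interpret product_sigma_finite "\<lambda>_::nat. lborel :: 'a measure" ..
  show "sigma_finite_measure (Z k)" by (rule sigma_finite) simp
qed

lemma v_measurable [measurable]: "v \<in> borel_measurable borel"
  using v_integrable by auto

lemma B_nonneg: "0 \<le> B"
  using v_bound[of 0] by linarith

lemma prod_v_bound: "\<bar>\<Prod>i=1..k. v (z i)\<bar> \<le> B ^ k"
  using prod_mono[of "{1..k}" "\<lambda>i. \<bar>v (z i)\<bar>" "\<lambda>_. B"] v_bound by (simp add: abs_prod)

definition action :: "'a \<Rightarrow> 'a \<Rightarrow> 'w \<Rightarrow> real" where
  "action x y \<omega> = (LINT s:{0..t}|lborel. v (X x y s \<omega>))"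

definition weighted_density :: "nat \<Rightarrow> (nat \<Rightarrow> real) \<Rightarrow> 'a \<Rightarrow> 'a \<Rightarrow> real" where
  "weighted_density k l x y = (\<integral>z. path_density k l x y z * (\<Prod>i=1..k. v (z i)) \<partial>Z k)"

text \<open>Up to the factor \<open>(- t) ^ k\<close>, this is the \<open>k\<close>-th term of the
  perturbation series of the heat kernel, with time rescaled to the unit interval.\<close>

definition kernel_term :: "nat \<Rightarrow> 'a \<Rightarrow> 'a \<Rightarrow> real" where
  "kernel_term k x y = (LINT l:ordered_simplex k|L k. weighted_density k l x y)"

text \<open>What remains of \<open>weighted_density\<close> once both endpoints are integrated
  out.\<close>

definition chain_integral :: "nat \<Rightarrow> (nat \<Rightarrow> real) \<Rightarrow> real" where
  "chain_integral k l = (\<integral>z. inner_density k l z * (\<Prod>i=1..k. v (z i)) \<partial>Z k)"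

lemma clamped_path_section_measurable:
  assumes "\<omega> \<in> space (M x y)"
  shows "(\<lambda>u. v (clamped_path x y (t * u) \<omega>)) \<in> borel_measurable borel"
  using clamped_path_measurable[of "\<lambda>u. t * u" borel "\<lambda>_. \<omega>" x y] assms by measurable

text \<open>Rescaling to the unit interval removes \<open>t\<close> from the domain of integration.
  The closed interval may be replaced by the open one, which is what the simplex formula
  requires.\<close>

lemma action_eq:
  assumes \<omega>: "\<omega> \<in> space (M x y)"
  shows "action x y \<omega> = t * (LINT u:{0<..<1}|lborel. v (clamped_path x y (t * u) \<omega>))"
proof -
  note clamped_path_section_measurable[OF \<omega>, measurable]
  have "action x y \<omega> = t * (\<integral>u. indicator {0..t} (t * u) *\<^sub>R v (X x y (t * u) \<omega>) \<partial>lborel)"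
    unfolding action_def set_lebesgue_integral_def
    using t_pos by (subst lborel_integral_real_affine[of t _ 0]) auto
  also have "(\<lambda>u. indicator {0..t} (t * u) *\<^sub>R v (X x y (t * u) \<omega>)) = (\<lambda>u. indicator {0..1} u *\<^sub>R v (clamped_path x y (t * u) \<omega>))"
    using t_pos by (auto simp: fun_eq_iff indicator_def clamped_path_eq zero_le_mult_iff)
  also have "(\<integral>u. indicator {0..1} u *\<^sub>R v (clamped_path x y (t * u) \<omega>) \<partial>lborel) = (LINT u:{0<..<1}|lborel. v (clamped_path x y (t * u) \<omega>))"
    unfolding set_lebesgue_integral_def
    using AE_lborel_singleton[of 0] AE_lborel_singleton[of 1]
    by (intro integral_cong_AE) (auto simp: indicator_def elim!: eventually_elim2)
  finally show ?thesis .
qed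

lemma set_integrable_section:
  assumes \<omega>: "\<omega> \<in> space (M x y)"
  shows "set_integrable lborel {0<..<1} (\<lambda>u. v (clamped_path x y (t * u) \<omega>))"
proof -
  note clamped_path_section_measurable[OF \<omega>, measurable]
  show ?thesis
    unfolding set_integrable_def
  proof (rule Bochner_Integration.integrable_bound)
    show "integrable lborel (\<lambda>u::real. indicator {0<..<1} u *\<^sub>R B)"
      by (intro integrable_scaleR_left integrable_real_indicator) auto
  qed (use v_bound in \<open>auto simp: indicator_def intro: order_trans[OF v_bound abs_ge_self]\<close>)
qed

lemma action_bound:
  assumes \<omega>: "\<omega> \<in> space (M x y)"
  shows "\<bar>action x y \<omega>\<bar> \<le> t * B"
proof -
  have "norm (LINT u:{0<..<1}|lborel. v (clamped_path x y (t * u) \<omega>)) \<le> (\<integral>u. indicator {0<..<1::real} u * B \<partial>lborel)"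
    unfolding set_lebesgue_integral_def
    using v_bound by (intro norm_integral_le_integral integrable_mult_left integrable_real_indicator)
      (auto simp: indicator_def)
  also have "\<dots> = B" by simp
  finally show ?thesis using t_pos by (simp add: action_eq[OF \<omega>] abs_mult)
qed

lemma action_power:
  assumes \<omega>: "\<omega> \<in> space (M x y)" and k: "1 \<le> k"
  shows "action x y \<omega> ^ k / fact k =
    t ^ k * (LINT l:ordered_simplex k|L k. \<Prod>i=1..k. v (clamped_path x y (t * l i) \<omega>))"
  using integral_ordered_simplex_prod[OF k set_integrable_section[OF \<omega>]]
  by (simp add: action_eq[OF \<omega>] power_mult_distrib)

lemma action_measurable: "action x y \<in> borel_measurable (M x y)"
proof -
  have "(\<lambda>\<omega>. t * (LINT u:{0<..<1}|lborel. v (clamped_path x y (t * u) \<omega>))) \<in> borel_measurable (M x y)"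
    unfolding set_lebesgue_integral_def
    using clamped_path_measurable[of "\<lambda>w. t * snd w" "M x y \<Otimes>\<^sub>M lborel" fst x y] by measurable
  also have "?this \<longleftrightarrow> ?thesis"
    using action_eq by (intro measurable_cong) simp
  finally show ?thesis .
qed

lemma expectation_simplex:
  assumes k: "1 \<le> k" and l: "l \<in> ordered_simplex k"
  shows "p t (x - y) * (\<integral>\<omega>. (\<Prod>i=1..k. v (clamped_path x y (t * l i) \<omega>)) \<partial>M x y) = weighted_density k l x y"
proof -
  have "clamped_path x y (t * l i) = X x y (t * l i)" if "i \<in> {1..k}" for i
    using that l t_pos by (auto simp: ordered_simplex_iff[OF k] clamped_path_eq fun_eq_iff less_imp_le)
  then have "(\<Prod>i=1..k. v (clamped_path x y (t * l i) \<omega>)) = (\<Prod>i=1..k. v ((\<lambda>i\<in>{1..k}. X x y (t * l i) \<omega>) i))" for \<omega>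
    by (intro prod.cong) auto
  then show ?thesis
    unfolding weighted_density_def using bridge_expectation[OF k l, of "\<lambda>z. \<Prod>i=1..k. v (z i)" x y] by simp
qed

text \<open>Fubini applies because the integrand is bounded by \<open>B ^ k\<close> on the product
  of a probability space with a simplex of finite volume. Afterwards the bridge appears only through
  its densities.\<close>

lemma moment:
  assumes k: "1 \<le> k"
  shows "p t (x - y) * (\<integral>\<omega>. action x y \<omega> ^ k / fact k \<partial>M x y) = t ^ k * kernel_term k x y"
proof -
  interpret prob_space "M x y" by (rule prob_space_bridge)
  interpret PS: pair_sigma_finite "M x y" "L k" ..
  note ordered_simplex_sets[OF k, measurable]
  let ?S = "ordered_simplex k"
  let ?F = "\<lambda>\<omega> l. indicator ?S l *\<^sub>R (\<Prod>i=1..k. v (clamped_path x y (t * l i) \<omega>))"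
  have int: "integrable (M x y \<Otimes>\<^sub>M L k) (\<lambda>(\<omega>, l). ?F \<omega> l)"
  proof (rule Bochner_Integration.integrable_bound)
    show "integrable (M x y \<Otimes>\<^sub>M L k) (\<lambda>(\<omega>, l). B ^ k * indicator ?S l)"
      using emeasure_ordered_simplex_finite[OF k]
      by (intro PS.integrable_pair_mult integrable_real_indicator) auto
    have Ym: "(\<lambda>w. clamped_path x y (t * snd w i) (fst w)) \<in> borel_measurable (M x y \<Otimes>\<^sub>M L k)" if "i \<in> {1..k}" for i
      using that by (intro clamped_path_measurable) measurable
    have "(\<lambda>w. \<Prod>i=1..k. v (clamped_path x y (t * snd w i) (fst w))) \<in> borel_measurable (M x y \<Otimes>\<^sub>M L k)"
      by (intro borel_measurable_prod measurable_compose[OF Ym v_measurable])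
    then show "(\<lambda>(\<omega>, l). ?F \<omega> l) \<in> borel_measurable (M x y \<Otimes>\<^sub>M L k)"
      unfolding split_beta by measurable
    show "AE w in M x y \<Otimes>\<^sub>M L k. norm (case w of (\<omega>, l) \<Rightarrow> ?F \<omega> l) \<le> norm (case w of (\<omega>, l) \<Rightarrow> B ^ k * indicator ?S l)"
      using prod_v_bound B_nonneg by (intro AE_I2) (auto simp: indicator_def)
  qed
  have "(\<integral>\<omega>. action x y \<omega> ^ k / fact k \<partial>M x y) = (\<integral>\<omega>. t ^ k * (\<integral>l. ?F \<omega> l \<partial>L k) \<partial>M x y)"
    using action_power[OF _ k] unfolding set_lebesgue_integral_def by (intro Bochner_Integration.integral_cong) auto
  also have "\<dots> = t ^ k * (\<integral>l. (\<integral>\<omega>. ?F \<omega> l \<partial>M x y) \<partial>L k)"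
    using PS.Fubini_integral[OF int] by simp
  finally have "p t (x - y) * (\<integral>\<omega>. action x y \<omega> ^ k / fact k \<partial>M x y) =
      t ^ k * (\<integral>l. p t (x - y) * (\<integral>\<omega>. ?F \<omega> l \<partial>M x y) \<partial>L k)"
    by simp
  also have "(\<integral>l. p t (x - y) * (\<integral>\<omega>. ?F \<omega> l \<partial>M x y) \<partial>L k) = kernel_term k x y"
    unfolding kernel_term_def set_lebesgue_integral_def
  proof (intro Bochner_Integration.integral_cong refl)
    fix l
    show "p t (x - y) * (\<integral>\<omega>. ?F \<omega> l \<partial>M x y) = indicator ?S l *\<^sub>R weighted_density k l x y"
      using expectation_simplex[OF k, of l x y] by (cases "l \<in> ?S") auto
  qed
  finally show ?thesis .
qed

text \<open>Integrating out \<open>x\<close> and then \<open>y\<close> removes one transition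
  density of mass one each time.\<close>

lemma nn_integral_one_step:
  assumes l: "0 < l" "l < 1"
  shows "(\<integral>\<^sup>+y. \<integral>\<^sup>+x. (\<integral>\<^sup>+w. ennreal (p (t * (1 - l)) (y - w) * p (t * l) (w - x) * \<bar>v w\<bar>) \<partial>lborel) \<partial>lborel \<partial>lborel) =
    (\<integral>\<^sup>+w. ennreal \<bar>v w\<bar> \<partial>lborel)"
proof -
  have pos: "0 < t * (1 - l)" "0 < t * l" using l t_pos by auto
  have one: "(\<integral>\<^sup>+x. ennreal (p s (x - w)) \<partial>lborel) = 1" "(\<integral>\<^sup>+x. ennreal (p s (w - x)) \<partial>lborel) = 1" if "0 < s" for s w
  proof -
    have "(\<integral>\<^sup>+x. ennreal (p s x) \<partial>lborel) = 1"
      using p_integrable[OF that] p_integral[OF that] p_nonneg[OF that] by (subst nn_integral_eq_integral) auto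
    then show "(\<integral>\<^sup>+x. ennreal (p s (x - w)) \<partial>lborel) = 1" "(\<integral>\<^sup>+x. ennreal (p s (w - x)) \<partial>lborel) = 1"
      using nn_integral_lborel_shift(1)[of "\<lambda>x. ennreal (p s x)" "- w"] nn_integral_lborel_shift(2)[of "\<lambda>x. ennreal (p s x)" w]
      by simp_all
  qed
  let ?a = "\<lambda>y w. ennreal (p (t * (1 - l)) (y - w))" and ?b = "\<lambda>w x. ennreal (p (t * l) (w - x))"
  have "(\<integral>\<^sup>+y. \<integral>\<^sup>+x. (\<integral>\<^sup>+w. ennreal (p (t * (1 - l)) (y - w) * p (t * l) (w - x) * \<bar>v w\<bar>) \<partial>lborel) \<partial>lborel \<partial>lborel) =
     (\<integral>\<^sup>+y. \<integral>\<^sup>+x. (\<integral>\<^sup>+w. ?b w x * (?a y w * ennreal \<bar>v w\<bar>) \<partial>lborel) \<partial>lborel \<partial>lborel)"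
    using p_nonneg[OF pos(1)] p_nonneg[OF pos(2)] by (simp add: ennreal_mult mult_ac)
  also have "\<dots> = (\<integral>\<^sup>+y. \<integral>\<^sup>+w. (\<integral>\<^sup>+x. ?b w x * (?a y w * ennreal \<bar>v w\<bar>) \<partial>lborel) \<partial>lborel \<partial>lborel)"
    by (intro nn_integral_cong lborel_pair.Fubini') measurable
  also have "\<dots> = (\<integral>\<^sup>+y. \<integral>\<^sup>+w. ?a y w * ennreal \<bar>v w\<bar> \<partial>lborel \<partial>lborel)"
    by (simp add: nn_integral_multc one[OF pos(2)])
  also have "\<dots> = (\<integral>\<^sup>+w. \<integral>\<^sup>+y. ?a y w * ennreal \<bar>v w\<bar> \<partial>lborel \<partial>lborel)"
    by (intro lborel_pair.Fubini') measurable
  also have "\<dots> = (\<integral>\<^sup>+w. ennreal \<bar>v w\<bar> \<partial>lborel)"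
    by (simp add: nn_integral_multc one[OF pos(1)])
  finally show ?thesis .
qed

text \<open>
  Bounding all factors but one by \<open>B\<close> reduces the estimate to \<open>k = 1\<close>, because every
  one-dimensional marginal of the bridge has an explicit density.
\<close>

lemma nn_integral_path_density_le:
  assumes k: "1 \<le> k" and l: "l \<in> ordered_simplex k"
  shows "(\<integral>\<^sup>+y. \<integral>\<^sup>+x. (\<integral>\<^sup>+z. ennreal (path_density k l x y z * \<bar>\<Prod>i=1..k. v (z i)\<bar>) \<partial>Z k) \<partial>lborel \<partial>lborel) \<le>
    ennreal (B ^ (k - 1)) * (\<integral>\<^sup>+w. ennreal \<bar>v w\<bar> \<partial>lborel)"
proof -
  interpret product_sigma_finite "\<lambda>_::nat. lborel :: 'a measure" ..
  \<comment> \<open>The time whose factor of \<open>v\<close> is kept; a simplex of dimension one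
    describes the marginal there.\<close>
  define l1 where "l1 = restrict l {1..1}"
  have l1: "l1 \<in> ordered_simplex 1"
    using l unfolding ordered_simplex_iff[OF k] ordered_simplex_iff[OF order_refl]
    using k by (auto simp: l1_def decreasing_above_iff)
  have l01: "0 < l 1" "l 1 < 1" using l k by (auto simp: ordered_simplex_iff[OF k])
  have step: "(\<integral>\<^sup>+z. ennreal (path_density k l x y z * \<bar>\<Prod>i=1..k. v (z i)\<bar>) \<partial>Z k) \<le>
      ennreal (B ^ (k - 1)) * (\<integral>\<^sup>+w. ennreal (p (t * (1 - l 1)) (y - w) * p (t * l 1) (w - x) * \<bar>v w\<bar>) \<partial>lborel)" for x y
  proof -
    have "(\<integral>\<^sup>+z. ennreal (path_density k l x y z * \<bar>\<Prod>i=1..k. v (z i)\<bar>) \<partial>Z k) =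
       (\<integral>\<^sup>+z. ennreal (path_density k l x y z) * ennreal \<bar>\<Prod>i=1..k. v (z i)\<bar> \<partial>Z k)"
      using path_density_nonneg[OF k l] by (intro nn_integral_cong) (simp add: ennreal_mult)
    \<comment> \<open>Back under the bridge expectation the surplus factors can be bounded
      pointwise. The return to densities then uses the marginal at a single time, which replaces a
      Chapman-Kolmogorov argument.\<close>
    also have "\<dots> = ennreal (p t (x - y)) * (\<integral>\<^sup>+\<omega>. ennreal \<bar>\<Prod>i=1..k. v ((\<lambda>i\<in>{1..k}. X x y (t * l i) \<omega>) i)\<bar> \<partial>M x y)"
      by (rule bridge_nn_expectation[OF k l, symmetric]) measurable
    also have "\<dots> \<le> ennreal (p t (x - y)) * (\<integral>\<^sup>+\<omega>. ennreal (B ^ (k - 1)) * ennreal \<bar>v ((\<lambda>i\<in>{1..1}. X x y (t * l1 i) \<omega>) 1)\<bar> \<partial>M x y)"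
    proof (intro mult_left_mono nn_integral_mono)
      fix \<omega>
      let ?a = "\<lambda>i. \<bar>v (X x y (t * l i) \<omega>)\<bar>"
      have "(\<Prod>i=1..k. ?a i) = ?a 1 * (\<Prod>i=2..k. ?a i)"
        using k by (subst prod.atLeast_Suc_atMost) (auto simp: numeral_2_eq_2 One_nat_def)
      also have "\<dots> \<le> ?a 1 * (\<Prod>i=2..k. B)"
        using v_bound by (intro mult_left_mono prod_mono) auto
      also have "\<dots> = B ^ (k - 1) * ?a 1" by simp
      finally have "(\<Prod>i=1..k. ?a i) \<le> B ^ (k - 1) * ?a 1" .
      moreover have "\<bar>\<Prod>i=1..k. v ((\<lambda>i\<in>{1..k}. X x y (t * l i) \<omega>) i)\<bar> = (\<Prod>i=1..k. ?a i)"
        unfolding abs_prod by (intro prod.cong) auto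
      ultimately show "ennreal \<bar>\<Prod>i=1..k. v ((\<lambda>i\<in>{1..k}. X x y (t * l i) \<omega>) i)\<bar> \<le>
          ennreal (B ^ (k - 1)) * ennreal \<bar>v ((\<lambda>i\<in>{1..1}. X x y (t * l1 i) \<omega>) 1)\<bar>"
        using B_nonneg by (simp add: l1_def ennreal_mult[symmetric] ennreal_leI)
    qed auto
    also have "\<dots> = (\<integral>\<^sup>+z. ennreal (path_density 1 l1 x y z) * (ennreal (B ^ (k - 1)) * ennreal \<bar>v (z 1)\<bar>) \<partial>Z 1)"
      by (rule bridge_nn_expectation[OF order_refl l1]) measurable
    also have "\<dots> = (\<integral>\<^sup>+z. (\<lambda>w. ennreal (p (t * (1 - l 1)) (y - w) * p (t * l 1) (w - x)) * (ennreal (B ^ (k - 1)) * ennreal \<bar>v w\<bar>)) (z 1) \<partial>Z 1)"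
      by (intro nn_integral_cong) (simp add: path_density_eq inner_density_def l1_def)
    also have "\<dots> = (\<integral>\<^sup>+w. ennreal (p (t * (1 - l 1)) (y - w) * p (t * l 1) (w - x)) * (ennreal (B ^ (k - 1)) * ennreal \<bar>v w\<bar>) \<partial>lborel)"
      unfolding atLeastAtMost_singleton by (rule product_nn_integral_singleton) measurable
    also have "\<dots> = (\<integral>\<^sup>+w. ennreal (B ^ (k - 1)) * ennreal (p (t * (1 - l 1)) (y - w) * p (t * l 1) (w - x) * \<bar>v w\<bar>) \<partial>lborel)"
      using p_nonneg t_pos l01 by (intro nn_integral_cong) (simp add: ennreal_mult'' mult_ac)
    also have "\<dots> = ennreal (B ^ (k - 1)) * (\<integral>\<^sup>+w. ennreal (p (t * (1 - l 1)) (y - w) * p (t * l 1) (w - x) * \<bar>v w\<bar>) \<partial>lborel)"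
      by (rule nn_integral_cmult) measurable
    finally show ?thesis .
  qed
  have "(\<integral>\<^sup>+y. \<integral>\<^sup>+x. (\<integral>\<^sup>+z. ennreal (path_density k l x y z * \<bar>\<Prod>i=1..k. v (z i)\<bar>) \<partial>Z k) \<partial>lborel \<partial>lborel) \<le>
     (\<integral>\<^sup>+y. \<integral>\<^sup>+x. ennreal (B ^ (k - 1)) * (\<integral>\<^sup>+w. ennreal (p (t * (1 - l 1)) (y - w) * p (t * l 1) (w - x) * \<bar>v w\<bar>) \<partial>lborel) \<partial>lborel \<partial>lborel)"
    by (intro nn_integral_mono step)
  also have "\<dots> = ennreal (B ^ (k - 1)) * (\<integral>\<^sup>+y. \<integral>\<^sup>+x. (\<integral>\<^sup>+w. ennreal (p (t * (1 - l 1)) (y - w) * p (t * l 1) (w - x) * \<bar>v w\<bar>) \<partial>lborel) \<partial>lborel \<partial>lborel)"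
    by (subst nn_integral_cmult[symmetric], measurable, subst nn_integral_cmult[symmetric], measurable)
  also note nn_integral_one_step[OF l01]
  finally show ?thesis .
qed

end

text \<open>Meant for the action, which has either sign but is bounded by \<open>t * B\<close>, so
  the factor \<open>exp \<bar>s\<bar>\<close> is harmless.\<close>

lemma abs_exp_minus_taylor_le:
  fixes s :: real
  shows "\<bar>exp (- s) - (\<Sum>k\<le>N. (- s) ^ k / fact k)\<bar> \<le> exp \<bar>s\<bar> * \<bar>s\<bar> ^ Suc N / fact (Suc N)"
proof -
  obtain r where r: "\<bar>r\<bar> \<le> \<bar>- s\<bar>"
    and e: "exp (- s) = (\<Sum>m<Suc N. (- s) ^ m / fact m) + exp r / fact (Suc N) * (- s) ^ Suc N"
    using Maclaurin_exp_le[of "- s" "Suc N"] by blast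
  have "exp r \<le> exp \<bar>s\<bar>" using r by simp
  then have "exp r * \<bar>s\<bar> ^ Suc N / fact (Suc N) \<le> exp \<bar>s\<bar> * \<bar>s\<bar> ^ Suc N / fact (Suc N)"
    by (intro divide_right_mono mult_right_mono) auto
  then show ?thesis
    unfolding e by (simp add: lessThan_Suc_atMost abs_mult power_abs del: power_Suc fact_Suc)
qed

section \<open>Integration over both endpoints and the remainder of the exponential series\<close>

context bounded_potential
begin

text \<open>Its points are pairs \<open>(y, x)\<close> in this order, because
  \<open>heat_content\<close> integrates over \<open>y\<close> outside and over \<open>x\<close>
  inside.\<close>

definition endpoint_measure :: "('a \<times> 'a) measure" where "endpoint_measure = lborel \<Otimes>\<^sub>M lborel"

lemma sets_endpoint_measure [measurable_cong]: "sets endpoint_measure = sets (borel \<Otimes>\<^sub>M borel)"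
  unfolding endpoint_measure_def by (intro sets_pair_measure_cong) auto

sublocale endpoint_measure: sigma_finite_measure endpoint_measure
  unfolding endpoint_measure_def by (rule lborel_pair.sigma_finite_measure_axioms)

text \<open>Available because \<open>weighted_density\<close> is written with transition densities,
  which are jointly measurable, instead of bridge measures.\<close>

lemma weighted_density_measurable: "(\<lambda>(l, y, x). weighted_density k l x y) \<in> borel_measurable (L k \<Otimes>\<^sub>M endpoint_measure)"
  unfolding weighted_density_def split_beta
proof (rule Z.borel_measurable_lebesgue_integral)
  have *: "(\<lambda>w. v (snd w i)) \<in> borel_measurable ((L k \<Otimes>\<^sub>M endpoint_measure) \<Otimes>\<^sub>M Z k)" if "i \<in> {1..k}" for i
    using that by measurable
  show "(\<lambda>(xa, z). path_density k (fst xa) (snd (snd xa)) (fst (snd xa)) z * (\<Prod>i=1..k. v (z i)))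
      \<in> borel_measurable ((L k \<Otimes>\<^sub>M endpoint_measure) \<Otimes>\<^sub>M Z k)"
    unfolding split_beta
    by (intro borel_measurable_times path_density_measurable borel_measurable_prod *) measurable
qed

lemma endpoint_integral:
  assumes "0 < r" "0 < s"
  shows "integrable endpoint_measure (\<lambda>(y, x). p r (y - a) * p s (b - x))"
    and "(\<integral>(y, x). p r (y - a) * p s (b - x) \<partial>endpoint_measure) = 1"
proof -
  have 1: "integrable lborel (\<lambda>y. p r (y - a))" "(\<integral>y. p r (y - a) \<partial>lborel) = 1"
    using p_integrable[OF assms(1)] p_integral[OF assms(1)] integral_lborel_shift(1,3)[of "p r" "- a"] by auto
  have 2: "integrable lborel (\<lambda>x. p s (b - x))" "(\<integral>x. p s (b - x) \<partial>lborel) = 1"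
    using p_integrable[OF assms(2)] p_integral[OF assms(2)] integral_lborel_shift(2,4)[of "p s" b] by auto
  show int: "integrable endpoint_measure (\<lambda>(y, x). p r (y - a) * p s (b - x))"
    unfolding endpoint_measure_def by (intro lborel_pair.integrable_pair_mult 1 2)
  show "(\<integral>(y, x). p r (y - a) * p s (b - x) \<partial>endpoint_measure) = 1"
    using lborel_pair.integral_fst'[OF int[unfolded endpoint_measure_def]] 1 2 unfolding endpoint_measure_def by simp
qed

text \<open>The endpoints occur only in the two outer transition factors, each of mass one, so
  integrating them out leaves the inner chain. The third bound is uniform in \<open>l\<close>, as
  needed for the integral over the simplex.\<close>

lemma weighted_density_integral:
  assumes k: "1 \<le> k" and l: "l \<in> ordered_simplex k"
  shows "integrable endpoint_measure (\<lambda>(y, x). weighted_density k l x y)"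
    and "(\<integral>(y, x). weighted_density k l x y \<partial>endpoint_measure) = chain_integral k l"
    and "(\<integral>\<^sup>+(y, x). ennreal \<bar>weighted_density k l x y\<bar> \<partial>endpoint_measure) \<le> ennreal (B ^ (k - 1) * (\<integral>x. \<bar>v x\<bar> \<partial>lborel))"
proof -
  interpret bZ: pair_sigma_finite endpoint_measure "Z k" ..
  let ?F = "\<lambda>w z. path_density k l (snd w) (fst w) z * (\<Prod>i=1..k. v (z i))"
  have *: "(\<lambda>w. v (snd w i)) \<in> borel_measurable (endpoint_measure \<Otimes>\<^sub>M Z k)" if "i \<in> {1..k}" for i
    using that by measurable
  have m: "(\<lambda>(w, z). ?F w z) \<in> borel_measurable (endpoint_measure \<Otimes>\<^sub>M Z k)"
    unfolding split_beta
    by (intro borel_measurable_times path_density_measurable borel_measurable_prod *) measurable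
  have vfin: "ennreal (B ^ (k - 1)) * (\<integral>\<^sup>+w. ennreal \<bar>v w\<bar> \<partial>lborel) = ennreal (B ^ (k - 1) * (\<integral>x. \<bar>v x\<bar> \<partial>lborel))"
    using v_integrable B_nonneg by (subst nn_integral_eq_integral) (auto simp: ennreal_mult)
  have norm: "ennreal (norm (?F w z)) = ennreal (path_density k l (snd w) (fst w) z * \<bar>\<Prod>i=1..k. v (z i)\<bar>)" for w z
    using path_density_nonneg[OF k l] by (simp add: abs_mult)
  have m': "(\<lambda>(w, z). ennreal (path_density k l (snd w) (fst w) z * \<bar>\<Prod>i=1..k. v (z i)\<bar>)) \<in> borel_measurable (endpoint_measure \<Otimes>\<^sub>M Z k)"
    unfolding split_beta
    by (intro measurable_compose[OF _ measurable_ennreal] borel_measurable_times borel_measurable_abs path_density_measurable borel_measurable_prod *) measurable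
  have m'': "(\<lambda>w. \<integral>\<^sup>+z. ennreal (path_density k l (snd w) (fst w) z * \<bar>\<Prod>i=1..k. v (z i)\<bar>) \<partial>Z k) \<in> borel_measurable endpoint_measure"
    using m' by (intro Z.borel_measurable_nn_integral)
  have bound: "(\<integral>\<^sup>+w. \<integral>\<^sup>+z. ennreal (norm (?F w z)) \<partial>Z k \<partial>endpoint_measure) \<le> ennreal (B ^ (k - 1) * (\<integral>x. \<bar>v x\<bar> \<partial>lborel))"
  proof -
    have "(\<integral>\<^sup>+w. \<integral>\<^sup>+z. ennreal (norm (?F w z)) \<partial>Z k \<partial>endpoint_measure) =
      (\<integral>\<^sup>+y. \<integral>\<^sup>+x. \<integral>\<^sup>+z. ennreal (path_density k l x y z * \<bar>\<Prod>i=1..k. v (z i)\<bar>) \<partial>Z k \<partial>lborel \<partial>lborel)"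
      unfolding norm using lborel.nn_integral_fst[OF m''[unfolded endpoint_measure_def]] by (simp add: endpoint_measure_def)
    then show ?thesis using nn_integral_path_density_le[OF k l] by (simp add: vfin)
  qed
  have int: "integrable (endpoint_measure \<Otimes>\<^sub>M Z k) (\<lambda>(w, z). ?F w z)"
  proof (rule integrableI_bounded[OF m])
    have "(\<integral>\<^sup>+wz. ennreal (norm (case wz of (w, z) \<Rightarrow> ?F w z)) \<partial>(endpoint_measure \<Otimes>\<^sub>M Z k)) = (\<integral>\<^sup>+w. \<integral>\<^sup>+z. ennreal (norm (?F w z)) \<partial>Z k \<partial>endpoint_measure)"
      using m by (subst Z.nn_integral_fst[symmetric]) (auto simp: split_beta)
    then show "(\<integral>\<^sup>+wz. ennreal (norm (case wz of (w, z) \<Rightarrow> ?F w z)) \<partial>(endpoint_measure \<Otimes>\<^sub>M Z k)) < \<infinity>"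
      using bound by (simp add: order_le_less_trans)
  qed
  have weighted_density: "(\<lambda>(y, x). weighted_density k l x y) = (\<lambda>w. \<integral>z. ?F w z \<partial>Z k)"
    by (auto simp: weighted_density_def)
  show "integrable endpoint_measure (\<lambda>(y, x). weighted_density k l x y)"
    unfolding weighted_density using bZ.integrable_fst'[OF int] by simp
  have "(\<integral>\<^sup>+(y, x). ennreal \<bar>weighted_density k l x y\<bar> \<partial>endpoint_measure) \<le> (\<integral>\<^sup>+w. \<integral>\<^sup>+z. ennreal (norm (?F w z)) \<partial>Z k \<partial>endpoint_measure)"
    using bZ.AE_integrable_fst'[OF int]
    by (intro nn_integral_mono_AE) (auto elim!: eventually_mono simp: weighted_density_def split_beta dest!: integral_norm_bound_ennreal)
  from this bound show "(\<integral>\<^sup>+(y, x). ennreal \<bar>weighted_density k l x y\<bar> \<partial>endpoint_measure) \<le> ennreal (B ^ (k - 1) * (\<integral>x. \<bar>v x\<bar> \<partial>lborel))"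
    by (rule order_trans)
  have pos: "0 < t * (1 - l 1)" "0 < t * l k"
    using l k t_pos by (auto simp: ordered_simplex_iff[OF k])
  have "(\<integral>(y, x). weighted_density k l x y \<partial>endpoint_measure) = (\<integral>z. (\<integral>w. ?F w z \<partial>endpoint_measure) \<partial>Z k)"
    unfolding weighted_density using bZ.Fubini_integral[OF int] by simp
  also have "\<dots> = chain_integral k l"
    unfolding chain_integral_def
  proof (intro Bochner_Integration.integral_cong refl)
    fix z
    have "(\<integral>w. ?F w z \<partial>endpoint_measure) = (\<integral>w. (inner_density k l z * (\<Prod>i=1..k. v (z i))) *
       (case w of (y, x) \<Rightarrow> p (t * (1 - l 1)) (y - z 1) * p (t * l k) (z k - x)) \<partial>endpoint_measure)"
      by (intro Bochner_Integration.integral_cong refl) (simp add: path_density_eq[OF k] split_beta mult_ac)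
    also have "\<dots> = inner_density k l z * (\<Prod>i=1..k. v (z i))"
      by (simp only: integral_mult_right_zero endpoint_integral(2)[OF pos] mult_1_right)
    finally show "(\<integral>w. ?F w z \<partial>endpoint_measure) = inner_density k l z * (\<Prod>i=1..k. v (z i))" .
  qed
  finally show "(\<integral>(y, x). weighted_density k l x y \<partial>endpoint_measure) = chain_integral k l" .
qed

text \<open>Fubini between the simplex and the endpoints, justified by the bound uniform in
  \<open>l\<close> and the finite volume of the simplex.\<close>

lemma kernel_term_integral:
  assumes k: "1 \<le> k"
  shows "integrable endpoint_measure (\<lambda>(y, x). kernel_term k x y)"
    and "(\<integral>(y, x). kernel_term k x y \<partial>endpoint_measure) = (LINT l:ordered_simplex k|L k. chain_integral k l)"
    and "set_integrable (L k) (ordered_simplex k) (chain_integral k)"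
proof -
  interpret Lb: pair_sigma_finite "L k" endpoint_measure ..
  note ordered_simplex_sets[OF k, measurable] weighted_density_measurable[measurable]
  let ?S = "ordered_simplex k"
  let ?F = "\<lambda>l w. indicator ?S l *\<^sub>R weighted_density k l (snd w) (fst w)"
  let ?C = "ennreal (B ^ (k - 1) * (\<integral>x. \<bar>v x\<bar> \<partial>lborel))"
  have pm: "(\<lambda>lw. weighted_density k (fst lw) (snd (snd lw)) (fst (snd lw))) \<in> borel_measurable (L k \<Otimes>\<^sub>M endpoint_measure)"
    using weighted_density_measurable[of k] unfolding split_beta .
  then have m: "(\<lambda>(l, w). ?F l w) \<in> borel_measurable (L k \<Otimes>\<^sub>M endpoint_measure)"
    unfolding split_beta by measurable
  have int: "integrable (L k \<Otimes>\<^sub>M endpoint_measure) (\<lambda>(l, w). ?F l w)"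
  proof (rule integrableI_bounded[OF m])
    have "(\<integral>\<^sup>+lw. ennreal (norm (case lw of (l, w) \<Rightarrow> ?F l w)) \<partial>(L k \<Otimes>\<^sub>M endpoint_measure)) = (\<integral>\<^sup>+l. \<integral>\<^sup>+w. ennreal (norm (?F l w)) \<partial>endpoint_measure \<partial>L k)"
      using m by (subst endpoint_measure.nn_integral_fst[symmetric]) (auto simp: split_beta)
    also have "\<dots> \<le> (\<integral>\<^sup>+l. ?C * indicator ?S l \<partial>L k)"
    proof (rule nn_integral_mono)
      fix l
      show "(\<integral>\<^sup>+w. ennreal (norm (?F l w)) \<partial>endpoint_measure) \<le> ?C * indicator ?S l"
        using weighted_density_integral(3)[OF k, of l] unfolding split_beta by (cases "l \<in> ?S") auto
    qed
    also have "\<dots> = ?C * emeasure (L k) ?S" by (rule nn_integral_cmult_indicator) measurable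
    also have "\<dots> < \<infinity>" using emeasure_ordered_simplex_finite[OF k] by (simp add: ennreal_mult_less_top)
    finally show "(\<integral>\<^sup>+lw. ennreal (norm (case lw of (l, w) \<Rightarrow> ?F l w)) \<partial>(L k \<Otimes>\<^sub>M endpoint_measure)) < \<infinity>" .
  qed
  have kernel_term: "(\<lambda>(y, x). kernel_term k x y) = (\<lambda>w. \<integral>l. ?F l w \<partial>L k)"
    by (auto simp: kernel_term_def set_lebesgue_integral_def)
  have FG: "(\<integral>w. ?F l w \<partial>endpoint_measure) = indicator ?S l *\<^sub>R chain_integral k l" for l
    using weighted_density_integral(2)[OF k, of l] unfolding split_beta by (cases "l \<in> ?S") auto
  show "integrable endpoint_measure (\<lambda>(y, x). kernel_term k x y)"
    unfolding kernel_term using Lb.integrable_snd[of ?F] int by simp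
  show "(\<integral>(y, x). kernel_term k x y \<partial>endpoint_measure) = (LINT l:ordered_simplex k|L k. chain_integral k l)"
    unfolding kernel_term set_lebesgue_integral_def using Lb.Fubini_integral[OF int] by (simp only: FG)
  show "set_integrable (L k) ?S (chain_integral k)"
    unfolding set_integrable_def using Lb.integrable_fst'[OF int] by (simp only: split_conv FG)
qed

lemma chain_integral_one:
  assumes "l \<in> ordered_simplex 1"
  shows "chain_integral 1 l = (\<integral>x. v x \<partial>lborel)"
proof -
  interpret product_sigma_finite "\<lambda>_::nat. lborel :: 'a measure" ..
  show ?thesis
    unfolding chain_integral_def inner_density_def by (simp add: product_integral_singleton)
qed

lemma set_integral_chain_integral_one: "(LINT l:ordered_simplex 1|L 1. chain_integral 1 l) = (\<integral>x. v x \<partial>lborel)"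
proof -
  \<comment> \<open>Writing 1 as a product of constant functions lets the simplex formula compute
    the volume.\<close>
  have "(LINT l:ordered_simplex 1|L 1. chain_integral 1 l) = (LINT l:ordered_simplex 1|L 1. (\<Prod>i=1..1. (\<lambda>_. 1) (l i)) * (\<integral>x. v x \<partial>lborel))"
    unfolding set_lebesgue_integral_def
    by (intro Bochner_Integration.integral_cong refl) (auto simp: chain_integral_one indicator_def)
  also have "\<dots> = (LINT l:ordered_simplex 1|L 1. \<Prod>i=1..1. (\<lambda>_. 1) (l i)) * (\<integral>x. v x \<partial>lborel)"
    by (simp only: set_lebesgue_integral_def real_scaleR_def mult.assoc[symmetric] integral_mult_left_zero)
  also have "(LINT l:ordered_simplex 1|L 1. \<Prod>i=1..1. (\<lambda>_. 1) (l i)) = (1::real)"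
    by (subst integral_ordered_simplex_prod[OF order_refl]) (auto simp: set_integrable_def set_lebesgue_integral_def)
  finally show ?thesis by simp
qed

lemma exp_action_integrable:
  "integrable (M x y) (\<lambda>\<omega>. exp (- action x y \<omega>))" "integrable (M x y) (\<lambda>\<omega>. action x y \<omega> ^ k / fact k)"
proof -
  interpret prob_space "M x y" by (rule prob_space_bridge)
  note action_measurable[measurable]
  show "integrable (M x y) (\<lambda>\<omega>. exp (- action x y \<omega>))"
  proof (rule integrable_const_bound)
    show "AE \<omega> in M x y. norm (exp (- action x y \<omega>)) \<le> exp (t * B)"
      using action_bound by (intro AE_I2) (fastforce simp: abs_le_iff)
  qed measurable
  show "integrable (M x y) (\<lambda>\<omega>. action x y \<omega> ^ k / fact k)"
  proof (rule integrable_const_bound)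
    show "AE \<omega> in M x y. norm (action x y \<omega> ^ k / fact k) \<le> (t * B) ^ k / fact k"
      using action_bound by (intro AE_I2) (auto simp: power_abs intro!: divide_right_mono power_mono)
  qed measurable
qed

definition kernel_difference :: "'a \<Rightarrow> 'a \<Rightarrow> real" where
  "kernel_difference x y = p t (x - y) * (\<integral>\<omega>. exp (- action x y \<omega>) \<partial>M x y) - p t (x - y)"

definition taylor_remainder :: "nat \<Rightarrow> 'a \<Rightarrow> 'a \<Rightarrow> real" where
  "taylor_remainder N x y = kernel_difference x y - (\<Sum>k=1..N. (- t) ^ k * kernel_term k x y)"

text \<open>The first kernel term of this instance is the majorant for the remainder, both in the
  pointwise limit and in the integral over the endpoints.\<close>

interpretation abs: bounded_potential p t M X "\<lambda>x. \<bar>v x\<bar>" B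
  by unfold_locales (use v_integrable v_bound in auto)

lemma abs_action_le:
  assumes \<omega>: "\<omega> \<in> space (M x y)"
  shows "\<bar>action x y \<omega>\<bar> \<le> abs.action x y \<omega>"
proof -
  have "\<bar>LINT u:{0<..<1}|lborel. v (clamped_path x y (t * u) \<omega>)\<bar> \<le> (LINT u:{0<..<1}|lborel. \<bar>v (clamped_path x y (t * u) \<omega>)\<bar>)"
    using abs.set_integrable_section[OF \<omega>] norm_integral_le_integral[of lborel
        "\<lambda>u. indicator {0<..<1::real} u *\<^sub>R \<bar>v (clamped_path x y (t * u) \<omega>)\<bar>" "\<lambda>u. indicator {0<..<1::real} u *\<^sub>R v (clamped_path x y (t * u) \<omega>)"]
    unfolding set_lebesgue_integral_def set_integrable_def by (simp add: abs_mult)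
  then show ?thesis
    using t_pos by (simp add: action_eq[OF \<omega>] abs.action_eq[OF \<omega>] abs_mult)
qed

text \<open>Of the \<open>Suc N\<close> powers of the action only \<open>N\<close> are bounded by
  \<open>t * B\<close>. The last one is kept as the action of the absolute value, since a bound by
  constants alone would not be integrable over the endpoints.\<close>

lemma taylor_remainder_bound: "\<bar>taylor_remainder N x y\<bar> \<le> exp (t * B) * (t * B) ^ N / fact (Suc N) * (t * abs.kernel_term 1 x y)"
proof -
  interpret prob_space "M x y" by (rule prob_space_bridge)
  define c where "c = exp (t * B) * (t * B) ^ N / fact (Suc N)"
  have c: "0 \<le> c" using t_pos B_nonneg by (simp add: c_def)
  let ?T = "\<lambda>\<omega>. exp (- action x y \<omega>) - (\<Sum>k\<le>N. (- 1) ^ k * (action x y \<omega> ^ k / fact k))"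
  \<comment> \<open>The trivial power and factorial match the form of \<open>abs.moment\<close> for
    \<open>k = 1\<close>.\<close>
  have int: "integrable (M x y) (\<lambda>\<omega>. c * (abs.action x y \<omega> ^ 1 / fact 1))"
    by (rule integrable_mult_right[OF abs.exp_action_integrable(2)])
  have pointwise: "norm (?T \<omega>) \<le> c * (abs.action x y \<omega> ^ 1 / fact 1)" if \<omega>: "\<omega> \<in> space (M x y)" for \<omega>
  proof -
    let ?A = "action x y \<omega>"
    have "(\<Sum>k\<le>N. (- 1) ^ k * (?A ^ k / fact k)) = (\<Sum>k\<le>N. (- ?A) ^ k / fact k)"
    proof (intro sum.cong refl)
      fix k
      show "(- 1) ^ k * (?A ^ k / fact k) = (- ?A) ^ k / fact k" by (subst power_minus) simp
    qed
    then have "norm (?T \<omega>) \<le> exp \<bar>?A\<bar> * \<bar>?A\<bar> ^ Suc N / fact (Suc N)"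
      using abs_exp_minus_taylor_le[of ?A N] by (simp only: real_norm_def)
    also have "\<dots> = exp \<bar>?A\<bar> * \<bar>?A\<bar> ^ N / fact (Suc N) * \<bar>?A\<bar>" by (simp only: power_Suc2 times_divide_eq_left mult.assoc)
    also have "\<dots> \<le> c * abs.action x y \<omega>"
      unfolding c_def using action_bound[OF \<omega>] abs_action_le[OF \<omega>] t_pos B_nonneg
      by (intro mult_mono divide_right_mono power_mono) auto
    finally show ?thesis by simp
  qed
  have "p t (x - y) * (\<integral>\<omega>. (\<Sum>k\<le>N. (- 1) ^ k * (action x y \<omega> ^ k / fact k)) \<partial>M x y) =
      (\<Sum>k\<le>N. (- 1) ^ k * (p t (x - y) * (\<integral>\<omega>. action x y \<omega> ^ k / fact k \<partial>M x y)))"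
    by (subst Bochner_Integration.integral_sum)
       (auto simp: sum_distrib_left mult.left_commute exp_action_integrable simp del: times_divide_eq_right)
  also have "\<dots> = p t (x - y) + (\<Sum>k=1..N. (- 1) ^ k * (p t (x - y) * (\<integral>\<omega>. action x y \<omega> ^ k / fact k \<partial>M x y)))"
  proof -
    have "{..N} = insert 0 {1..N}" by auto
    then show ?thesis by (simp add: prob_space)
  qed
  also have "(\<Sum>k=1..N. (- 1) ^ k * (p t (x - y) * (\<integral>\<omega>. action x y \<omega> ^ k / fact k \<partial>M x y))) = (\<Sum>k=1..N. (- t) ^ k * kernel_term k x y)"
    by (intro sum.cong refl) (subst moment, auto simp: power_minus[of t] mult.assoc)
  finally have "taylor_remainder N x y = p t (x - y) * (\<integral>\<omega>. ?T \<omega> \<partial>M x y)"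
    unfolding taylor_remainder_def kernel_difference_def
    by (subst Bochner_Integration.integral_diff)
       (auto simp: exp_action_integrable right_diff_distrib simp del: times_divide_eq_right)
  then have "\<bar>taylor_remainder N x y\<bar> = p t (x - y) * \<bar>\<integral>\<omega>. ?T \<omega> \<partial>M x y\<bar>"
    using p_pos[of x y] by (simp add: abs_mult)
  also have "\<dots> \<le> p t (x - y) * (\<integral>\<omega>. c * (abs.action x y \<omega> ^ 1 / fact 1) \<partial>M x y)"
    using norm_integral_le_integral[OF int pointwise] p_pos[of x y] by (intro mult_left_mono) auto
  also have "\<dots> = c * (p t (x - y) * (\<integral>\<omega>. abs.action x y \<omega> ^ 1 / fact 1 \<partial>M x y))"
    by (simp add: mult.left_commute)
  also have "\<dots> = c * (t * abs.kernel_term 1 x y)"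
    by (subst abs.moment) auto
  finally show ?thesis unfolding c_def .
qed

text \<open>The bridge expectations come with no measurability in the endpoints. The partial sums of
  kernel terms are measurable, and at each fixed pair of endpoints the remainder tends to 0 like
  \<open>(t * B) ^ N / fact N\<close>.\<close>

lemma kernel_difference_measurable: "(\<lambda>(y, x). kernel_difference x y) \<in> borel_measurable endpoint_measure"
proof (rule borel_measurable_LIMSEQ_metric)
  show "(\<lambda>(y, x). \<Sum>k=1..N. (- t) ^ k * kernel_term k x y) \<in> borel_measurable endpoint_measure" for N
    unfolding split_beta using kernel_term_integral(1)[THEN borel_measurable_integrable, unfolded split_beta]
    by (intro borel_measurable_sum borel_measurable_times) auto
  fix w :: "'a \<times> 'a"
  obtain y x where w: "w = (y, x)" by (cases w)
  let ?K = "exp (t * B) * \<bar>t * abs.kernel_term 1 x y\<bar>"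
  have "(\<lambda>N. ?K * (inverse (fact N) * (t * B) ^ N)) \<longlonglongrightarrow> ?K * 0"
    by (intro tendsto_mult_left summable_LIMSEQ_zero summable_exp)
  then have lim: "(\<lambda>N. ?K * (inverse (fact N) * (t * B) ^ N)) \<longlonglongrightarrow> 0" by simp
  have "(\<lambda>N. taylor_remainder N x y) \<longlonglongrightarrow> 0"
  proof (rule Lim_null_comparison[OF always_eventually lim], rule allI)
    fix N
    have "exp (t * B) * (t * B) ^ N / fact (Suc N) * (t * abs.kernel_term 1 x y) \<le> exp (t * B) * (t * B) ^ N / fact (Suc N) * \<bar>t * abs.kernel_term 1 x y\<bar>"
      using t_pos B_nonneg by (intro mult_left_mono) auto
    \<comment> \<open>Lowering the factorial to \<open>fact N\<close> gives the general term of the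
      exponential series, which tends to 0.\<close>
    also have "\<dots> \<le> exp (t * B) * (t * B) ^ N / fact N * \<bar>t * abs.kernel_term 1 x y\<bar>"
      using t_pos B_nonneg by (intro mult_right_mono divide_left_mono fact_mono) auto
    also have "\<dots> = ?K * (inverse (fact N) * (t * B) ^ N)"
      by (simp add: divide_inverse mult_ac)
    finally show "norm (taylor_remainder N x y) \<le> ?K * (inverse (fact N) * (t * B) ^ N)"
      using taylor_remainder_bound[of N x y] by simp
  qed
  from tendsto_diff[OF tendsto_const[of "kernel_difference x y"] this]
  show "(\<lambda>N. case w of (y, x) \<Rightarrow> \<Sum>k=1..N. (- t) ^ k * kernel_term k x y) \<longlonglongrightarrow> (case w of (y, x) \<Rightarrow> kernel_difference x y)"
    by (simp add: w taylor_remainder_def)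
qed

text \<open>The majorant of the remainder integrates over both endpoints to \<open>t\<close> times
  the integral of the absolute potential; with \<open>(t * B) ^ N\<close> this has order
  \<open>t ^ (N + 1)\<close>.\<close>

lemma double_integral_expansion:
  "\<bar>(\<integral>y. (\<integral>x. kernel_difference x y \<partial>lborel) \<partial>lborel) - (\<Sum>k=1..N. (- t) ^ k * (LINT l:ordered_simplex k|L k. chain_integral k l))\<bar> \<le>
    exp (t * B) * (t * B) ^ N * t * (\<integral>x. \<bar>v x\<bar> \<partial>lborel)"
proof -
  define c where "c = exp (t * B) * (t * B) ^ N / fact (Suc N)"
  have "exp (t * B) * (t * B) ^ N / fact (Suc N) \<le> exp (t * B) * (t * B) ^ N / 1"
    using t_pos B_nonneg by (intro divide_left_mono fact_ge_1) auto
  then have c: "0 \<le> c" "c \<le> exp (t * B) * (t * B) ^ N"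
    using t_pos B_nonneg by (auto simp: c_def)
  have Rb: "\<bar>taylor_remainder N x y\<bar> \<le> c * (t * abs.kernel_term 1 x y)" for x y
    using taylor_remainder_bound[of N x y] unfolding c_def .
  let ?h = "\<lambda>k w. case w of (y, x) \<Rightarrow> kernel_term k x y"
  have Rm: "(\<lambda>(y, x). taylor_remainder N x y) = (\<lambda>w. (case w of (y, x) \<Rightarrow> kernel_difference x y) - (\<Sum>k=1..N. (- t) ^ k * ?h k w))"
    by (auto simp: taylor_remainder_def)
  have hs: "integrable endpoint_measure (\<lambda>w. \<Sum>k=1..N. (- t) ^ k * ?h k w)"
    by (intro Bochner_Integration.integrable_sum integrable_mult_right kernel_term_integral) auto
  have dom: "integrable endpoint_measure (\<lambda>w. c * (t * (case w of (y, x) \<Rightarrow> abs.kernel_term 1 x y)))"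
    by (intro integrable_mult_right abs.kernel_term_integral) auto
  have Rint: "integrable endpoint_measure (\<lambda>(y, x). taylor_remainder N x y)"
  proof (rule Bochner_Integration.integrable_bound[OF dom])
    show "(\<lambda>(y, x). taylor_remainder N x y) \<in> borel_measurable endpoint_measure"
      unfolding Rm using kernel_difference_measurable hs by (intro borel_measurable_diff) auto
    show "AE w in endpoint_measure. norm (case w of (y, x) \<Rightarrow> taylor_remainder N x y) \<le> norm (c * (t * (case w of (y, x) \<Rightarrow> abs.kernel_term 1 x y)))"
      by (intro AE_I2) (auto intro: order_trans[OF Rb abs_ge_self] simp del: abs_mult)
  qed
  have Hint: "integrable endpoint_measure (\<lambda>(y, x). kernel_difference x y)"
    using Bochner_Integration.integrable_add[OF Rint hs] unfolding Rm by simp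
  have "(\<integral>y. (\<integral>x. kernel_difference x y \<partial>lborel) \<partial>lborel) = (\<integral>(y, x). kernel_difference x y \<partial>endpoint_measure)"
    using lborel_pair.integral_fst'[OF Hint[unfolded endpoint_measure_def]] unfolding endpoint_measure_def by simp
  also have "\<dots> = (\<integral>(y, x). taylor_remainder N x y \<partial>endpoint_measure) + (\<integral>w. (\<Sum>k=1..N. (- t) ^ k * ?h k w) \<partial>endpoint_measure)"
    unfolding Rm using Hint hs by (subst Bochner_Integration.integral_diff) auto
  also have "(\<integral>w. (\<Sum>k=1..N. (- t) ^ k * ?h k w) \<partial>endpoint_measure) = (\<Sum>k=1..N. (- t) ^ k * (LINT l:ordered_simplex k|L k. chain_integral k l))"
    by (subst Bochner_Integration.integral_sum) (auto intro!: integrable_mult_right kernel_term_integral simp: kernel_term_integral(2))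
  finally have "\<bar>(\<integral>y. (\<integral>x. kernel_difference x y \<partial>lborel) \<partial>lborel) - (\<Sum>k=1..N. (- t) ^ k * (LINT l:ordered_simplex k|L k. chain_integral k l))\<bar> =
      norm (\<integral>(y, x). taylor_remainder N x y \<partial>endpoint_measure)"
    by simp
  also have "\<dots> \<le> (\<integral>w. c * (t * (case w of (y, x) \<Rightarrow> abs.kernel_term 1 x y)) \<partial>endpoint_measure)"
    using Rb by (intro norm_integral_le_integral dom) auto
  also have "\<dots> = c * t * (\<integral>x. \<bar>v x\<bar> \<partial>lborel)"
    by (simp add: abs.kernel_term_integral(2) abs.set_integral_chain_integral_one del: atLeastAtMost_singleton)
  also have "\<dots> \<le> exp (t * B) * (t * B) ^ N * t * (\<integral>x. \<bar>v x\<bar> \<partial>lborel)"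
    using c t_pos by (intro mult_right_mono) auto
  finally show ?thesis .
qed

end

subsection \<open>Fourier representation of a chain of transition densities\<close>

lemma partial_sum_measurable [measurable]:
  fixes m :: nat
  shows "(\<lambda>\<theta>. \<lambda>i\<in>{1..m}. - (\<Sum>j=1..i. \<theta> j)) \<in>
     measurable (\<Pi>\<^sub>M i\<in>{1..m}. (lborel :: 'a::euclidean_space measure)) (\<Pi>\<^sub>M i\<in>{1..m}. lborel)"
proof (rule measurable_restrict)
  fix i assume i: "i \<in> {1..m}"
  have "(\<lambda>\<theta>. \<theta> j) \<in> borel_measurable (\<Pi>\<^sub>M i\<in>{1..m}. (lborel :: 'a measure))" if "j \<in> {1..i}" for j
    using measurable_component_singleton[of j "{1..m}" "\<lambda>_. lborel :: 'a measure"] i that by simp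
  then have "(\<lambda>\<theta>. - (\<Sum>j=1..i. \<theta> j)) \<in> borel_measurable (\<Pi>\<^sub>M i\<in>{1..m}. (lborel :: 'a measure))"
    by (intro borel_measurable_uminus borel_measurable_sum)
  then show "(\<lambda>\<theta>. - (\<Sum>j=1..i. \<theta> j)) \<in> measurable (\<Pi>\<^sub>M i\<in>{1..m}. (lborel :: 'a measure)) lborel"
    by simp
qed

text \<open>The substitution is triangular with diagonal entries \<open>- 1\<close>. With the
  earlier coordinates fixed, the last one undergoes a reflection and a translation, and the
  induction handles the rest.\<close>

lemma nn_integral_partial_sums:
  fixes f :: "(nat \<Rightarrow> 'a::euclidean_space) \<Rightarrow> ennreal"
  assumes "f \<in> borel_measurable (\<Pi>\<^sub>M i\<in>{1..m}. lborel)"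
  shows "(\<integral>\<^sup>+\<theta>. f (\<lambda>i\<in>{1..m}. - (\<Sum>j=1..i. \<theta> j)) \<partial>(\<Pi>\<^sub>M i\<in>{1..m}. lborel)) =
         (\<integral>\<^sup>+\<xi>. f \<xi> \<partial>(\<Pi>\<^sub>M i\<in>{1..m}. lborel))"
  using assms
proof (induction m arbitrary: f)
  case 0
  have "(\<lambda>i\<in>{1..0}. - (\<Sum>j=1..i. \<theta> j)) = (\<lambda>_. undefined)" for \<theta> :: "nat \<Rightarrow> 'a" by auto
  then show ?case by (simp add: PiM_empty nn_integral_count_space_finite)
next
  case (Suc m)
  interpret product_sigma_finite "\<lambda>_::nat. lborel :: 'a measure" ..
  let ?Z = "\<lambda>m. \<Pi>\<^sub>M i\<in>{1..m}. (lborel :: 'a measure)"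
  let ?T = "\<lambda>m \<theta>. \<lambda>i\<in>{1..m}. - (\<Sum>j=1..i. \<theta> j :: 'a)"
  have ins: "{1..Suc m} = insert (Suc m) {1..m}" by auto
  have insZ: "?Z (Suc m) = PiM (insert (Suc m) {1..m}) (\<lambda>_. lborel)" by (simp only: ins)
  note f[measurable] = Suc.prems
  have upd[measurable]: "(\<lambda>(x, y). x(Suc m := y)) \<in> measurable (?Z m \<Otimes>\<^sub>M lborel) (?Z (Suc m))"
    unfolding ins using measurable_add_dim[of "Suc m" "{1..m}" "\<lambda>_. lborel"] by simp
  have f2: "(\<lambda>(x, y). f (x(Suc m := y))) \<in> borel_measurable (?Z m \<Otimes>\<^sub>M lborel)"
    using measurable_compose[OF upd f] by (simp add: split_beta)
  have fT: "(\<lambda>\<theta>. f (?T (Suc m) \<theta>)) \<in> borel_measurable (?Z (Suc m))"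
    by (rule measurable_compose[OF partial_sum_measurable f])
  \<comment> \<open>Only the last output coordinate depends on \<open>y\<close>.\<close>
  have T: "?T (Suc m) (x(Suc m := y)) = (?T m x)(Suc m := - (\<Sum>j=1..m. x j) - y)" for x y
  proof
    fix i
    have "(\<Sum>j=1..i. (x(Suc m := y)) j) = (\<Sum>j=1..i. x j)" if "i \<le> m"
      using that by (intro sum.cong) auto
    moreover have "(\<Sum>j=1..m. (x(Suc m := y)) j) = (\<Sum>j=1..m. x j)" by (intro sum.cong) auto
    ultimately show "?T (Suc m) (x(Suc m := y)) i = ((?T m x)(Suc m := - (\<Sum>j=1..m. x j) - y)) i"
      by (cases "i = Suc m") auto
  qed
  have "(\<integral>\<^sup>+\<theta>. f (?T (Suc m) \<theta>) \<partial>?Z (Suc m)) = (\<integral>\<^sup>+x. \<integral>\<^sup>+y. f ((?T m x)(Suc m := - (\<Sum>j=1..m. x j) - y)) \<partial>lborel \<partial>?Z m)"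
    unfolding T[symmetric] using fT unfolding insZ by (intro product_nn_integral_insert) simp_all
  also have "\<dots> = (\<integral>\<^sup>+x. \<integral>\<^sup>+y. f ((?T m x)(Suc m := y)) \<partial>lborel \<partial>?Z m)"
  proof (rule nn_integral_cong)
    fix x assume x: "x \<in> space (?Z m)"
    then have "?T m x \<in> space (?Z m)" by (auto simp: space_PiM)
    from measurable_Pair2[OF f2 this]
    have "(\<lambda>y. f ((?T m x)(Suc m := y))) \<in> borel_measurable borel" by simp
    from nn_integral_lborel_shift(2)[OF this]
    show "(\<integral>\<^sup>+y. f ((?T m x)(Suc m := - (\<Sum>j=1..m. x j) - y)) \<partial>lborel) = (\<integral>\<^sup>+y. f ((?T m x)(Suc m := y)) \<partial>lborel)" .
  qed
  also have "\<dots> = (\<integral>\<^sup>+x. \<integral>\<^sup>+y. f (x(Suc m := y)) \<partial>lborel \<partial>?Z m)"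
    using f2 by (intro Suc.IH[of "\<lambda>x. \<integral>\<^sup>+y. f (x(Suc m := y)) \<partial>lborel"]) (auto intro!: lborel.borel_measurable_nn_integral)
  also have "\<dots> = (\<integral>\<^sup>+\<xi>. f \<xi> \<partial>?Z (Suc m))"
    using f unfolding ins by (subst product_nn_integral_insert) auto
  finally show ?case .
qed

text \<open>As an equality of measures the substitution also serves complex integrands.\<close>

lemma distr_partial_sums:
  fixes m :: nat
  shows "distr (\<Pi>\<^sub>M i\<in>{1..m}. lborel) (\<Pi>\<^sub>M i\<in>{1..m}. lborel) (\<lambda>\<theta>. \<lambda>i\<in>{1..m}. - (\<Sum>j=1..i. \<theta> j)) =
   (\<Pi>\<^sub>M i\<in>{1..m}. (lborel :: 'a::euclidean_space measure))" (is "distr ?Z _ ?T = _")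
proof (rule measure_eqI)
  fix A assume "A \<in> sets (distr ?Z ?Z ?T)"
  then have [measurable]: "A \<in> sets ?Z" by simp
  have "emeasure (distr ?Z ?Z ?T) A = (\<integral>\<^sup>+\<xi>. indicator A \<xi> \<partial>distr ?Z ?Z ?T)" by simp
  also have "\<dots> = (\<integral>\<^sup>+\<theta>. indicator A (?T \<theta>) \<partial>?Z)" by (rule nn_integral_distr) measurable
  also have "\<dots> = emeasure ?Z A" using nn_integral_partial_sums[of "indicator A" m] by simp
  finally show "emeasure (distr ?Z ?Z ?T) A = emeasure ?Z A" .
qed simp

text \<open>Moves the phases from the increments to the single points \<open>z i\<close>, so that
  the integral over \<open>z\<close> splits into one Fourier transform per point.\<close>

lemma summation_by_parts_inner:
  fixes z \<xi> :: "nat \<Rightarrow> 'a::real_inner"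
  assumes "\<xi> 0 = 0"
  shows "(\<Sum>j=1..m. (z j - z (j + 1)) \<bullet> \<xi> j) = - (\<Sum>i=1..m. z i \<bullet> (\<xi> (i - 1) - \<xi> i)) - z (m + 1) \<bullet> \<xi> m"
  using assms by (induction m) (auto simp: inner_diff_left inner_diff_right Suc_eq_plus1[symmetric] simp del: Suc_eq_plus1)

text \<open>Here \<open>m\<close> counts the transition factors, so the chain has
  \<open>m + 1\<close> points. Fubini is justified by the integrability of \<open>v\<close> in every
  point and of \<open>E j\<close> in every frequency, the phases having modulus one.\<close>

lemma chain_integral_fourier:
  fixes p :: "real \<Rightarrow> 'a::euclidean_space \<Rightarrow> real" and v :: "'a \<Rightarrow> real"
  assumes p: "stable_density \<alpha> p" and \<alpha>: "0 < \<alpha>" and v: "integrable lborel v"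
    and s: "\<And>j. j \<in> {1..m} \<Longrightarrow> 0 < s j"
  shows "complex_of_real (\<integral>z. (\<Prod>j=1..m. p (s j) (z j - z (j + 1))) * (\<Prod>i=1..m + 1. v (z i)) \<partial>(\<Pi>\<^sub>M i\<in>{1..m + 1}. lborel)) =
    complex_of_real (1 / (2 * pi) ^ (DIM('a) * m)) *
      (\<integral>\<theta>. fourier v (- (\<Sum>i=1..m. \<theta> i)) *
         (\<Prod>i=1..m. fourier v (\<theta> i) * complex_of_real (exp (- s i * norm (\<Sum>j=1..i. \<theta> j) powr \<alpha>))) \<partial>(\<Pi>\<^sub>M i\<in>{1..m}. lborel))"
proof -
  interpret product_sigma_finite "\<lambda>_::nat. lborel :: 'a measure" ..
  let ?Z = "\<lambda>m. \<Pi>\<^sub>M i\<in>{1..m}. (lborel :: 'a measure)"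
  interpret Zn: sigma_finite_measure "?Z (m + 1)" by (rule sigma_finite) simp
  interpret Zm: sigma_finite_measure "?Z m" by (rule sigma_finite) simp
  interpret ZZ: pair_sigma_finite "?Z (m + 1)" "?Z m" ..
  note fourier_measurable[OF v, measurable]
  have [measurable]: "v \<in> borel_measurable borel" using v by auto
  define c where "c = 1 / (2 * pi) ^ DIM('a)"
  define E where "E j \<xi> = exp (- s j * norm \<xi> powr \<alpha>)" for j and \<xi> :: 'a
  have [measurable]: "E j \<in> borel_measurable borel" for j unfolding E_def by measurable
  have E: "integrable lborel (E j)" if "j \<in> {1..m}" for j
    unfolding E_def by (rule integrable_exp_neg_powr[OF s[OF that] \<alpha>])
  let ?e = "\<lambda>w \<xi>. exp (\<i> * complex_of_real (w \<bullet> \<xi>))"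
  have eE: "integrable lborel (\<lambda>\<xi>. ?e w \<xi> * complex_of_real (E j \<xi>))" if "j \<in> {1..m}" for j w
    by (rule Bochner_Integration.integrable_bound[OF E[OF that]]) (auto simp: norm_mult)
  let ?F = "\<lambda>z \<xi>. (\<Prod>i=1..m + 1. complex_of_real (v (z i))) * (\<Prod>j=1..m. ?e (z j - z (j + 1)) (\<xi> j) * complex_of_real (E j (\<xi> j)))"
  have step1: "complex_of_real ((\<Prod>j=1..m. p (s j) (z j - z (j + 1))) * (\<Prod>i=1..m + 1. v (z i))) =
      complex_of_real (c ^ m) * (\<integral>\<xi>. ?F z \<xi> \<partial>?Z m)" for z
  proof -
    have "(\<Prod>j=1..m. complex_of_real (p (s j) (z j - z (j + 1)))) =
        (\<Prod>j=1..m. complex_of_real c * (\<integral>\<xi>. ?e (z j - z (j + 1)) \<xi> * complex_of_real (E j \<xi>) \<partial>lborel))"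
      by (intro prod.cong refl) (simp add: stable_density_inversion[OF p \<alpha> s] c_def E_def scaleR_conv_of_real)
    also have "\<dots> = complex_of_real (c ^ m) * (\<integral>\<xi>. (\<Prod>j=1..m. ?e (z j - z (j + 1)) (\<xi> j) * complex_of_real (E j (\<xi> j))) \<partial>?Z m)"
      by (subst product_integral_prod) (auto simp: prod.distrib eE)
    finally have *: "(\<Prod>j=1..m. complex_of_real (p (s j) (z j - z (j + 1)))) =
      complex_of_real (c ^ m) * (\<integral>\<xi>. (\<Prod>j=1..m. ?e (z j - z (j + 1)) (\<xi> j) * complex_of_real (E j (\<xi> j))) \<partial>?Z m)" .
    show ?thesis
      unfolding of_real_mult of_real_prod * integral_mult_right_zero by (simp only: mult_ac)
  qed
  have int: "integrable (?Z (m + 1) \<Otimes>\<^sub>M ?Z m) (\<lambda>(z, \<xi>). ?F z \<xi>)"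
  proof (rule Bochner_Integration.integrable_bound)
    show "integrable (?Z (m + 1) \<Otimes>\<^sub>M ?Z m) (\<lambda>(z, \<xi>). (\<Prod>i=1..m + 1. v (z i)) * (\<Prod>j=1..m. E j (\<xi> j)))"
      by (intro ZZ.integrable_pair_mult product_integrable_prod v E) auto
    have zm: "(\<lambda>w. fst w i) \<in> borel_measurable (?Z (m + 1) \<Otimes>\<^sub>M ?Z m)" if "i \<in> {1..m + 1}" for i
      using that by measurable
    have xm: "(\<lambda>w. snd w i) \<in> borel_measurable (?Z (m + 1) \<Otimes>\<^sub>M ?Z m)" if "i \<in> {1..m}" for i
      using that by measurable
    have vm: "(\<lambda>w. complex_of_real (v (fst w i))) \<in> borel_measurable (?Z (m + 1) \<Otimes>\<^sub>M ?Z m)" if "i \<in> {1..m + 1}" for i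
      using zm[OF that] by measurable
    have em: "(\<lambda>w. ?e (fst w j - fst w (j + 1)) (snd w j) * complex_of_real (E j (snd w j))) \<in> borel_measurable (?Z (m + 1) \<Otimes>\<^sub>M ?Z m)"
      if "j \<in> {1..m}" for j
    proof -
      have [measurable]: "(\<lambda>w. fst w j) \<in> borel_measurable (?Z (m + 1) \<Otimes>\<^sub>M ?Z m)"
        "(\<lambda>w. fst w (j + 1)) \<in> borel_measurable (?Z (m + 1) \<Otimes>\<^sub>M ?Z m)"
        "(\<lambda>w. snd w j) \<in> borel_measurable (?Z (m + 1) \<Otimes>\<^sub>M ?Z m)"
        using that by (auto intro!: zm xm)
      show ?thesis by measurable
    qed
    show "(\<lambda>(z, \<xi>). ?F z \<xi>) \<in> borel_measurable (?Z (m + 1) \<Otimes>\<^sub>M ?Z m)"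
      unfolding split_beta by (intro borel_measurable_times borel_measurable_prod vm em)
    show "AE w in ?Z (m + 1) \<Otimes>\<^sub>M ?Z m. norm (case w of (z, \<xi>) \<Rightarrow> ?F z \<xi>) \<le> norm (case w of (z, \<xi>) \<Rightarrow> (\<Prod>i=1..m + 1. v (z i)) * (\<Prod>j=1..m. E j (\<xi> j)))"
      by (intro AE_I2) (auto simp: norm_mult abs_mult prod_norm[symmetric] abs_prod)
  qed
  \<comment> \<open>Padding with 0 at indices 0 and \<open>m + 1\<close> makes the first and last
    point obey the same formula as the others.\<close>
  let ?x = "\<lambda>\<xi> i. if i \<in> {1..m} then \<xi> i else 0 :: 'a"
  have step3: "(\<integral>z. ?F z \<xi> \<partial>?Z (m + 1)) =
      (\<Prod>j=1..m. complex_of_real (E j (\<xi> j))) * ((\<Prod>i=1..m. fourier v (?x \<xi> (i - 1) - \<xi> i)) * fourier v (?x \<xi> m))" for \<xi>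
  proof -
    let ?y = "\<lambda>i. ?x \<xi> (i - 1) - ?x \<xi> i"
    have ph: "(\<Prod>j=1..m. ?e (z j - z (j + 1)) (\<xi> j)) = (\<Prod>i=1..m + 1. exp (- (\<i> * complex_of_real (z i \<bullet> ?y i))))" for z
    proof -
      have "(\<Sum>j=1..m. (z j - z (j + 1)) \<bullet> \<xi> j) = (\<Sum>j=1..m. (z j - z (j + 1)) \<bullet> ?x \<xi> j)"
        by (intro sum.cong) auto
      also have "\<dots> = - (\<Sum>i=1..m. z i \<bullet> ?y i) - z (m + 1) \<bullet> ?x \<xi> m"
        by (rule summation_by_parts_inner) simp
      also have "\<dots> = - (\<Sum>i=1..m + 1. z i \<bullet> ?y i)"
        unfolding Suc_eq_plus1[symmetric] by (simp add: sum.cl_ivl_Suc)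
      finally have eq: "(\<Sum>j=1..m. (z j - z (j + 1)) \<bullet> \<xi> j) = - (\<Sum>i=1..m + 1. z i \<bullet> ?y i)" .
      have "(\<Prod>j=1..m. ?e (z j - z (j + 1)) (\<xi> j)) = exp (\<i> * complex_of_real (\<Sum>j=1..m. (z j - z (j + 1)) \<bullet> \<xi> j))"
        by (simp add: exp_sum sum_distrib_left)
      also have "\<dots> = (\<Prod>i=1..m + 1. exp (- (\<i> * complex_of_real (z i \<bullet> ?y i))))"
        unfolding eq by (subst exp_sum[symmetric]) (auto simp: sum_distrib_left sum_negf)
      finally show ?thesis .
    qed
    have "(\<integral>z. ?F z \<xi> \<partial>?Z (m + 1)) = (\<integral>z. (\<Prod>j=1..m. complex_of_real (E j (\<xi> j))) *
        (\<Prod>i=1..m + 1. exp (- (\<i> * complex_of_real (z i \<bullet> ?y i))) * complex_of_real (v (z i))) \<partial>?Z (m + 1))"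
      by (intro Bochner_Integration.integral_cong refl) (simp only: prod.distrib ph mult_ac)
    also have "\<dots> = (\<Prod>j=1..m. complex_of_real (E j (\<xi> j))) * (\<Prod>i=1..m + 1. fourier v (?y i))"
      unfolding integral_mult_right_zero
      by (subst product_integral_prod[OF finite_atLeastAtMost integrable_fourier_integrand[OF v]]) (simp only: fourier_def)
    also have "(\<Prod>i=1..m + 1. fourier v (?y i)) = (\<Prod>i=1..m. fourier v (?x \<xi> (i - 1) - \<xi> i)) * fourier v (?x \<xi> m)"
      unfolding Suc_eq_plus1[symmetric] by (auto simp: prod.cl_ivl_Suc intro!: prod.cong)
    finally show ?thesis .
  qed
  let ?W = "\<lambda>\<xi>. (\<Prod>j=1..m. complex_of_real (E j (\<xi> j))) * ((\<Prod>i=1..m. fourier v (?x \<xi> (i - 1) - \<xi> i)) * fourier v (?x \<xi> m))"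
  let ?T = "\<lambda>\<theta>. \<lambda>i\<in>{1..m}. - (\<Sum>j=1..i. \<theta> j :: 'a)"
  have W: "?W \<in> borel_measurable (?Z m)"
  proof -
    have x: "(\<lambda>\<xi>. ?x \<xi> i) \<in> borel_measurable (?Z m)" for i by (cases "i \<in> {1..m}") auto
    have "(\<lambda>\<xi>. complex_of_real (E j (\<xi> j))) \<in> borel_measurable (?Z m)" if "j \<in> {1..m}" for j
      using that by measurable
    moreover have "(\<lambda>\<xi>. fourier v (?x \<xi> (i - 1) - \<xi> i)) \<in> borel_measurable (?Z m)" if "i \<in> {1..m}" for i
    proof -
      have "(\<lambda>\<xi>. ?x \<xi> (i - 1) - \<xi> i) \<in> borel_measurable (?Z m)"
        using that by (intro borel_measurable_diff x) measurable
      then show ?thesis by (rule measurable_compose) measurable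
    qed
    moreover have "(\<lambda>\<xi>. fourier v (?x \<xi> m)) \<in> borel_measurable (?Z m)"
      by (rule measurable_compose[OF x]) measurable
    ultimately show ?thesis by (intro borel_measurable_times borel_measurable_prod)
  qed
  have "complex_of_real (\<integral>z. (\<Prod>j=1..m. p (s j) (z j - z (j + 1))) * (\<Prod>i=1..m + 1. v (z i)) \<partial>?Z (m + 1)) =
      complex_of_real (c ^ m) * (\<integral>z. (\<integral>\<xi>. ?F z \<xi> \<partial>?Z m) \<partial>?Z (m + 1))"
    by (simp only: integral_complex_of_real[symmetric] step1 integral_mult_right_zero)
  also have "(\<integral>z. (\<integral>\<xi>. ?F z \<xi> \<partial>?Z m) \<partial>?Z (m + 1)) = (\<integral>\<xi>. ?W \<xi> \<partial>?Z m)"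
    unfolding ZZ.Fubini_integral[OF int, symmetric] step3 ..
  also have "(\<integral>\<xi>. ?W \<xi> \<partial>?Z m) = (\<integral>\<xi>. ?W \<xi> \<partial>distr (?Z m) (?Z m) ?T)"
    by (simp only: distr_partial_sums)
  also have "\<dots> = (\<integral>\<theta>. ?W (?T \<theta>) \<partial>?Z m)"
    by (rule integral_distr[OF partial_sum_measurable W])
  also have "\<dots> = (\<integral>\<theta>. fourier v (- (\<Sum>i=1..m. \<theta> i)) *
         (\<Prod>i=1..m. fourier v (\<theta> i) * complex_of_real (exp (- s i * norm (\<Sum>j=1..i. \<theta> j) powr \<alpha>))) \<partial>?Z m)"
  proof (intro Bochner_Integration.integral_cong refl)
    fix \<theta> :: "nat \<Rightarrow> 'a"
    \<comment> \<open>Consecutive differences of the new frequencies recover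
      \<open>\<theta> i\<close>, while the last frequency alone gives minus the total sum.\<close>
    have 1: "?x (?T \<theta>) i = - (\<Sum>j=1..i. \<theta> j)" if "i \<le> m" for i
      using that by (cases "i = 0") auto
    have 2: "?x (?T \<theta>) (i - 1) - ?T \<theta> i = \<theta> i" if "i \<in> {1..m}" for i
    proof -
      have "(\<Sum>j=1..i. \<theta> j) = (\<Sum>j=1..i - 1. \<theta> j) + \<theta> i"
        using that by (cases i) auto
      then show ?thesis using that 1[of "i - 1"] by auto
    qed
    have "(\<Prod>i=1..m. fourier v (?x (?T \<theta>) (i - 1) - ?T \<theta> i)) = (\<Prod>i=1..m. fourier v (\<theta> i))"
      by (intro prod.cong refl arg_cong[where f="fourier v"] 2)
    moreover have "(\<Prod>j=1..m. complex_of_real (E j (?T \<theta> j))) = (\<Prod>j=1..m. complex_of_real (exp (- s j * norm (\<Sum>i=1..j. \<theta> i) powr \<alpha>)))"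
      by (intro prod.cong refl) (auto simp: E_def)
    ultimately show "?W (?T \<theta>) = fourier v (- (\<Sum>i=1..m. \<theta> i)) *
         (\<Prod>i=1..m. fourier v (\<theta> i) * complex_of_real (exp (- s i * norm (\<Sum>j=1..i. \<theta> j) powr \<alpha>)))"
      by (simp only: 1[OF order_refl] prod.distrib mult_ac)
  qed
  also have "c ^ m = 1 / (2 * pi) ^ (DIM('a) * m)"
    by (simp add: c_def power_mult power_one_over)
  finally show ?thesis .
qed

subsection \<open>The multinomial expansion of the phases\<close>

lemma finite_multi_indices [simp]: "finite (multi_indices m n)"
proof (rule finite_subset)
  show "multi_indices m n \<subseteq> {1..m} \<rightarrow>\<^sub>E {..n}"
  proof
    fix e assume e: "e \<in> multi_indices m n"
    have "e i \<le> n" if "i \<in> {1..m}" for i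
      using e that member_le_sum[of i "{1..m}" e] by (auto simp: multi_indices_def)
    with e show "e \<in> {1..m} \<rightarrow>\<^sub>E {..n}" by (auto simp: multi_indices_def PiE_def)
  qed
qed (simp add: finite_PiE)

lemma multi_indices_Suc:
  "bij_betw (\<lambda>(j, e). e(Suc m := j)) (SIGMA j:{..n}. multi_indices m (n - j)) (multi_indices (Suc m) n)"
proof (rule bij_betw_byWitness[where f'="\<lambda>e. (e (Suc m), restrict e {1..m})"])
  have upd: "(\<Sum>i=1..m. (e(Suc m := j)) i) = (\<Sum>i=1..m. e i)" for e :: "nat \<Rightarrow> nat" and j
    by (intro sum.cong) auto
  show "\<forall>a\<in>SIGMA j:{..n}. multi_indices m (n - j).
      (\<lambda>e. (e (Suc m), restrict e {1..m})) ((\<lambda>(j, e). e(Suc m := j)) a) = a"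
    by (auto simp: multi_indices_def fun_eq_iff PiE_def extensional_def)
  show "\<forall>a\<in>multi_indices (Suc m) n.
      (\<lambda>(j, e). e(Suc m := j)) ((\<lambda>e. (e (Suc m), restrict e {1..m})) a) = a"
    by (auto simp: multi_indices_def fun_eq_iff PiE_def extensional_def le_Suc_eq)
  show "(\<lambda>(j, e). e(Suc m := j)) ` (SIGMA j:{..n}. multi_indices m (n - j)) \<subseteq> multi_indices (Suc m) n"
    by (auto simp: multi_indices_def PiE_def extensional_def upd simp del: fun_upd_apply) auto
  show "(\<lambda>e. (e (Suc m), restrict e {1..m})) ` multi_indices (Suc m) n \<subseteq> (SIGMA j:{..n}. multi_indices m (n - j))"
    by (auto simp: multi_indices_def PiE_def)
qed

text \<open>The binomial theorem separates the last summand, whose exponent \<open>j\<close> is the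
  last entry of the multi-index; \<open>multi_indices_Suc\<close> reassembles the indices.\<close>

lemma multinomial_theorem:
  fixes x :: "nat \<Rightarrow> real"
  shows "(\<Sum>i=1..m. x i) ^ n =
    (\<Sum>e\<in>multi_indices m n. fact n / (\<Prod>i=1..m. fact (e i)) * (\<Prod>i=1..m. x i ^ e i))"
proof (induction m arbitrary: n)
  case 0
  \<comment> \<open>The empty domain carries one extensional function, of sum 0, matching the
    convention that \<open>0 ^ 0 = 1\<close>.\<close>
  have "multi_indices 0 n = (if n = 0 then {\<lambda>_. undefined} else {})"
    by (auto simp: multi_indices_def)
  then show ?case by (auto simp: power_0_left)
next
  case (Suc m)
  let ?f = "\<lambda>m n e. fact n / (\<Prod>i=1..m. fact (e i)) * (\<Prod>i=1..m. x i ^ e i)"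
  have summand: "?f (Suc m) n (e(Suc m := j)) = real (n choose j) * x (Suc m) ^ j * ?f m (n - j) e" if "j \<le> n" for j e
  proof -
    have "(\<Prod>i=1..m. fact ((e(Suc m := j)) i)) = (\<Prod>i=1..m. fact (e i) :: real)"
      "(\<Prod>i=1..m. x i ^ (e(Suc m := j)) i) = (\<Prod>i=1..m. x i ^ e i)"
      by (auto intro!: prod.cong)
    moreover have "real (n choose j) = fact n / (fact j * fact (n - j))"
      using that by (simp add: binomial_fact)
    ultimately show ?thesis by (simp add: prod.cl_ivl_Suc field_simps)
  qed
  have "(\<Sum>i=1..Suc m. x i) ^ n = (x (Suc m) + (\<Sum>i=1..m. x i)) ^ n" by (simp add: add.commute)
  also have "\<dots> = (\<Sum>j\<le>n. real (n choose j) * x (Suc m) ^ j * (\<Sum>e\<in>multi_indices m (n - j). ?f m (n - j) e))"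
    by (simp only: binomial_ring Suc.IH)
  also have "\<dots> = (\<Sum>(j, e)\<in>(SIGMA j:{..n}. multi_indices m (n - j)). real (n choose j) * x (Suc m) ^ j * ?f m (n - j) e)"
    by (simp only: sum_distrib_left) (simp add: sum.Sigma)
  also have "\<dots> = (\<Sum>je\<in>(SIGMA j:{..n}. multi_indices m (n - j)). ?f (Suc m) n ((\<lambda>(j, e). e(Suc m := j)) je))"
  proof (intro sum.cong refl)
    fix je assume "je \<in> (SIGMA j:{..n}. multi_indices m (n - j))"
    then obtain j e where "je = (j, e)" "j \<le> n" by auto
    then show "(case je of (j, e) \<Rightarrow> real (n choose j) * x (Suc m) ^ j * ?f m (n - j) e) = ?f (Suc m) n ((\<lambda>(j, e). e(Suc m := j)) je)"
      using summand[of j e] by (simp only: split_conv)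
  qed
  also have "\<dots> = (\<Sum>e\<in>multi_indices (Suc m) n. ?f (Suc m) n e)"
    by (rule sum.reindex_bij_betw[OF multi_indices_Suc])
  finally show ?case .
qed

text \<open>For nonnegative \<open>s\<close> the intermediate point of the remainder is negative, so
  no exponential factor survives. This matters because the phase is unbounded in the
  frequencies.\<close>

lemma exp_minus_taylor_le_nonneg:
  fixes s :: real
  assumes "0 \<le> s"
  shows "\<bar>exp (- s) - (\<Sum>n\<le>q. (- s) ^ n / fact n)\<bar> \<le> s ^ Suc q"
proof (cases "s = 0")
  case True
  have "(\<Sum>n\<le>q. (0::real) ^ n / fact n) = 1"
    by (subst sum.atMost_shift) (simp add: power_0_left)
  with True show ?thesis by simp
next
  case False
  then have "- s < 0" using assms by simp
  then obtain r where r: "r < 0" "exp (- s) = (\<Sum>m<Suc q. exp 0 / fact m * (- s) ^ m) + exp r / fact (Suc q) * (- s) ^ Suc q"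
    using Maclaurin_minus[of "- s" "Suc q" "\<lambda>_. exp" exp] by (auto simp del: fact_Suc power_Suc sum.lessThan_Suc)
  have "exp r * s ^ Suc q / fact (Suc q) \<le> 1 * s ^ Suc q / 1"
    using r(1) assms by (intro frac_le mult_right_mono fact_ge_1) auto
  then show ?thesis
    unfolding r(2) using assms by (simp add: lessThan_Suc_atMost abs_mult power_abs del: power_Suc fact_Suc)
qed

text \<open>A product of weights in single variables is needed so that the integral over all
  frequencies factors.\<close>

lemma one_plus_norm_partial_sum_le:
  fixes \<theta> :: "nat \<Rightarrow> 'a::real_normed_vector"
  shows "1 + norm (\<Sum>j=1..i. \<theta> j) \<le> (\<Prod>j=1..i. 1 + norm (\<theta> j))"
proof (induction i)
  case (Suc i)
  have "1 + norm (\<Sum>j=1..Suc i. \<theta> j) \<le> 1 + (norm (\<Sum>j=1..i. \<theta> j) + norm (\<theta> (Suc i)))"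
    using norm_triangle_ineq by simp
  also have "\<dots> \<le> (1 + norm (\<Sum>j=1..i. \<theta> j)) * (1 + norm (\<theta> (Suc i)))"
    by (simp add: algebra_simps)
  also have "\<dots> \<le> (\<Prod>j=1..i. 1 + norm (\<theta> j)) * (1 + norm (\<theta> (Suc i)))"
    using Suc by (intro mult_right_mono) auto
  finally show ?case by simp
qed simp

text \<open>Adding 1 makes the base at least 1, so the exponent may be raised from
  \<open>\<alpha>\<close> to 2. The bound is the same for all \<open>i\<close>, which lets it
  control sums and products of phases at once.\<close>

lemma partial_sum_powr_le:
  fixes \<theta> :: "nat \<Rightarrow> 'a::real_normed_vector"
  assumes "0 < \<alpha>" "\<alpha> \<le> 2" "i \<le> m"
  shows "norm (\<Sum>j=1..i. \<theta> j) powr \<alpha> \<le> (\<Prod>j=1..m. 1 + norm (\<theta> j)) ^ 2"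
proof -
  let ?r = "norm (\<Sum>j=1..i. \<theta> j)"
  have "?r powr \<alpha> \<le> (1 + ?r) powr \<alpha>" using assms by (intro powr_mono2) auto
  also have "\<dots> \<le> (1 + ?r) powr 2" using assms by (intro powr_mono) auto
  also have "\<dots> = (1 + ?r) ^ 2" by (simp add: powr_numeral add_nonneg_pos)
  also have "\<dots> \<le> (\<Prod>j=1..m. 1 + norm (\<theta> j)) ^ 2"
  proof (rule power_mono)
    have "1 + ?r \<le> (\<Prod>j=1..i. 1 + norm (\<theta> j))" by (rule one_plus_norm_partial_sum_le)
    also have "\<dots> \<le> (\<Prod>j=1..m. 1 + norm (\<theta> j))"
      using assms(3) by (intro prod_mono2) (auto intro: add_nonneg_nonneg)
    finally show "1 + ?r \<le> (\<Prod>j=1..m. 1 + norm (\<theta> j))" .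
  qed simp
  finally show ?thesis .
qed

section \<open>Expansion of the chain integrals in powers of \<open>t\<close>\<close>

definition fourier_weight :: "('a::euclidean_space \<Rightarrow> real) \<Rightarrow> nat \<Rightarrow> (nat \<Rightarrow> 'a) \<Rightarrow> complex" where
  "fourier_weight V m \<theta> = fourier V (- (\<Sum>i=1..m. \<theta> i)) * (\<Prod>i=1..m. fourier V (\<theta> i))"

lemma component_borel_measurable:
  "j \<in> I \<Longrightarrow> (\<lambda>\<theta>. \<theta> j) \<in> borel_measurable (\<Pi>\<^sub>M i\<in>I. (lborel :: 'a::euclidean_space measure))"
  using measurable_component_singleton[of j I "\<lambda>_. lborel :: 'a measure"] by simp

lemma fourier_weight_measurable:
  fixes V :: "'a::euclidean_space \<Rightarrow> real"
  assumes V: "integrable lborel V"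
  shows "fourier_weight V m \<in> borel_measurable (\<Pi>\<^sub>M i\<in>{1..m}. lborel)"
proof -
  have "(\<lambda>\<theta>. - (\<Sum>i=1..m. \<theta> i)) \<in> borel_measurable (\<Pi>\<^sub>M i\<in>{1..m}. (lborel :: 'a measure))"
    by (intro borel_measurable_uminus borel_measurable_sum component_borel_measurable)
  then show ?thesis
    unfolding fourier_weight_def
    by (intro borel_measurable_times borel_measurable_prod measurable_compose[OF _ fourier_measurable[OF V]]
        component_borel_measurable)
qed

lemma partial_sum_powr_measurable:
  fixes m :: nat
  assumes "i \<in> {1..m}"
  shows "(\<lambda>\<theta>. norm (\<Sum>j=1..i. \<theta> j) powr \<alpha>) \<in> borel_measurable (\<Pi>\<^sub>M i\<in>{1..m}. (lborel :: 'a::euclidean_space measure))"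
proof -
  have "(\<lambda>\<theta>. \<Sum>j=1..i. \<theta> j) \<in> borel_measurable (\<Pi>\<^sub>M i\<in>{1..m}. (lborel :: 'a measure))"
    using assms by (intro borel_measurable_sum component_borel_measurable) auto
  then show ?thesis by measurable
qed

text \<open>The factor at minus the total frequency is merely bounded; the decay comes from the
  remaining \<open>m\<close> factors, one for each variable.\<close>

lemma integrable_fourier_weight:
  fixes V :: "'a::euclidean_space \<Rightarrow> real"
  assumes V: "rapidly_decreasing_smooth V"
  shows "integrable (\<Pi>\<^sub>M i\<in>{1..m}. lborel) (\<lambda>\<theta>. norm (fourier_weight V m \<theta>) * (\<Prod>j=1..m. 1 + norm (\<theta> j)) ^ n)"
proof -
  interpret product_sigma_finite "\<lambda>_::nat. lborel :: 'a measure" ..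
  note Vi = rapidly_decreasing_smooth_integrable[OF V]
  define C where "C = (\<integral>x. \<bar>V x\<bar> \<partial>lborel)"
  have C: "norm (fourier V \<xi>) \<le> C" for \<xi> unfolding C_def by (rule norm_fourier_le[OF Vi])
  show ?thesis
  proof (rule Bochner_Integration.integrable_bound)
    show "integrable (\<Pi>\<^sub>M i\<in>{1..m}. lborel) (\<lambda>\<theta>. C * (\<Prod>i=1..m. (1 + norm (\<theta> i)) ^ n * norm (fourier V (\<theta> i))))"
      by (intro integrable_mult_right product_integrable_prod integrable_fourier_weighted V) auto
    have "(\<lambda>\<theta>. 1 + norm (\<theta> j)) \<in> borel_measurable (\<Pi>\<^sub>M i\<in>{1..m}. (lborel :: 'a measure))" if "j \<in> {1..m}" for j
      using component_borel_measurable[OF that] by measurable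
    then show "(\<lambda>\<theta>. norm (fourier_weight V m \<theta>) * (\<Prod>j=1..m. 1 + norm (\<theta> j)) ^ n) \<in> borel_measurable (\<Pi>\<^sub>M i\<in>{1..m}. lborel)"
      by (intro borel_measurable_times borel_measurable_power borel_measurable_prod
          measurable_compose[OF fourier_weight_measurable[OF Vi] borel_measurable_norm])
    show "AE \<theta> in \<Pi>\<^sub>M i\<in>{1..m}. lborel. norm (norm (fourier_weight V m \<theta>) * (\<Prod>j=1..m. 1 + norm (\<theta> j)) ^ n) \<le>
        norm (C * (\<Prod>i=1..m. (1 + norm (\<theta> i)) ^ n * norm (fourier V (\<theta> i))))"
    proof (rule AE_I2)
      fix \<theta> :: "nat \<Rightarrow> 'a"
      let ?P = "(\<Prod>i=1..m. (1 + norm (\<theta> i)) ^ n * norm (fourier V (\<theta> i)))"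
      have "0 \<le> norm (fourier_weight V m \<theta>) * (\<Prod>j=1..m. 1 + norm (\<theta> j)) ^ n"
        by (intro mult_nonneg_nonneg zero_le_power prod_nonneg) auto
      have "norm (fourier_weight V m \<theta>) * (\<Prod>j=1..m. 1 + norm (\<theta> j)) ^ n =
          norm (fourier V (- (\<Sum>i=1..m. \<theta> i))) * ?P"
        by (simp add: fourier_weight_def norm_mult prod_norm[symmetric] prod.distrib prod_power_distrib mult_ac)
      also have "\<dots> \<le> C * ?P" using C by (intro mult_right_mono prod_nonneg) auto
      finally show "norm (norm (fourier_weight V m \<theta>) * (\<Prod>j=1..m. 1 + norm (\<theta> j)) ^ n) \<le> norm (C * ?P)"
        using \<open>0 \<le> norm (fourier_weight V m \<theta>) * (\<Prod>j=1..m. 1 + norm (\<theta> j)) ^ n\<close>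
        unfolding real_norm_def by linarith
    qed
  qed
qed

definition phase_integral :: "real \<Rightarrow> ('a::euclidean_space \<Rightarrow> real) \<Rightarrow> nat \<Rightarrow> (nat \<Rightarrow> nat) \<Rightarrow> complex" where
  "phase_integral \<alpha> V m e =
     complex_of_real (1 / (2 * pi) ^ (DIM('a) * m)) *
     (\<integral>\<theta>. fourier V (- (\<Sum>i=1..m. \<theta> i)) *
        (\<Prod>i=1..m. fourier V (\<theta> i) * complex_of_real ((norm (\<Sum>j=1..i. \<theta> j) powr \<alpha>) ^ e i))
      \<partial>(\<Pi>\<^sub>M i\<in>{1..m}. (lborel :: 'a measure)))"

lemma integrable_fourier_weight_mult:
  fixes V :: "'a::euclidean_space \<Rightarrow> real"
  assumes V: "rapidly_decreasing_smooth V"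
    and f: "f \<in> borel_measurable (\<Pi>\<^sub>M i\<in>{1..m}. lborel)"
    and bound: "\<And>\<theta>. \<bar>f \<theta>\<bar> \<le> D * (\<Prod>j=1..m. 1 + norm (\<theta> j)) ^ n"
  shows "integrable (\<Pi>\<^sub>M i\<in>{1..m}. lborel) (\<lambda>\<theta>. fourier_weight V m \<theta> * complex_of_real (f \<theta>))"
proof (rule Bochner_Integration.integrable_bound)
  show "integrable (\<Pi>\<^sub>M i\<in>{1..m}. lborel) (\<lambda>\<theta>. D * (norm (fourier_weight V m \<theta>) * (\<Prod>j=1..m. 1 + norm (\<theta> j)) ^ n))"
    by (intro integrable_mult_right integrable_fourier_weight V)
  show "(\<lambda>\<theta>. fourier_weight V m \<theta> * complex_of_real (f \<theta>)) \<in> borel_measurable (\<Pi>\<^sub>M i\<in>{1..m}. lborel)"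
    using measurable_compose[OF f, of complex_of_real borel]
    by (intro borel_measurable_times fourier_weight_measurable rapidly_decreasing_smooth_integrable V) simp
  show "AE \<theta> in \<Pi>\<^sub>M i\<in>{1..m}. lborel. norm (fourier_weight V m \<theta> * complex_of_real (f \<theta>)) \<le>
      norm (D * (norm (fourier_weight V m \<theta>) * (\<Prod>j=1..m. 1 + norm (\<theta> j)) ^ n))"
  proof (rule AE_I2)
    fix \<theta>
    have "norm (fourier_weight V m \<theta> * complex_of_real (f \<theta>)) \<le> norm (fourier_weight V m \<theta>) * (D * (\<Prod>j=1..m. 1 + norm (\<theta> j)) ^ n)"
      using bound by (simp add: norm_mult mult_left_mono)
    also have "\<dots> = D * (norm (fourier_weight V m \<theta>) * (\<Prod>j=1..m. 1 + norm (\<theta> j)) ^ n)"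
      by (simp only: mult_ac)
    finally show "norm (fourier_weight V m \<theta> * complex_of_real (f \<theta>)) \<le>
        norm (D * (norm (fourier_weight V m \<theta>) * (\<Prod>j=1..m. 1 + norm (\<theta> j)) ^ n))"
      unfolding real_norm_def by linarith
  qed
qed

text \<open>The constant is chosen before \<open>t\<close> and the gaps \<open>\<mu>\<close>,
  because the estimate is afterwards integrated over the simplex and used as \<open>t\<close> tends
  to 0.\<close>

lemma chain_expansion:
  fixes V :: "'a::euclidean_space \<Rightarrow> real" and p :: "real \<Rightarrow> 'a \<Rightarrow> real"
  assumes p: "stable_density \<alpha> p" and \<alpha>: "0 < \<alpha>" "\<alpha> \<le> 2" and V: "rapidly_decreasing_smooth V"
  shows "\<exists>K. \<forall>t>0. \<forall>\<mu>. (\<forall>i\<in>{1..m}. 0 < \<mu> i \<and> \<mu> i \<le> 1) \<longrightarrow>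
    norm (complex_of_real (\<integral>z. (\<Prod>j=1..m. p (t * \<mu> j) (z j - z (j + 1))) * (\<Prod>i=1..m + 1. V (z i)) \<partial>(\<Pi>\<^sub>M i\<in>{1..m + 1}. lborel)) -
      (\<Sum>n\<le>q. \<Sum>e\<in>multi_indices m n. complex_of_real ((- t) ^ n / fact n * (fact n / (\<Prod>i=1..m. fact (e i)) * (\<Prod>i=1..m. \<mu> i ^ e i))) * phase_integral \<alpha> V m e))
    \<le> K * t ^ Suc q"
proof -
  let ?Z = "\<Pi>\<^sub>M i\<in>{1..m}. (lborel :: 'a measure)"
  define c where "c = complex_of_real (1 / (2 * pi) ^ (DIM('a) * m))"
  define a where "a i \<theta> = norm (\<Sum>j=1..i. \<theta> j :: 'a) powr \<alpha>" for i and \<theta> :: "nat \<Rightarrow> 'a"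
  define P where "P \<theta> = (\<Prod>j=1..m. 1 + norm (\<theta> j))" for \<theta> :: "nat \<Rightarrow> 'a"
  define W where "W = fourier_weight V m"
  have am: "a i \<in> borel_measurable ?Z" if "i \<in> {1..m}" for i
    unfolding a_def by (rule partial_sum_powr_measurable[OF that])
  have a0: "0 \<le> a i \<theta>" for i \<theta> by (simp add: a_def)
  have aP: "a i \<theta> \<le> P \<theta> ^ 2" if "i \<in> {1..m}" for i \<theta>
    unfolding a_def P_def using that by (intro partial_sum_powr_le \<alpha>) auto
  \<comment> \<open>The phase is at most \<open>m * P \<theta> ^ 2\<close>, so the Taylor remainder
    of order \<open>q\<close> contributes \<open>m ^ Suc q\<close> and the weight
    \<open>P \<theta> ^ (2 * Suc q)\<close>.\<close>
  define K where "K = norm c * (real m ^ Suc q * (\<integral>\<theta>. norm (W \<theta>) * P \<theta> ^ (2 * Suc q) \<partial>?Z))"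
  have "norm (complex_of_real (\<integral>z. (\<Prod>j=1..m. p (t * \<mu> j) (z j - z (j + 1))) * (\<Prod>i=1..m + 1. V (z i)) \<partial>(\<Pi>\<^sub>M i\<in>{1..m + 1}. lborel)) -
      (\<Sum>n\<le>q. \<Sum>e\<in>multi_indices m n. complex_of_real ((- t) ^ n / fact n * (fact n / (\<Prod>i=1..m. fact (e i)) * (\<Prod>i=1..m. \<mu> i ^ e i))) * phase_integral \<alpha> V m e))
    \<le> K * t ^ Suc q" if t: "0 < t" and \<mu>: "\<forall>i\<in>{1..m}. 0 < \<mu> i \<and> \<mu> i \<le> 1" for t \<mu>
  proof -
    \<comment> \<open>The product of the exponentials along the chain is
      \<open>exp (- (t * u \<theta>))\<close>.\<close>
    define u where "u \<theta> = (\<Sum>i=1..m. \<mu> i * a i \<theta>)" for \<theta>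
    have um: "u \<in> borel_measurable ?Z"
      unfolding u_def using am by (intro borel_measurable_sum borel_measurable_times) auto
    have u0: "0 \<le> u \<theta>" for \<theta>
      unfolding u_def using \<mu> a0 by (intro sum_nonneg mult_nonneg_nonneg) (auto simp: less_imp_le)
    have uP: "u \<theta> \<le> real m * P \<theta> ^ 2" for \<theta>
    proof -
      have "u \<theta> \<le> (\<Sum>i=1..m. 1 * P \<theta> ^ 2)"
        unfolding u_def using \<mu> a0 aP by (intro sum_mono mult_mono) auto
      then show ?thesis by simp
    qed
    let ?mon = "\<lambda>e \<theta>. \<Prod>i=1..m. a i \<theta> ^ e i"
    let ?co = "\<lambda>n e. (- t) ^ n / fact n * (fact n / (\<Prod>i=1..m. fact (e i)) * (\<Prod>i=1..m. \<mu> i ^ e i))"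
    have mon_int: "integrable ?Z (\<lambda>\<theta>. W \<theta> * complex_of_real (?mon e \<theta>))" for e
      unfolding W_def
    proof (rule integrable_fourier_weight_mult[OF V, where D=1 and n="2 * (\<Sum>i=1..m. e i)"])
      show "?mon e \<in> borel_measurable ?Z"
        using am by (intro borel_measurable_prod borel_measurable_power) auto
      fix \<theta>
      have "\<bar>?mon e \<theta>\<bar> = ?mon e \<theta>" using a0 by (intro abs_of_nonneg prod_nonneg) auto
      also have "\<dots> \<le> (\<Prod>i=1..m. (P \<theta> ^ 2) ^ e i)"
        using a0 aP by (intro prod_mono conjI power_mono zero_le_power) auto
      also have "\<dots> = P \<theta> ^ (2 * (\<Sum>i=1..m. e i))"
        by (simp add: power_sum power_mult)
      finally show "\<bar>?mon e \<theta>\<bar> \<le> 1 * (\<Prod>j=1..m. 1 + norm (\<theta> j)) ^ (2 * (\<Sum>i=1..m. e i))"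
        by (simp add: P_def)
    qed
    have phase: "phase_integral \<alpha> V m e = c * (\<integral>\<theta>. W \<theta> * complex_of_real (?mon e \<theta>) \<partial>?Z)" for e
      unfolding phase_integral_def c_def W_def fourier_weight_def a_def
      by (simp add: prod.distrib mult.assoc)
    have exp_int: "integrable ?Z (\<lambda>\<theta>. W \<theta> * complex_of_real (exp (- (t * u \<theta>))))"
      unfolding W_def
    proof (rule integrable_fourier_weight_mult[OF V, where D=1 and n=0])
      show "(\<lambda>\<theta>. exp (- (t * u \<theta>))) \<in> borel_measurable ?Z" using um by measurable
    qed (use t u0 in simp)
    have chain: "complex_of_real (\<integral>z. (\<Prod>j=1..m. p (t * \<mu> j) (z j - z (j + 1))) * (\<Prod>i=1..m + 1. V (z i)) \<partial>(\<Pi>\<^sub>M i\<in>{1..m + 1}. lborel)) =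
        c * (\<integral>\<theta>. W \<theta> * complex_of_real (exp (- (t * u \<theta>))) \<partial>?Z)"
    proof -
      have "(\<Prod>i=1..m. complex_of_real (exp (- (t * \<mu> i) * norm (\<Sum>j=1..i. \<theta> j) powr \<alpha>))) = complex_of_real (exp (- (t * u \<theta>)))" for \<theta> :: "nat \<Rightarrow> 'a"
        by (simp add: u_def a_def sum_distrib_left exp_sum[symmetric] sum_negf[symmetric] mult.assoc flip: of_real_prod)
      then show ?thesis
        using t \<mu> unfolding c_def W_def fourier_weight_def
        by (subst chain_integral_fourier[OF p \<alpha>(1) rapidly_decreasing_smooth_integrable[OF V]])
           (auto simp: prod.distrib mult.assoc)
    qed
    have poly: "(\<Sum>n\<le>q. (- (t * u \<theta>)) ^ n / fact n) = (\<Sum>n\<le>q. \<Sum>e\<in>multi_indices m n. ?co n e * ?mon e \<theta>)" for \<theta>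
    proof (intro sum.cong refl)
      fix n
      have "(- (t * u \<theta>)) ^ n / fact n = (- t) ^ n / fact n * u \<theta> ^ n"
        by (metis minus_mult_left power_mult_distrib times_divide_eq_left)
      also have "u \<theta> ^ n = (\<Sum>e\<in>multi_indices m n. fact n / (\<Prod>i=1..m. fact (e i)) * (\<Prod>i=1..m. (\<mu> i * a i \<theta>) ^ e i))"
        unfolding u_def by (rule multinomial_theorem)
      also have "(- t) ^ n / fact n * \<dots> = (\<Sum>e\<in>multi_indices m n. ?co n e * ?mon e \<theta>)"
        unfolding sum_distrib_left by (intro sum.cong refl) (simp only: power_mult_distrib prod.distrib mult.assoc)
      finally show "(- (t * u \<theta>)) ^ n / fact n = (\<Sum>e\<in>multi_indices m n. ?co n e * ?mon e \<theta>)" .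
    qed
    have poly_eq: "W \<theta> * complex_of_real (\<Sum>n\<le>q. (- (t * u \<theta>)) ^ n / fact n) =
       (\<Sum>n\<le>q. \<Sum>e\<in>multi_indices m n. complex_of_real (?co n e) * (W \<theta> * complex_of_real (?mon e \<theta>)))" for \<theta>
      unfolding poly of_real_sum of_real_mult sum_distrib_left by (intro sum.cong refl) (simp only: mult.left_commute)
    have poly_int: "integrable ?Z (\<lambda>\<theta>. W \<theta> * complex_of_real (\<Sum>n\<le>q. (- (t * u \<theta>)) ^ n / fact n))"
      unfolding poly_eq by (intro Bochner_Integration.integrable_sum integrable_mult_right mon_int)
    have sum_eq: "(\<Sum>n\<le>q. \<Sum>e\<in>multi_indices m n. complex_of_real (?co n e) * phase_integral \<alpha> V m e) =
        c * (\<integral>\<theta>. W \<theta> * complex_of_real (\<Sum>n\<le>q. (- (t * u \<theta>)) ^ n / fact n) \<partial>?Z)"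
    proof -
      have "(\<integral>\<theta>. W \<theta> * complex_of_real (\<Sum>n\<le>q. (- (t * u \<theta>)) ^ n / fact n) \<partial>?Z) =
        (\<Sum>n\<le>q. \<Sum>e\<in>multi_indices m n. complex_of_real (?co n e) * (\<integral>\<theta>. W \<theta> * complex_of_real (?mon e \<theta>) \<partial>?Z))"
        unfolding poly_eq
        by (subst Bochner_Integration.integral_sum, intro Bochner_Integration.integrable_sum integrable_mult_right mon_int,
            subst Bochner_Integration.integral_sum, intro integrable_mult_right mon_int, simp only: integral_mult_right_zero)
      then show ?thesis
        unfolding phase by (simp only: sum_distrib_left mult.left_commute)
    qed
    have "norm (c * (\<integral>\<theta>. W \<theta> * complex_of_real (exp (- (t * u \<theta>))) \<partial>?Z) -
        c * (\<integral>\<theta>. W \<theta> * complex_of_real (\<Sum>n\<le>q. (- (t * u \<theta>)) ^ n / fact n) \<partial>?Z)) =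
      norm c * norm (\<integral>\<theta>. W \<theta> * complex_of_real (exp (- (t * u \<theta>))) - W \<theta> * complex_of_real (\<Sum>n\<le>q. (- (t * u \<theta>)) ^ n / fact n) \<partial>?Z)"
      by (simp only: Bochner_Integration.integral_diff[OF exp_int poly_int] right_diff_distrib[of c, symmetric] norm_mult)
    also have "\<dots> \<le> norm c * (\<integral>\<theta>. (t ^ Suc q * real m ^ Suc q) * (norm (W \<theta>) * P \<theta> ^ (2 * Suc q)) \<partial>?Z)"
    proof (intro mult_left_mono norm_integral_le_integral)
      show "integrable ?Z (\<lambda>\<theta>. (t ^ Suc q * real m ^ Suc q) * (norm (W \<theta>) * P \<theta> ^ (2 * Suc q)))"
        unfolding W_def P_def by (intro integrable_mult_right integrable_fourier_weight V)
      fix \<theta>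
      have "norm (W \<theta> * complex_of_real (exp (- (t * u \<theta>))) - W \<theta> * complex_of_real (\<Sum>n\<le>q. (- (t * u \<theta>)) ^ n / fact n)) =
         norm (W \<theta>) * \<bar>exp (- (t * u \<theta>)) - (\<Sum>n\<le>q. (- (t * u \<theta>)) ^ n / fact n)\<bar>"
        unfolding right_diff_distrib[symmetric] of_real_diff[symmetric] norm_mult norm_of_real ..
      also have "\<dots> \<le> norm (W \<theta>) * (t * u \<theta>) ^ Suc q"
        using t u0 by (intro mult_left_mono exp_minus_taylor_le_nonneg) auto
      also have "\<dots> \<le> norm (W \<theta>) * (t * (real m * P \<theta> ^ 2)) ^ Suc q"
        using t u0 uP by (intro mult_left_mono power_mono mult_nonneg_nonneg) auto
      also have "\<dots> = (t ^ Suc q * real m ^ Suc q) * (norm (W \<theta>) * P \<theta> ^ (2 * Suc q))"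
        unfolding power_mult_distrib power_mult[symmetric] by (simp only: mult_ac)
      finally show "norm (W \<theta> * complex_of_real (exp (- (t * u \<theta>))) - W \<theta> * complex_of_real (\<Sum>n\<le>q. (- (t * u \<theta>)) ^ n / fact n)) \<le>
        (t ^ Suc q * real m ^ Suc q) * (norm (W \<theta>) * P \<theta> ^ (2 * Suc q))" .
    qed auto
    also have "\<dots> = K * t ^ Suc q"
      unfolding K_def integral_mult_right_zero by (simp only: mult_ac)
    finally show ?thesis unfolding chain sum_eq .
  qed
  then show ?thesis by blast
qed

lemma C_pair_phase_integral:
  "C_pair \<alpha> V n k = (\<Sum>e\<in>multi_indices (k - 1) n. complex_of_real (A_coeff k n e) * phase_integral \<alpha> V (k - 1) e)"
  by (simp only: C_pair_def phase_integral_def)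

text \<open>Stated for any \<open>g\<close> that agrees with the chain integral on the simplex, so
  that \<open>K\<close> can be fixed before \<open>t\<close> although \<open>chain_integral\<close>
  belongs to a locale with fixed \<open>t\<close>. Integrating the monomials in the gaps yields
  \<open>A_coeff\<close>.\<close>

lemma simplex_chain_expansion:
  fixes V :: "'a::euclidean_space \<Rightarrow> real" and p :: "real \<Rightarrow> 'a \<Rightarrow> real"
  assumes p: "stable_density \<alpha> p" and \<alpha>: "0 < \<alpha>" "\<alpha> \<le> 2" and V: "rapidly_decreasing_smooth V" and k: "1 \<le> k"
  shows "\<exists>K. \<forall>t>0. \<forall>g.
    (\<forall>l\<in>ordered_simplex k. g l = (\<integral>z. (\<Prod>j=1..k - 1. p (t * (l j - l (j + 1))) (z j - z (j + 1))) * (\<Prod>i=1..k. V (z i)) \<partial>(\<Pi>\<^sub>M i\<in>{1..k}. lborel))) \<longrightarrow>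
    set_integrable (\<Pi>\<^sub>M i\<in>{1..k}. lborel) (ordered_simplex k) g \<longrightarrow>
    norm (complex_of_real (LINT l:ordered_simplex k|(\<Pi>\<^sub>M i\<in>{1..k}. lborel). g l) -
      (\<Sum>n\<le>q. (- complex_of_real t) ^ n / fact n * C_pair \<alpha> V n k)) \<le> K * t ^ Suc q"
proof -
  define m where "m = k - 1"
  have km: "k = m + 1" using k by (simp add: m_def)
  let ?L = "\<Pi>\<^sub>M i\<in>{1..k}. (lborel :: real measure)"
  let ?S = "ordered_simplex k"
  note ordered_simplex_sets[OF k, measurable]
  let ?chain = "\<lambda>t \<mu>. complex_of_real (\<integral>z. (\<Prod>j=1..m. p (t * \<mu> j) (z j - z (j + 1))) * (\<Prod>i=1..m + 1. V (z i)) \<partial>(\<Pi>\<^sub>M i\<in>{1..m + 1}. lborel))"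
  \<comment> \<open>The part of each coefficient that does not depend on the point of the
    simplex.\<close>
  let ?b = "\<lambda>t n e. complex_of_real ((- t) ^ n / fact n) * complex_of_real (fact n / (\<Prod>i=1..m. fact (e i))) * phase_integral \<alpha> V m e"
  obtain K where K_all: "\<forall>t>0. \<forall>\<mu>. (\<forall>i\<in>{1..m}. 0 < \<mu> i \<and> \<mu> i \<le> 1) \<longrightarrow>
      norm (?chain t \<mu> - (\<Sum>n\<le>q. \<Sum>e\<in>multi_indices m n. complex_of_real ((- t) ^ n / fact n * (fact n / (\<Prod>i=1..m. fact (e i)) * (\<Prod>i=1..m. \<mu> i ^ e i))) * phase_integral \<alpha> V m e)) \<le> K * t ^ Suc q"
    using chain_expansion[OF p \<alpha> V, of m q] by (elim exE) (rule that)
  note K = K_all[rule_format]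
  have \<mu>: "0 < l i - l (i + 1) \<and> l i - l (i + 1) \<le> 1" if "l \<in> ?S" "i \<in> {1..m}" for l i
  proof -
    have "l (i + 1) < l i" "0 < l (i + 1)" "l i < 1"
      using that by (auto simp: ordered_simplex_iff[OF k] decreasing_above_iff m_def)
    then show ?thesis by simp
  qed
  let ?M = "\<lambda>e l. \<Prod>i=1..m. (l i - l (i + 1)) ^ e i :: real"
  have fin: "emeasure ?L ?S < \<infinity>" by (rule emeasure_ordered_simplex_finite[OF k])
  have S_int: "integrable ?L (\<lambda>l. indicator ?S l *\<^sub>R (D::real))" for D
    using fin by (intro integrable_scaleR_left integrable_real_indicator) auto
  have M_int: "integrable ?L (\<lambda>l. indicator ?S l *\<^sub>R ?M e l)" for e
  proof (rule Bochner_Integration.integrable_bound[OF S_int[of 1]])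
    have "?M e \<in> borel_measurable ?L"
      by (intro borel_measurable_prod borel_measurable_power borel_measurable_diff component_borel_measurable) (auto simp: km)
    then show "(\<lambda>l. indicator ?S l *\<^sub>R ?M e l) \<in> borel_measurable ?L" by measurable
    have "\<bar>?M e l\<bar> \<le> 1" if "l \<in> ?S" for l
    proof -
      have "\<bar>l i - l (i + 1)\<bar> \<le> 1" if "i \<in> {1..m}" for i
        using \<mu>[OF \<open>l \<in> ?S\<close> that] by linarith
      then show ?thesis
        unfolding abs_prod by (intro prod_le_1) (auto simp: power_abs intro!: power_le_one)
    qed
    then show "AE l in ?L. norm (indicator ?S l *\<^sub>R ?M e l) \<le> norm (indicator ?S l *\<^sub>R (1::real))"
      by (intro AE_I2) (auto simp: indicator_def)
  qed
  have "norm (complex_of_real (LINT l:?S|?L. g l) - (\<Sum>n\<le>q. (- complex_of_real t) ^ n / fact n * C_pair \<alpha> V n k))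
      \<le> (K * measure ?L ?S) * t ^ Suc q"
    if t: "0 < t" and g: "\<forall>l\<in>?S. g l = (\<integral>z. (\<Prod>j=1..k - 1. p (t * (l j - l (j + 1))) (z j - z (j + 1))) * (\<Prod>i=1..k. V (z i)) \<partial>(\<Pi>\<^sub>M i\<in>{1..k}. lborel))"
      and gi: "set_integrable ?L ?S g" for t g
  proof -
    let ?poly = "\<lambda>l. \<Sum>n\<le>q. \<Sum>e\<in>multi_indices m n. complex_of_real (indicator ?S l *\<^sub>R ?M e l) * ?b t n e"
    have gi': "integrable ?L (\<lambda>l. complex_of_real (indicator ?S l *\<^sub>R g l))"
      using gi unfolding set_integrable_def by (rule integrable_of_real)
    have poly_int: "integrable ?L ?poly"
      by (intro Bochner_Integration.integrable_sum integrable_mult_left integrable_of_real M_int)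
    have "(\<Sum>n\<le>q. (- complex_of_real t) ^ n / fact n * C_pair \<alpha> V n k) =
        (\<Sum>n\<le>q. \<Sum>e\<in>multi_indices m n. complex_of_real (LINT l:?S|?L. ?M e l) * ?b t n e)"
      unfolding C_pair_phase_integral m_def[symmetric] A_coeff_def sum_distrib_left
      by (intro sum.cong refl) (simp add: mult_ac)
    also have "\<dots> = (\<Sum>n\<le>q. \<Sum>e\<in>multi_indices m n. (\<integral>l. complex_of_real (indicator ?S l *\<^sub>R ?M e l) * ?b t n e \<partial>?L))"
      unfolding set_lebesgue_integral_def integral_mult_left_zero integral_complex_of_real ..
    also have "\<dots> = (\<integral>l. ?poly l \<partial>?L)"
      by (subst Bochner_Integration.integral_sum, intro Bochner_Integration.integrable_sum integrable_mult_left integrable_of_real M_int,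
          subst Bochner_Integration.integral_sum, intro integrable_mult_left integrable_of_real M_int, rule refl)
    finally have "norm (complex_of_real (LINT l:?S|?L. g l) - (\<Sum>n\<le>q. (- complex_of_real t) ^ n / fact n * C_pair \<alpha> V n k)) =
        norm (\<integral>l. complex_of_real (indicator ?S l *\<^sub>R g l) - ?poly l \<partial>?L)"
      unfolding Bochner_Integration.integral_diff[OF gi' poly_int] set_lebesgue_integral_def by (simp only: integral_complex_of_real)
    also have "\<dots> \<le> (\<integral>l. indicator ?S l *\<^sub>R (K * t ^ Suc q) \<partial>?L)"
    proof (rule norm_integral_le_integral[OF S_int])
      fix l
      show "norm (complex_of_real (indicator ?S l *\<^sub>R g l) - ?poly l) \<le> indicator ?S l *\<^sub>R (K * t ^ Suc q)"
      proof (cases "l \<in> ?S")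
        case True
        have gl: "complex_of_real (g l) = ?chain t (\<lambda>i. l i - l (i + 1))"
          using g True by (simp only: km m_def[symmetric] add_diff_cancel_right')
        have "?poly l = (\<Sum>n\<le>q. \<Sum>e\<in>multi_indices m n. complex_of_real ((- t) ^ n / fact n * (fact n / (\<Prod>i=1..m. fact (e i)) * ?M e l)) * phase_integral \<alpha> V m e)"
          using True by (intro sum.cong refl) (simp add: mult_ac)
        then show ?thesis
          using K[OF t, of "\<lambda>i. l i - l (i + 1)"] \<mu>[OF True] True by (simp only: gl indicator_simps scaleR_one)
      qed simp
    qed
    also have "\<dots> = (K * measure ?L ?S) * t ^ Suc q"
      using fin by (subst integral_scaleR_left) (auto simp: less_top[symmetric] integrable_real_indicator)
    finally show ?thesis .
  qed
  then show ?thesis by blast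
qed

subsection \<open>The heat content\<close>

text \<open>Summing by \<open>k\<close> instead of by the total degree \<open>n + k \<le> N\<close>
  leaves \<open>n \<le> N - k\<close>: a chain with \<open>k\<close> points is expanded to order
  \<open>N - k\<close> only.\<close>

lemma C_coeff_sum:
  "(\<Sum>m=2..N. z ^ m * C_coeff \<alpha> V m) =
   (\<Sum>k=2..N. z ^ k * (\<Sum>n\<le>N - k. z ^ n / fact n * C_pair \<alpha> V n k))"
proof -
  have "(\<Sum>m=2..N. z ^ m * C_coeff \<alpha> V m) =
      (\<Sum>m=2..N. \<Sum>k=2..m. z ^ k * (z ^ (m - k) / fact (m - k) * C_pair \<alpha> V (m - k) k))"
  proof (intro sum.cong refl)
    fix m
    have "C_coeff \<alpha> V m = (\<Sum>k=2..m. 1 / fact (m - k) * C_pair \<alpha> V (m - k) k)"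
      unfolding C_coeff_def
      by (rule sum.reindex_bij_witness[where i="\<lambda>k. (m - k, k)" and j=snd]) auto
    then have "z ^ m * C_coeff \<alpha> V m = (\<Sum>k=2..m. z ^ m * (1 / fact (m - k) * C_pair \<alpha> V (m - k) k))"
      by (simp only: sum_distrib_left)
    also have "\<dots> = (\<Sum>k=2..m. z ^ k * (z ^ (m - k) / fact (m - k) * C_pair \<alpha> V (m - k) k))"
    proof (intro sum.cong refl)
      fix k assume "k \<in> {2..m}"
      then have "z ^ m = z ^ k * z ^ (m - k)" by (simp add: power_add[symmetric])
      then show "z ^ m * (1 / fact (m - k) * C_pair \<alpha> V (m - k) k) = z ^ k * (z ^ (m - k) / fact (m - k) * C_pair \<alpha> V (m - k) k)"
        by simp
    qed
    finally show "z ^ m * C_coeff \<alpha> V m = (\<Sum>k=2..m. z ^ k * (z ^ (m - k) / fact (m - k) * C_pair \<alpha> V (m - k) k))" .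
  qed
  also have "\<dots> = (\<Sum>(m, k)\<in>(SIGMA m:{2..N}. {2..m}). z ^ k * (z ^ (m - k) / fact (m - k) * C_pair \<alpha> V (m - k) k))"
    by (rule sum.Sigma) auto
  also have "\<dots> = (\<Sum>(k, n)\<in>(SIGMA k:{2..N}. {..N - k}). z ^ k * (z ^ n / fact n * C_pair \<alpha> V n k))"
    by (rule sum.reindex_bij_witness[where i="\<lambda>(k, n). (k + n, k)" and j="\<lambda>(m, k). (k, m - k)"]) auto
  also have "\<dots> = (\<Sum>k=2..N. \<Sum>n\<le>N - k. z ^ k * (z ^ n / fact n * C_pair \<alpha> V n k))"
    by (rule sum.Sigma[symmetric]) auto
  finally show ?thesis by (simp only: sum_distrib_left)
qed

lemma (in bounded_potential) heat_content_expansion: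
  "\<bar>(\<integral>y. (\<integral>x. p t (x - y) * (\<integral>\<omega>. exp (- (LINT s:{0..t}|lborel. v (X x y s \<omega>))) \<partial>M x y) - p t (x - y) \<partial>lborel) \<partial>lborel) -
    (\<Sum>k=1..N. (- t) ^ k * (LINT l:ordered_simplex k|L k. chain_integral k l))\<bar> \<le>
    exp (t * B) * (t * B) ^ N * t * (\<integral>x. \<bar>v x\<bar> \<partial>lborel)"
  using double_integral_expansion[of N] unfolding kernel_difference_def action_def .

theorem theorem3p1:
  fixes \<alpha> :: real
    and V :: "'a::euclidean_space \<Rightarrow> real"
    and p :: "real \<Rightarrow> 'a \<Rightarrow> real"
    and M :: "real \<Rightarrow> 'a \<Rightarrow> 'a \<Rightarrow> 'w measure"
    and X :: "real \<Rightarrow> 'a \<Rightarrow> 'a \<Rightarrow> real \<Rightarrow> 'w \<Rightarrow> 'a"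
    and N :: nat
  assumes "0 < \<alpha>" "\<alpha> \<le> 2"
    and "rapidly_decreasing_smooth V"
    and "stable_density \<alpha> p"
    and "\<And>t x y. 0 < t \<Longrightarrow> stable_bridge p t x y (M t x y) (X t x y)"
    and "2 \<le> N"
  shows "(\<lambda>t. complex_of_real (heat_content p M X V t) -
            (- complex_of_real t * complex_of_real (\<integral>\<theta>. V \<theta> \<partial>lborel) +
             (\<Sum>m=2..N. (- complex_of_real t) ^ m * C_coeff \<alpha> V m)))
         \<in> O[at_right 0](\<lambda>t. complex_of_real (t ^ (N + 1)))"
proof -
  note \<alpha> = assms(1,2) and V = assms(3) and p = assms(4)
  \<comment> \<open>The truncation makes \<open>p\<close> jointly measurable in time and space.\<close>
  define p' where "p' s x = (if 0 < s then p s x else 0)" for s x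
  have p'_eq: "p' s = p s" if "0 < s" for s
    using that by (simp add: p'_def fun_eq_iff)
  have p': "stable_density \<alpha> p'"
    using p by (simp add: stable_density_def p'_eq)
  have p'_meas: "(\<lambda>(s, x). p' s x) \<in> borel_measurable (borel \<Otimes>\<^sub>M borel)"
    unfolding p'_def by (rule stable_density_jointly_measurable[OF p \<alpha>(1)])
  have bridge': "stable_bridge p' t x y (M t x y) (X t x y)" if t: "0 < t" for t x y
  proof -
    \<comment> \<open>The fractions decrease strictly, so the bridge densities evaluate
      \<open>p\<close> at positive times only.\<close>
    have "(\<Prod>j=0..k. p' (t * (l j - l (j + 1))) (w j)) = (\<Prod>j=0..k. p (t * (l j - l (j + 1))) (w j))"
      if "\<forall>j\<le>k. l (j + 1) < l j" for k :: nat and l w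
      using that t by (intro prod.cong refl) (auto simp: p'_def)
    note prod_eq = this
    note bridge = assms(5)[OF t, of x y, unfolded stable_bridge_def Let_def]
    show ?thesis
      unfolding stable_bridge_def Let_def p'_eq[OF t]
    proof (intro conjI allI impI)
      fix k and l :: "nat \<Rightarrow> real"
      assume l: "1 \<le> k" "l 0 = 1" "l (k + 1) = 0" "\<forall>j\<le>k. l (j + 1) < l j"
      show "distributed (M t x y) (\<Pi>\<^sub>M i\<in>{1..k}. lborel) (\<lambda>\<omega>. \<lambda>i\<in>{1..k}. X t x y (t * l i) \<omega>)
          (\<lambda>z. ennreal ((\<Prod>j=0..k. p' (t * (l j - l (j + 1))) ((z(0 := y, k + 1 := x)) j - (z(0 := y, k + 1 := x)) (j + 1))) / p t (x - y)))"
        unfolding prod_eq[OF l(4)] using bridge l by blast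
    qed (use bridge in blast)+
  qed
  obtain B where B: "\<And>x. \<bar>V x\<bar> \<le> B"
    using rapidly_decreasing_smooth_bound[OF V, of 0] by (metis mult_1 power_0)
  have "bounded_potential p' t (M t) (X t) V B" if t: "0 < t" for t
  proof
    show "integrable lborel (p' s)" "0 \<le> p' s x" "(\<integral>x. p' s x \<partial>lborel) = 1" if "0 < s" for s x
      using p' that stable_density_integral[OF p' \<alpha>(1) that] by (auto simp: stable_density_def)
  qed (use t p'_meas bridge'[OF t] B rapidly_decreasing_smooth_integrable[OF V] in auto)
  note BP = this
  define I where "I k t = (LINT l:ordered_simplex k|(\<Pi>\<^sub>M i\<in>{1..k}. lborel). bounded_potential.chain_integral p' t V k l)" for k t
  have heat: "\<bar>heat_content p M X V t - (\<Sum>k=1..N. (- t) ^ k * I k t)\<bar> \<le> exp (t * B) * (t * B) ^ N * t * (\<integral>x. \<bar>V x\<bar> \<partial>lborel)"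
    if t: "0 < t" for t
    using bounded_potential.heat_content_expansion[OF BP[OF t], of N] t
    by (simp add: heat_content_def heat_kernel_def I_def p'_def)
  have I1: "I 1 t = (\<integral>x. V x \<partial>lborel)" if t: "0 < t" for t
    unfolding I_def by (rule bounded_potential.set_integral_chain_integral_one[OF BP[OF t]])
  \<comment> \<open>Order \<open>N - k\<close> is enough, since the \<open>k\<close>-th integral is
    multiplied by \<open>t ^ k\<close>.\<close>
  have "\<forall>k\<in>{2..N}. \<exists>K. \<forall>t>0. norm (complex_of_real (I k t) - (\<Sum>n\<le>N - k. (- complex_of_real t) ^ n / fact n * C_pair \<alpha> V n k)) \<le> K * t ^ Suc (N - k)"
  proof
    fix k assume "k \<in> {2..N}"
    then have k: "1 \<le> k" by simp
    obtain K where K: "\<forall>t>0. \<forall>g.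
      (\<forall>l\<in>ordered_simplex k. g l = (\<integral>z. (\<Prod>j=1..k - 1. p' (t * (l j - l (j + 1))) (z j - z (j + 1))) * (\<Prod>i=1..k. V (z i)) \<partial>(\<Pi>\<^sub>M i\<in>{1..k}. lborel))) \<longrightarrow>
      set_integrable (\<Pi>\<^sub>M i\<in>{1..k}. lborel) (ordered_simplex k) g \<longrightarrow>
      norm (complex_of_real (LINT l:ordered_simplex k|(\<Pi>\<^sub>M i\<in>{1..k}. lborel). g l) -
        (\<Sum>n\<le>N - k. (- complex_of_real t) ^ n / fact n * C_pair \<alpha> V n k)) \<le> K * t ^ Suc (N - k)"
      using simplex_chain_expansion[OF p' \<alpha> V k, of "N - k"] by (elim exE) (rule that)
    show "\<exists>K. \<forall>t>0. norm (complex_of_real (I k t) - (\<Sum>n\<le>N - k. (- complex_of_real t) ^ n / fact n * C_pair \<alpha> V n k)) \<le> K * t ^ Suc (N - k)"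
    proof (intro exI allI impI)
      fix t :: real assume t: "0 < t"
      interpret bounded_potential p' t "M t" "X t" V B by (rule BP[OF t])
      show "norm (complex_of_real (I k t) - (\<Sum>n\<le>N - k. (- complex_of_real t) ^ n / fact n * C_pair \<alpha> V n k)) \<le> K * t ^ Suc (N - k)"
        unfolding I_def using kernel_term_integral(3)[OF k]
        by (intro K[rule_format, OF t]) (auto simp: chain_integral_def inner_density_def)
    qed
  qed
  then obtain K where K: "\<And>k t. k \<in> {2..N} \<Longrightarrow> 0 < t \<Longrightarrow>
      norm (complex_of_real (I k t) - (\<Sum>n\<le>N - k. (- complex_of_real t) ^ n / fact n * C_pair \<alpha> V n k)) \<le> K k * t ^ Suc (N - k)"
    by metis
  \<comment> \<open>The first summand bounds the remainder of the exponential series, with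
    \<open>exp (t * B) \<le> exp B\<close> for \<open>t < 1\<close>; the sum collects the Taylor
    remainders of the phases.\<close>
  define D where "D = exp B * B ^ N * (\<integral>x. \<bar>V x\<bar> \<partial>lborel) + (\<Sum>k=2..N. K k)"
  have B0: "0 \<le> B" using B[of 0] by linarith
  have main: "norm (complex_of_real (heat_content p M X V t) -
            (- complex_of_real t * complex_of_real (\<integral>\<theta>. V \<theta> \<partial>lborel) +
             (\<Sum>m=2..N. (- complex_of_real t) ^ m * C_coeff \<alpha> V m))) \<le> D * norm (complex_of_real (t ^ (N + 1)))"
    if t: "0 < t" "t < 1" for t
  proof -
    let ?z = "- complex_of_real t"
    let ?Q = "\<lambda>k. \<Sum>n\<le>N - k. ?z ^ n / fact n * C_pair \<alpha> V n k"
    have "{1..N} = insert 1 {2..N}" using assms(6) by auto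
    then have split: "complex_of_real (\<Sum>k=1..N. (- t) ^ k * I k t) = ?z * complex_of_real (\<integral>\<theta>. V \<theta> \<partial>lborel) + (\<Sum>k=2..N. ?z ^ k * complex_of_real (I k t))"
      by (simp add: I1[OF t(1)])
    have "complex_of_real (heat_content p M X V t) -
            (?z * complex_of_real (\<integral>\<theta>. V \<theta> \<partial>lborel) + (\<Sum>m=2..N. ?z ^ m * C_coeff \<alpha> V m)) =
        complex_of_real (heat_content p M X V t - (\<Sum>k=1..N. (- t) ^ k * I k t)) + (\<Sum>k=2..N. ?z ^ k * (complex_of_real (I k t) - ?Q k))"
      unfolding C_coeff_sum of_real_diff split by (simp add: right_diff_distrib sum_subtractf)
    also have "norm \<dots> \<le> exp (t * B) * (t * B) ^ N * t * (\<integral>x. \<bar>V x\<bar> \<partial>lborel) + (\<Sum>k=2..N. K k * t ^ (N + 1))"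
    proof (rule order_trans[OF norm_triangle_ineq add_mono])
      show "norm (complex_of_real (heat_content p M X V t - (\<Sum>k=1..N. (- t) ^ k * I k t))) \<le> exp (t * B) * (t * B) ^ N * t * (\<integral>x. \<bar>V x\<bar> \<partial>lborel)"
        using heat[OF t(1)] unfolding norm_of_real .
      show "norm (\<Sum>k=2..N. ?z ^ k * (complex_of_real (I k t) - ?Q k)) \<le> (\<Sum>k=2..N. K k * t ^ (N + 1))"
      proof (rule order_trans[OF norm_sum sum_mono])
        fix k assume k: "k \<in> {2..N}"
        have "norm (?z ^ k * (complex_of_real (I k t) - ?Q k)) \<le> t ^ k * (K k * t ^ Suc (N - k))"
          using K[OF k t(1)] t by (simp add: norm_mult norm_power mult_left_mono)
        also have "\<dots> = K k * (t ^ k * t ^ Suc (N - k))" by (simp only: mult.left_commute)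
        also have "t ^ k * t ^ Suc (N - k) = t ^ (N + 1)"
          using k unfolding power_add[symmetric] by (intro arg_cong[where f="\<lambda>n. t ^ n"]) auto
        finally show "norm (?z ^ k * (complex_of_real (I k t) - ?Q k)) \<le> K k * t ^ (N + 1)" .
      qed
    qed
    also have "\<dots> \<le> D * t ^ (N + 1)"
    proof -
      have "t * B \<le> 1 * B" using t B0 by (intro mult_right_mono) auto
      then have "exp (t * B) * (B ^ N * (\<integral>x. \<bar>V x\<bar> \<partial>lborel) * t ^ (N + 1)) \<le> exp B * (B ^ N * (\<integral>x. \<bar>V x\<bar> \<partial>lborel) * t ^ (N + 1))"
        using t B0 by (intro mult_right_mono mult_nonneg_nonneg) auto
      moreover have "exp (t * B) * (t * B) ^ N * t * (\<integral>x. \<bar>V x\<bar> \<partial>lborel) = exp (t * B) * (B ^ N * (\<integral>x. \<bar>V x\<bar> \<partial>lborel) * t ^ (N + 1))"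
        by (simp add: power_mult_distrib power_add mult_ac)
      moreover have "D * t ^ (N + 1) = exp B * (B ^ N * (\<integral>x. \<bar>V x\<bar> \<partial>lborel) * t ^ (N + 1)) + (\<Sum>k=2..N. K k * t ^ (N + 1))"
        by (simp only: D_def distrib_right sum_distrib_right mult.assoc)
      ultimately show ?thesis by linarith
    qed
    finally show ?thesis using t by (simp add: norm_power norm_mult)
  qed
  show ?thesis
  proof (rule bigoI)
    show "\<forall>\<^sub>F t in at_right 0. norm (complex_of_real (heat_content p M X V t) -
            (- complex_of_real t * complex_of_real (\<integral>\<theta>. V \<theta> \<partial>lborel) +
             (\<Sum>m=2..N. (- complex_of_real t) ^ m * C_coeff \<alpha> V m))) \<le> D * norm (complex_of_real (t ^ (N + 1)))"
      using main by (auto simp: eventually_at_right_field intro!: exI[of _ 1])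
  qed
qed

end
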